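(* Let $G$ be a locally compact (Hausdorff) abelian group. The map $\beta_G:(\Delta(L^1(G),\star_c),\tau^* )\to(\mathcal{COS}(G),\tau_{ucc})$ is an open map.
   Context: $G$ is written additively, with Haar measure used in all integrals; $L^1(G)$ is the space of complex-valued integrable functions on $G$ (modulo a.e. equality). The cosine convolution of $f,g\in L^1(G)$ is $$f\star_c g(x) := \int_G f(y)\cdot\frac{g(x+y)+g(x-y)}{2}\,dy,$$ which is finite for almost every $x\in G$ and makes $L^1(G)$ a (not necessarily commutative) Banach algebra. $\Delta(L^1(G),\star_c)$ denotes the set of all nonzero continuous $\mathbb{C}$-linear maps $m:L^1(G)\to\mathbb{C}$ which are multiplicative: $m(f\star_c g)=m(f)m(g)$ for all $f,g\in L^1(G)$. It carries the weak* topology $\tau^*$ (as a subset of the dual of $L^1(G)$). With $C^b(G)$ the space of bounded continuous functions $G\to\mathbb{C}$, the cosine class is $$\mathcal{COS}(G) := \left\{\phi\in C^b(G) : \phi\neq 0,\ \forall_{x,y\in G}\ \phi(x)\phi(y)=\frac{\phi(x+y)+\phi(x-y)}{2}\right\},$$ and $\tau_{ucc}$ is the topology of uniform convergence on compact subsets of $G$. For every $m\in\Delta(L^1(G),\star_c)$ there is a unique $\phi\in\mathcal{COS}(G)$ such that $m(f)=\int_G f(x)\phi(x)\,dx$ for all $f\in L^1(G)$; $\beta_G(m)$ is defined to be this $\phi$, and $\beta_G$ is a bijection. *)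

theory Defs
  imports "HOL-Analysis.Analysis"
begin

(* A Haar measure is a nonzero translation invariant Radon measure on the Borel sets.
   Regularity is stated in the usual form that does not need sigma-compactness: outer
   regularity on Borel sets, inner regularity on open sets. Invariance under left
   translations suffices, since the group is commutative. *)
definition haar_measure :: "'a::{topological_ab_group_add, t2_space} measure \<Rightarrow> bool" where
  "haar_measure \<mu> \<longleftrightarrow>
     sets \<mu> = sets borel \<and>
     emeasure \<mu> UNIV \<noteq> 0 \<and>
     (\<forall>a. \<forall>A\<in>sets borel. emeasure \<mu> ((+) a ` A) = emeasure \<mu> A) \<and>
     (\<forall>K. compact K \<longrightarrow> emeasure \<mu> K < \<infinity>) \<and>
     (\<forall>A\<in>sets borel. emeasure \<mu> A = (INF U\<in>{U. open U \<and> A \<subseteq> U}. emeasure \<mu> U)) \<and>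
     (\<forall>U. open U \<longrightarrow> emeasure \<mu> U = (SUP K\<in>{K. compact K \<and> K \<subseteq> U}. emeasure \<mu> K))"

definition L1_rel :: "'a measure \<Rightarrow> (('a \<Rightarrow> complex) \<times> ('a \<Rightarrow> complex)) set" where
  "L1_rel \<mu> = {(f, g). integrable \<mu> f \<and> integrable \<mu> g \<and> (AE x in \<mu>. f x = g x)}"

definition L1 :: "'a measure \<Rightarrow> ('a \<Rightarrow> complex) set set" where
  "L1 \<mu> = {f. integrable \<mu> f} // L1_rel \<mu>"

definition L1_class :: "'a measure \<Rightarrow> ('a \<Rightarrow> complex) \<Rightarrow> ('a \<Rightarrow> complex) set" where
  "L1_class \<mu> f = L1_rel \<mu> `` {f}"

(* Functionals are total functions of HOL, made unique by being undefined outside of L1.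
   Linearity and continuity (for the L1 norm) are expressed on representatives. *)
definition L1_dual :: "'a measure \<Rightarrow> (('a \<Rightarrow> complex) set \<Rightarrow> complex) set" where
  "L1_dual \<mu> = {m \<in> extensional (L1 \<mu>).
     (\<forall>f g. integrable \<mu> f \<longrightarrow> integrable \<mu> g \<longrightarrow>
        m (L1_class \<mu> (\<lambda>x. f x + g x)) = m (L1_class \<mu> f) + m (L1_class \<mu> g)) \<and>
     (\<forall>c f. integrable \<mu> f \<longrightarrow> m (L1_class \<mu> (\<lambda>x. c * f x)) = c * m (L1_class \<mu> f)) \<and>
     (\<forall>f. integrable \<mu> f \<longrightarrow> (\<forall>\<epsilon>>0. \<exists>\<delta>>0. \<forall>g. integrable \<mu> g \<longrightarrow>
        (\<integral>x. norm (g x - f x) \<partial>\<mu>) < \<delta> \<longrightarrow>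
          dist (m (L1_class \<mu> g)) (m (L1_class \<mu> f)) < \<epsilon>))}"

definition weak_star_topology :: "'a measure \<Rightarrow> (('a \<Rightarrow> complex) set \<Rightarrow> complex) topology" where
  "weak_star_topology \<mu> = subtopology (product_topology (\<lambda>_. euclidean) (L1 \<mu>)) (L1_dual \<mu>)"

(* At the (null set of) points where the integrand is not integrable, the value is 0. *)
definition cos_conv ::
  "'a::{topological_ab_group_add, t2_space} measure \<Rightarrow>
     ('a \<Rightarrow> complex) \<Rightarrow> ('a \<Rightarrow> complex) \<Rightarrow> 'a \<Rightarrow> complex" where
  "cos_conv \<mu> f g x = (\<integral>y. f y * ((g (x + y) + g (x - y)) / 2) \<partial>\<mu>)"

definition cos_spectrum ::
  "'a::{topological_ab_group_add, t2_space} measure \<Rightarrow> (('a \<Rightarrow> complex) set \<Rightarrow> complex) set" where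
  "cos_spectrum \<mu> = {m \<in> L1_dual \<mu>.
     (\<exists>F\<in>L1 \<mu>. m F \<noteq> 0) \<and>
     (\<forall>f g. integrable \<mu> f \<longrightarrow> integrable \<mu> g \<longrightarrow>
        m (L1_class \<mu> (cos_conv \<mu> f g)) = m (L1_class \<mu> f) * m (L1_class \<mu> g))}"

definition cos_class :: "('a::{topological_ab_group_add, t2_space} \<Rightarrow> complex) set" where
  "cos_class = {\<phi> \<in> bcontfun. \<phi> \<noteq> (\<lambda>_. 0) \<and>
     (\<forall>x y. \<phi> x * \<phi> y = (\<phi> (x + y) + \<phi> (x - y)) / 2)}"

definition ucc_topology ::
  "('a::topological_space \<Rightarrow> 'b::metric_space) set \<Rightarrow> ('a \<Rightarrow> 'b) topology" where
  "ucc_topology S = topology (\<lambda>U. U \<subseteq> S \<and>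
     (\<forall>\<phi>\<in>U. \<exists>K \<epsilon>. compact K \<and> \<epsilon> > 0 \<and>
        {\<psi> \<in> S. \<forall>x\<in>K. dist (\<psi> x) (\<phi> x) < \<epsilon>} \<subseteq> U))"

lemma openin_ucc_topology:
  fixes S :: "('a::topological_space \<Rightarrow> 'b::metric_space) set"
  shows "openin (ucc_topology S) U \<longleftrightarrow> U \<subseteq> S \<and>
     (\<forall>\<phi>\<in>U. \<exists>K \<epsilon>. compact K \<and> \<epsilon> > 0 \<and>
        {\<psi> \<in> S. \<forall>x\<in>K. dist (\<psi> x) (\<phi> x) < \<epsilon>} \<subseteq> U)"
proof -
  define B where "B \<phi> K \<epsilon> = {\<psi> \<in> S. \<forall>x\<in>K. dist (\<psi> x) (\<phi> x) < \<epsilon>}"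
    for \<phi> :: "'a \<Rightarrow> 'b" and K and \<epsilon> :: real
  define P where "P U \<longleftrightarrow> U \<subseteq> S \<and> (\<forall>\<phi>\<in>U. \<exists>K \<epsilon>. compact K \<and> \<epsilon> > 0 \<and> B \<phi> K \<epsilon> \<subseteq> U)" for U
  have B_mono: "B \<phi> (K \<union> L) (min \<epsilon> \<delta>) \<subseteq> B \<phi> K \<epsilon> \<inter> B \<phi> L \<delta>" for \<phi> K L \<epsilon> \<delta>
    unfolding B_def by auto
  have P_D: "\<exists>K \<epsilon>. compact K \<and> \<epsilon> > 0 \<and> B \<phi> K \<epsilon> \<subseteq> U" if "P U" "\<phi> \<in> U" for U \<phi>
    using that(1)[unfolded P_def, THEN conjunct2] that(2) by (rule bspec)
  have P_sub: "U \<subseteq> S" if "P U" for U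
    using that unfolding P_def by (rule conjunct1)
  have P_I: "P U" if "U \<subseteq> S" "\<And>\<phi>. \<phi> \<in> U \<Longrightarrow> \<exists>K \<epsilon>. compact K \<and> \<epsilon> > 0 \<and> B \<phi> K \<epsilon> \<subseteq> U" for U
    unfolding P_def using that by (intro conjI ballI)
  have inter: "P (U \<inter> V)" if U: "P U" and V: "P V" for U V
  proof (rule P_I)
    show "U \<inter> V \<subseteq> S" using P_sub[OF U] by (rule le_infI1)
    fix \<phi> assume \<phi>: "\<phi> \<in> U \<inter> V"
    from P_D[OF U IntD1[OF \<phi>]] obtain K \<epsilon> where 1: "compact K" "\<epsilon> > 0" "B \<phi> K \<epsilon> \<subseteq> U"
      by (elim exE conjE)
    from P_D[OF V IntD2[OF \<phi>]] obtain L \<delta> where 2: "compact L" "\<delta> > 0" "B \<phi> L \<delta> \<subseteq> V"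
      by (elim exE conjE)
    have "B \<phi> (K \<union> L) (min \<epsilon> \<delta>) \<subseteq> U \<inter> V"
      using B_mono Int_mono[OF 1(3) 2(3)] by (rule order_trans)
    moreover have "compact (K \<union> L)" using 1(1) 2(1) by (rule compact_Un)
    moreover have "min \<epsilon> \<delta> > 0" using 1(2) 2(2) by simp
    ultimately show "\<exists>K \<epsilon>. compact K \<and> \<epsilon> > 0 \<and> B \<phi> K \<epsilon> \<subseteq> U \<inter> V"
      by (intro exI conjI)
  qed
  have union: "P (\<Union>\<U>)" if \<U>: "\<And>U. U \<in> \<U> \<Longrightarrow> P U" for \<U>
  proof (rule P_I)
    show "\<Union>\<U> \<subseteq> S" using P_sub[OF \<U>] by (rule Union_least)
    fix \<phi> assume "\<phi> \<in> \<Union>\<U>"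
    then obtain U where U: "U \<in> \<U>" "\<phi> \<in> U" by (rule UnionE)
    from P_D[OF \<U>[OF U(1)] U(2)] obtain K \<epsilon> where 1: "compact K" "\<epsilon> > 0" "B \<phi> K \<epsilon> \<subseteq> U"
      by (elim exE conjE)
    have "B \<phi> K \<epsilon> \<subseteq> \<Union>\<U>"
      using 1(3) Union_upper[OF U(1)] by (rule order_trans)
    with 1(1,2) show "\<exists>K \<epsilon>. compact K \<and> \<epsilon> > 0 \<and> B \<phi> K \<epsilon> \<subseteq> \<Union>\<U>"
      by (intro exI conjI)
  qed
  have "istopology P"
    unfolding istopology_def using inter union by simp
  moreover have "ucc_topology S = topology P"
    unfolding ucc_topology_def P_def B_def ..
  ultimately have "openin (ucc_topology S) U \<longleftrightarrow> P U"
    by (simp add: topology_inverse')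
  then show ?thesis unfolding P_def B_def .
qed

lemma topspace_ucc_topology [simp]: "topspace (ucc_topology S) = S"
proof (rule subset_antisym)
  show "topspace (ucc_topology S) \<subseteq> S"
    using openin_topspace[of "ucc_topology S"] unfolding openin_ucc_topology by (rule conjunct1)
  have "\<exists>K \<epsilon>. compact K \<and> \<epsilon> > 0 \<and> {\<psi> \<in> S. \<forall>x\<in>K. dist (\<psi> x) (\<phi> x) < \<epsilon>} \<subseteq> S" for \<phi>
    by (rule exI[of _ "{}"], rule exI[of _ 1]) simp
  then have "openin (ucc_topology S) S"
    unfolding openin_ucc_topology by simp
  then show "S \<subseteq> topspace (ucc_topology S)" by (rule openin_subset)
qed

definition cos_beta ::
  "'a::{topological_ab_group_add, t2_space} measure \<Rightarrow>
     (('a \<Rightarrow> complex) set \<Rightarrow> complex) \<Rightarrow> 'a \<Rightarrow> complex" where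
  "cos_beta \<mu> m = (THE \<phi>. \<phi> \<in> cos_class \<and>
     (\<forall>f. integrable \<mu> f \<longrightarrow> m (L1_class \<mu> f) = (\<integral>x. f x * \<phi> x \<partial>\<mu>)))"

end

theory Submission
  imports Defs
begin

text \<open>
  Why \<open>cos_beta\<close> is open.  Write \<open>m\<^sub>\<phi>\<close> for the functional \<open>f \<mapsto> \<integral> f \<phi>\<close>.  If \<open>cos_beta\<close> is a
  bijection from the spectrum onto the cosine class with inverse \<open>\<phi> \<mapsto> m\<^sub>\<phi>\<close>, then openness is
  continuity of \<open>\<phi> \<mapsto> m\<^sub>\<phi>\<close> from the compact-open to the weak* topology, that is, continuity of
  \<open>\<phi> \<mapsto> \<integral> f \<phi>\<close> for each integrable \<open>f\<close>.  That is elementary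
  (\<open>cos_class_pairing_ucc_continuous\<close>): functions of the cosine class are bounded by 1
  (\<open>norm_cos_class_le_1\<close>), and \<open>f\<close> has small integral outside some compact \<open>K\<close>, so two functions
  that are close on \<open>K\<close> have close integrals against \<open>f\<close>.

  Nearly all of the work is the bijection.  Let \<open>S\<^sub>y g x = (g (x + y) + g (x - y)) / 2\<close>
  (\<open>cos_shift\<close>), so that \<open>f \<star> g\<close> is the average of the \<open>S\<^sub>y g\<close> with weight \<open>f y\<close>.  Everything
  follows from one identity (\<open>L1_dual_cos_conv\<close>), valid for every bounded functional \<open>m\<close>:
  \<open>m (f \<star> g) = \<integral> f y * m (S\<^sub>y g) dy\<close>.  In one direction, apply it to \<open>m\<^sub>\<phi>\<close>: the cosine equation
  says \<open>S\<^sub>y \<phi> = \<phi> y * \<phi>\<close>, the operators \<open>S\<^sub>y\<close> are symmetric, so \<open>m\<^sub>\<phi> (S\<^sub>y g) = \<phi> y * m\<^sub>\<phi> g\<close>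
  and \<open>m\<^sub>\<phi>\<close> is multiplicative.  In the other direction, let \<open>m\<close> be multiplicative with
  \<open>m g\<^sub>0 \<noteq> 0\<close>; then \<open>\<phi> y = m (S\<^sub>y g\<^sub>0) / m g\<^sub>0\<close> represents \<open>m\<close>, and comparing \<open>m (f \<star> g)\<close> with
  \<open>m f * m g\<close> for all \<open>f\<close> and \<open>g\<close> forces the cosine equation, because a bounded continuous
  function is determined by its integrals (\<open>bcontfun_determined_by_integrals\<close>).

  The identity itself holds because \<open>y \<mapsto> S\<^sub>y g\<close> is continuous in the \<open>L\<^sup>1\<close> norm: on a piece of
  the group where \<open>S\<^sub>y g\<close> is nearly constant both sides nearly agree, and finitely many such
  pieces exhaust \<open>f\<close> up to a small error.  This argument needs \<open>f \<star> g\<close> to be integrable, with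
  \<open>\<parallel>f \<star> g\<parallel> \<le> \<parallel>f\<parallel> \<parallel>g\<parallel>\<close>.  On a group without countable base the usual appeal to Fubini fails
  at two places: Haar measure need not be \<open>\<sigma>\<close>-finite, and the Borel sets of the square may be more
  than the product \<open>\<sigma>\<close>-algebra, so that \<open>(x, y) \<mapsto> g (x + y)\<close> need not be measurable for Borel
  \<open>g\<close>.  Both obstacles disappear after changing \<open>f\<close> and \<open>g\<close> on null sets, so that they become
  iterated pointwise limits of continuous functions of compact support (\<open>baire_representative_exists\<close>).  Such a
  change does not affect \<open>f \<star> g\<close> at any point (\<open>cos_conv_cong_AE\<close>).
\<close>

section \<open>Haar measure: regularity, positivity and translations\<close>

locale lca_haar =
  fixes \<mu> :: "'a::{topological_ab_group_add, t2_space} measure"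
  assumes locally_compact: "locally_compact_space (euclidean :: 'a topology)"
    and haar: "haar_measure \<mu>"
begin

lemma sets_haar [simp, measurable_cong]: "sets \<mu> = sets borel"
  by (rule haar[unfolded haar_measure_def, THEN conjunct1])

lemma borel_measurable_haar: "borel_measurable \<mu> = borel_measurable borel"
  by (rule measurable_cong_sets) simp_all

lemma space_haar [simp]: "space \<mu> = UNIV"
  using sets_eq_imp_space_eq[OF sets_haar] by simp

lemma emeasure_UNIV_haar: "emeasure \<mu> UNIV \<noteq> 0"
  by (rule haar[unfolded haar_measure_def, THEN conjunct2, THEN conjunct1])

lemma emeasure_translate: "A \<in> sets borel \<Longrightarrow> emeasure \<mu> ((+) a ` A) = emeasure \<mu> A"
  by (rule haar[unfolded haar_measure_def, THEN conjunct2, THEN conjunct2, THEN conjunct1, rule_format])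

lemma emeasure_compact_finite: "compact K \<Longrightarrow> emeasure \<mu> K < \<infinity>"
  by (rule haar[unfolded haar_measure_def, THEN conjunct2, THEN conjunct2, THEN conjunct2, THEN conjunct1, rule_format])

lemma emeasure_outer:
  "A \<in> sets borel \<Longrightarrow> emeasure \<mu> A = (INF U\<in>{U. open U \<and> A \<subseteq> U}. emeasure \<mu> U)"
  by (rule haar[unfolded haar_measure_def, THEN conjunct2, THEN conjunct2, THEN conjunct2, THEN conjunct2,
        THEN conjunct1, rule_format])

lemma emeasure_inner:
  "open U \<Longrightarrow> emeasure \<mu> U = (SUP K\<in>{K. compact K \<and> K \<subseteq> U}. emeasure \<mu> K)"
  by (rule haar[unfolded haar_measure_def, THEN conjunct2, THEN conjunct2, THEN conjunct2, THEN conjunct2,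
        THEN conjunct2, rule_format])

lemma outer_open:
  assumes "A \<in> sets borel" "emeasure \<mu> A < \<infinity>" "0 < \<epsilon>"
  obtains U where "open U" "A \<subseteq> U" "emeasure \<mu> U < \<infinity>" "measure \<mu> (U - A) < \<epsilon>"
proof -
  have "emeasure \<mu> A = (INF U\<in>{U. open U \<and> A \<subseteq> U}. emeasure \<mu> U)"
    using assms(1) by (rule emeasure_outer)
  moreover have A: "emeasure \<mu> A = ennreal (measure \<mu> A)"
    using assms(2) by (simp add: emeasure_eq_ennreal_measure)
  moreover have "emeasure \<mu> A < ennreal (measure \<mu> A + \<epsilon>)"
    using assms(3) by (simp add: A ennreal_less_iff)
  ultimately have "(INF U\<in>{U. open U \<and> A \<subseteq> U}. emeasure \<mu> U) < ennreal (measure \<mu> A + \<epsilon>)"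
    by metis
  then obtain U where U: "open U" "A \<subseteq> U" "emeasure \<mu> U < ennreal (measure \<mu> A + \<epsilon>)"
    by (auto simp: INF_less_iff)
  have finU: "emeasure \<mu> U < \<infinity>"
    using U(3) ennreal_less_top order_less_trans by fastforce
  then have "emeasure \<mu> U = ennreal (measure \<mu> U)"
    by (simp add: emeasure_eq_ennreal_measure)
  then have "measure \<mu> U < measure \<mu> A + \<epsilon>"
    using U(3) by (simp add: ennreal_less_iff)
  moreover have "measure \<mu> (U - A) = measure \<mu> U - measure \<mu> A"
    using assms U finU by (intro measurable_measure_Diff) (auto simp: fmeasurable_def)
  ultimately show ?thesis using that U finU by simp
qed

lemma inner_compact:
  assumes "open U" "emeasure \<mu> U < \<infinity>" "0 < \<epsilon>"
  obtains K where "compact K" "K \<subseteq> U" "measure \<mu> (U - K) < \<epsilon>"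
proof (cases "measure \<mu> U < \<epsilon>")
  case True
  then show ?thesis using that[of "{}"] by simp
next
  case False
  have eq: "emeasure \<mu> U = (SUP K\<in>{K. compact K \<and> K \<subseteq> U}. emeasure \<mu> K)"
    using assms(1) by (rule emeasure_inner)
  have U: "emeasure \<mu> U = ennreal (measure \<mu> U)"
    using assms(2) by (simp add: emeasure_eq_ennreal_measure)
  have "ennreal (measure \<mu> U - \<epsilon>) < emeasure \<mu> U"
    unfolding U using False assms(3) by (subst ennreal_less_iff) auto
  then have "ennreal (measure \<mu> U - \<epsilon>) < (SUP K\<in>{K. compact K \<and> K \<subseteq> U}. emeasure \<mu> K)"
    using eq by metis
  then obtain K where K: "compact K" "K \<subseteq> U" "ennreal (measure \<mu> U - \<epsilon>) < emeasure \<mu> K"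
    by (auto simp: less_SUP_iff)
  have KB: "K \<in> sets borel" using K(1) by (simp add: compact_imp_closed)
  have "emeasure \<mu> K = ennreal (measure \<mu> K)"
    using emeasure_compact_finite[OF K(1)] by (simp add: emeasure_eq_ennreal_measure)
  then have "measure \<mu> U - \<epsilon> < measure \<mu> K"
    using K(3) False by (simp add: ennreal_less_iff)
  moreover have "measure \<mu> (U - K) = measure \<mu> U - measure \<mu> K"
    using assms K KB by (intro measurable_measure_Diff) (auto simp: fmeasurable_def)
  ultimately show ?thesis using that K by simp
qed

text \<open>
  Finitely many translates of a nonempty open set cover a given compact set.  If one open set
  were null, so would be every compact set and, by inner regularity, the whole group.
\<close>

lemma emeasure_open_pos:
  assumes "open U" "x \<in> U"
  shows "emeasure \<mu> U \<noteq> 0"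
proof
  assume 0: "emeasure \<mu> U = 0"
  have "emeasure \<mu> K = 0" if K: "compact K" for K
  proof -
    have "open ((+) a ` U)" for a
    proof -
      have "(+) a ` U = (\<lambda>y. y - a) -` U"
        by (auto simp: image_iff algebra_simps intro!: bexI[of _ "_ - a"])
      then show ?thesis
        using assms(1) by (simp add: open_vimage continuous_intros)
    qed
    moreover have "K \<subseteq> (\<Union>a\<in>UNIV. (+) a ` U)"
    proof
      fix k assume "k \<in> K"
      have "k = (k - x) + x" by simp
      then show "k \<in> (\<Union>a\<in>UNIV. (+) a ` U)" using assms(2) by blast
    qed
    ultimately obtain C where C: "finite C" "K \<subseteq> (\<Union>a\<in>C. (+) a ` U)"
      using K by (meson compactE_image)
    have "emeasure \<mu> ((+) a ` U) = 0" for a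
      using assms(1) 0 by (simp add: emeasure_translate)
    then have "(+) a ` U \<in> null_sets \<mu>" for a
      using \<open>\<And>a. open ((+) a ` U)\<close> by (simp add: null_sets_def)
    then have "(\<Union>a\<in>C. (+) a ` U) \<in> null_sets \<mu>"
      using C(1) by (intro null_sets.finite_UN) auto
    then have "emeasure \<mu> K \<le> 0"
      using C(2) emeasure_mono[of K _ \<mu>] by (metis null_setsD1 null_setsD2)
    then show ?thesis by simp
  qed
  moreover have "emeasure \<mu> UNIV = (SUP K\<in>{K. compact K \<and> K \<subseteq> UNIV}. emeasure \<mu> K)"
    by (rule emeasure_inner) simp
  ultimately have "emeasure \<mu> UNIV \<le> 0" by (metis (mono_tags, lifting) SUP_least mem_Collect_eq order_refl)
  then have "emeasure \<mu> UNIV = 0" by simp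
  then show False using emeasure_UNIV_haar by contradiction
qed

lemma measurable_translate [measurable]: "(\<lambda>x. x + a) \<in> borel_measurable \<mu>"
  unfolding borel_measurable_haar
  by (rule borel_measurable_continuous_onI) (rule continuous_on_add[OF continuous_on_id continuous_on_const])

lemma distr_translate: "distr \<mu> borel (\<lambda>x. x + a) = \<mu>"
proof (rule measure_eqI)
  fix A assume "A \<in> sets (distr \<mu> borel (\<lambda>x. x + a))"
  then have A: "A \<in> sets borel" by simp
  have "(\<lambda>x. x + a) -` A = (+) (- a) ` A"
    by (auto simp: image_iff algebra_simps intro!: bexI[of _ "_ + a"])
  then show "emeasure (distr \<mu> borel (\<lambda>x. x + a)) A = emeasure \<mu> A"
    using A emeasure_translate[of A "- a"] by (simp add: emeasure_distr)
qed simp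

lemma integral_translate:
  fixes f :: "'a \<Rightarrow> 'b::{banach, second_countable_topology}"
  assumes "f \<in> borel_measurable borel"
  shows "(\<integral>x. f (x + a) \<partial>\<mu>) = (\<integral>x. f x \<partial>\<mu>)"
  using integral_distr[OF measurable_translate assms, of a] unfolding distr_translate by (rule sym)

lemma integrable_translate:
  fixes f :: "'a \<Rightarrow> 'b::{banach, second_countable_topology}"
  assumes "integrable \<mu> f"
  shows "integrable \<mu> (\<lambda>x. f (x + a))"
proof -
  have "f \<in> borel_measurable borel"
    using borel_measurable_integrable[OF assms] unfolding borel_measurable_haar .
  from integrable_distr_eq[OF measurable_translate this, of a] show ?thesis
    unfolding distr_translate using assms by (rule iffD1)
qed

lemma AE_translate:
  assumes "AE x in \<mu>. P x"
  shows "AE x in \<mu>. P (x + a)"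
proof -
  have "AE x in distr \<mu> borel (\<lambda>x. x + a). P x"
    unfolding distr_translate by (rule assms)
  then show ?thesis by (rule AE_distrD[OF measurable_translate])
qed

section \<open>The \<open>L\<^sup>1\<close> norm and density of indicators of compact sets\<close>

definition L1_norm :: "('a \<Rightarrow> complex) \<Rightarrow> real" where
  "L1_norm f = (\<integral>x. norm (f x) \<partial>\<mu>)"

lemma L1_norm_nonneg: "0 \<le> L1_norm f"
  by (simp add: L1_norm_def)

lemma L1_norm_add_le:
  assumes "integrable \<mu> f" "integrable \<mu> g"
  shows "L1_norm (\<lambda>x. f x + g x) \<le> L1_norm f + L1_norm g"
proof -
  have "L1_norm (\<lambda>x. f x + g x) \<le> (\<integral>x. norm (f x) + norm (g x) \<partial>\<mu>)"
    unfolding L1_norm_def using assms by (intro integral_mono norm_triangle_ineq) auto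
  also have "\<dots> = L1_norm f + L1_norm g"
    using assms by (simp add: L1_norm_def)
  finally show ?thesis .
qed

lemma L1_norm_scale: "L1_norm (\<lambda>x. c * f x) = norm c * L1_norm f"
  by (simp add: L1_norm_def norm_mult)

lemma L1_norm_minus_commute: "L1_norm (\<lambda>x. f x - g x) = L1_norm (\<lambda>x. g x - f x)"
  by (simp add: L1_norm_def norm_minus_commute)

lemma L1_norm_mono:
  assumes "integrable \<mu> f" "integrable \<mu> g" "\<And>x. norm (f x) \<le> norm (g x)"
  shows "L1_norm f \<le> L1_norm g"
  unfolding L1_norm_def using assms by (intro integral_mono) auto

lemma L1_norm_triangle:
  assumes "integrable \<mu> f" "integrable \<mu> g" "integrable \<mu> h"
  shows "L1_norm (\<lambda>x. f x - h x) \<le> L1_norm (\<lambda>x. f x - g x) + L1_norm (\<lambda>x. g x - h x)"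
  using L1_norm_add_le[of "\<lambda>x. f x - g x" "\<lambda>x. g x - h x"] assms by simp

lemma L1_norm_translate:
  assumes "integrable \<mu> f"
  shows "L1_norm (\<lambda>x. f (x + a)) = L1_norm f"
proof -
  have "f \<in> borel_measurable borel"
    using borel_measurable_integrable[OF assms] by (simp only: borel_measurable_haar)
  then have "(\<lambda>x. norm (f x)) \<in> borel_measurable borel" by measurable
  from integral_translate[OF this] show ?thesis unfolding L1_norm_def .
qed

lemma integrable_indicator_times:
  fixes f :: "'a \<Rightarrow> complex"
  assumes "A \<in> sets borel" "integrable \<mu> f"
  shows "integrable \<mu> (\<lambda>x. indicator A x * f x)"
proof -
  have "integrable \<mu> (\<lambda>x. indicator A x *\<^sub>R f x)"
    using assms by (intro integrable_mult_indicator) auto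
  moreover have "(\<lambda>x. indicator A x *\<^sub>R f x) = (\<lambda>x. indicator A x * f x)"
    by (auto split: split_indicator)
  ultimately show ?thesis by simp
qed

lemma integrable_complex_indicator:
  assumes "A \<in> sets borel" "emeasure \<mu> A < \<infinity>"
  shows "integrable \<mu> (indicator A :: 'a \<Rightarrow> complex)"
proof -
  have "integrable \<mu> (\<lambda>x. indicator A x *\<^sub>R (1::complex))"
    using assms by (intro integrable_scaleR_left integrable_real_indicator) auto
  moreover have "(\<lambda>x. indicator A x *\<^sub>R (1::complex)) = indicator A"
    by (auto split: split_indicator)
  ultimately show ?thesis by simp
qed

lemma integrable_indicator_compact: "compact K \<Longrightarrow> integrable \<mu> (indicator K :: 'a \<Rightarrow> complex)"
  by (intro integrable_complex_indicator emeasure_compact_finite)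
    (auto dest: compact_imp_closed)

text \<open>
  By outer and then inner regularity, the indicator of a Borel set of finite measure is an
  \<open>L\<^sup>1\<close> limit of indicators of compact sets; hence linear combinations of the latter are dense.
  The three approximation results below (compact tails, continuity of translation, Baire
  representatives) are instances of this induction.
\<close>

lemma L1_induct [consumes 1, case_names compact scale add limit]:
  fixes f :: "'a \<Rightarrow> complex"
  assumes "integrable \<mu> f"
    and compact: "\<And>K. compact K \<Longrightarrow> P (indicator K)"
    and scale: "\<And>c f. integrable \<mu> f \<Longrightarrow> P f \<Longrightarrow> P (\<lambda>x. c * f x)"
    and add: "\<And>f g. integrable \<mu> f \<Longrightarrow> P f \<Longrightarrow> integrable \<mu> g \<Longrightarrow> P g \<Longrightarrow> P (\<lambda>x. f x + g x)"
    and limit: "\<And>f. integrable \<mu> f \<Longrightarrow>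
       (\<And>\<epsilon>. 0 < \<epsilon> \<Longrightarrow> \<exists>g. integrable \<mu> g \<and> P g \<and> L1_norm (\<lambda>x. g x - f x) < \<epsilon>) \<Longrightarrow> P f"
  shows "P f"
  using assms(1)
proof (induction rule: integrable_induct)
  case (base A c)
  have A: "A \<in> sets borel" using base(1) by simp
  have intA: "integrable \<mu> (indicator A :: 'a \<Rightarrow> complex)"
    using A base(2) by (rule integrable_complex_indicator)
  have "P (indicator A)"
  proof (rule limit[OF intA])
    fix \<epsilon> :: real assume \<epsilon>: "0 < \<epsilon>"
    obtain U where U: "open U" "A \<subseteq> U" "emeasure \<mu> U < \<infinity>" "measure \<mu> (U - A) < \<epsilon> / 2"
      by (rule outer_open[OF A base(2) half_gt_zero[OF \<epsilon>]])
    obtain K where K: "compact K" "K \<subseteq> U" "measure \<mu> (U - K) < \<epsilon> / 2"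
      by (rule inner_compact[OF U(1,3) half_gt_zero[OF \<epsilon>]])
    have KB: "K \<in> sets borel" using K(1) by (simp add: compact_imp_closed)
    have sets: "U - A \<in> sets \<mu>" "U - K \<in> sets \<mu>" using A KB U(1) by auto
    have "emeasure \<mu> (U - A) < \<infinity>" "emeasure \<mu> (U - K) < \<infinity>"
      using U(1,3) emeasure_mono[of "U - A" U \<mu>] emeasure_mono[of "U - K" U \<mu>]
      by (auto simp: order_le_less_trans)
    then have ints: "integrable \<mu> (indicator (U - A) :: 'a \<Rightarrow> real)"
        "integrable \<mu> (indicator (U - K) :: 'a \<Rightarrow> real)"
      using sets by (simp_all add: integrable_real_indicator)
    have "L1_norm (\<lambda>x. indicator K x - indicator A x)
        \<le> (\<integral>x. indicator (U - A) x + indicator (U - K) x \<partial>\<mu>)"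
      unfolding L1_norm_def
      using ints intA integrable_indicator_compact[OF K(1)] U(2) K(2)
      by (intro integral_mono) (auto split: split_indicator)
    also have "\<dots> = measure \<mu> (U - A) + measure \<mu> (U - K)"
      using ints sets by simp
    also have "\<dots> < \<epsilon>" using U(4) K(3) by simp
    finally show "\<exists>g. integrable \<mu> g \<and> P g \<and> L1_norm (\<lambda>x. g x - indicator A x) < \<epsilon>"
      using compact[OF K(1)] integrable_indicator_compact[OF K(1)] by blast
  qed
  moreover have "(\<lambda>x. indicator A x *\<^sub>R c) = (\<lambda>x. c * indicator A x)"
    by (auto split: split_indicator)
  ultimately show ?case using scale[OF intA, of c] by simp
next
  case (add f g)
  show ?case by (rule assms(4)[OF add.hyps(1) add.IH(1) add.hyps(2) add.IH(2)])
next
  case (lim f s)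
  show ?case
  proof (rule limit[OF lim.hyps(4)])
    fix \<epsilon> :: real assume "0 < \<epsilon>"
    have "(\<lambda>i. \<integral>x. norm (s i x - f x) \<partial>\<mu>) \<longlonglongrightarrow> (\<integral>x. 0 \<partial>\<mu>)"
    proof (rule integral_dominated_convergence[where w="\<lambda>x. 3 * norm (f x)"])
      show "AE x in \<mu>. (\<lambda>i. norm (s i x - f x)) \<longlonglongrightarrow> 0"
        using lim.hyps(2) by (auto intro!: AE_I2 tendsto_norm_zero LIM_zero)
      show "AE x in \<mu>. norm (norm (s i x - f x)) \<le> 3 * norm (f x)" for i
      proof (rule AE_I2)
        fix x assume "x \<in> space \<mu>"
        have "norm (s i x - f x) \<le> norm (s i x) + norm (f x)" by (rule norm_triangle_ineq4)
        then show "norm (norm (s i x - f x)) \<le> 3 * norm (f x)"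
          using lim.hyps(3)[OF \<open>x \<in> space \<mu>\<close>, of i] by simp
      qed
    qed (use lim.hyps in auto)
    then have "(\<lambda>i. L1_norm (\<lambda>x. s i x - f x)) \<longlonglongrightarrow> 0" by (simp add: L1_norm_def)
    then have "\<forall>\<^sub>F i in sequentially. L1_norm (\<lambda>x. s i x - f x) < \<epsilon>"
      using \<open>0 < \<epsilon>\<close> by (rule order_tendstoD)
    then obtain i where "L1_norm (\<lambda>x. s i x - f x) < \<epsilon>"
      by (auto simp: eventually_sequentially)
    then show "\<exists>g. integrable \<mu> g \<and> P g \<and> L1_norm (\<lambda>x. g x - f x) < \<epsilon>"
      using lim.hyps(1) lim.IH by blast
  qed
qed

lemma L1_tail_compact:
  assumes "integrable \<mu> f" "0 < \<epsilon>"
  obtains K where "compact K" "L1_norm (\<lambda>x. indicator (- K) x * f x) < \<epsilon>"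
proof -
  have int: "integrable \<mu> (\<lambda>x. indicator (- K) x * f x)" if "compact K" "integrable \<mu> f"
    for K and f :: "'a \<Rightarrow> complex"
    using that compact_imp_closed[OF that(1)] by (intro integrable_indicator_times) auto
  have "\<forall>\<epsilon>>0. \<exists>K. compact K \<and> L1_norm (\<lambda>x. indicator (- K) x * f x) < \<epsilon>"
    using assms(1)
  proof (induction rule: L1_induct)
    case (compact K)
    have "(\<lambda>x. indicator (- K) x * indicator K x) = (\<lambda>x. 0::complex)"
      by (auto split: split_indicator)
    then have "L1_norm (\<lambda>x. indicator (- K) x * indicator K x) = 0"
      by (simp add: L1_norm_def)
    with compact show ?case by auto
  next
    case (scale c f)
    show ?case
    proof (intro allI impI)
      fix \<epsilon> :: real assume "0 < \<epsilon>"
      then have "0 < \<epsilon> / (norm c + 1)" by (simp add: add_nonneg_pos)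
      with scale(2) obtain K where K: "compact K" "L1_norm (\<lambda>x. indicator (- K) x * f x) < \<epsilon> / (norm c + 1)"
        by blast
      have "L1_norm (\<lambda>x. indicator (- K) x * (c * f x)) = norm c * L1_norm (\<lambda>x. indicator (- K) x * f x)"
        by (simp flip: L1_norm_scale add: mult_ac)
      also have "\<dots> \<le> (norm c + 1) * L1_norm (\<lambda>x. indicator (- K) x * f x)"
        by (simp add: distrib_right L1_norm_nonneg)
      also have "\<dots> < \<epsilon>" using K(2) by (simp add: pos_less_divide_eq add_nonneg_pos mult.commute)
      finally show "\<exists>K. compact K \<and> L1_norm (\<lambda>x. indicator (- K) x * (c * f x)) < \<epsilon>" using K(1) by blast
    qed
  next
    case (add f g)
    show ?case
    proof (intro allI impI)
      fix \<epsilon> :: real assume \<epsilon>: "0 < \<epsilon>"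
      obtain K where K: "compact K" "L1_norm (\<lambda>x. indicator (- K) x * f x) < \<epsilon> / 2"
        using add.IH(1) \<epsilon> by (meson half_gt_zero)
      obtain L where L: "compact L" "L1_norm (\<lambda>x. indicator (- L) x * g x) < \<epsilon> / 2"
        using add.IH(2) \<epsilon> by (meson half_gt_zero)
      have KL: "compact (K \<union> L)" using K L by blast
      have "L1_norm (\<lambda>x. indicator (- (K \<union> L)) x * (f x + g x))
          \<le> L1_norm (\<lambda>x. indicator (- (K \<union> L)) x * f x) + L1_norm (\<lambda>x. indicator (- (K \<union> L)) x * g x)"
        using L1_norm_add_le[OF int[OF KL add.hyps(1)] int[OF KL add.hyps(2)]] by (simp add: distrib_left)
      also have "\<dots> \<le> L1_norm (\<lambda>x. indicator (- K) x * f x) + L1_norm (\<lambda>x. indicator (- L) x * g x)"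
        by (intro add_mono L1_norm_mono int KL K L add.hyps) (auto split: split_indicator)
      finally show "\<exists>K. compact K \<and> L1_norm (\<lambda>x. indicator (- K) x * (f x + g x)) < \<epsilon>"
        using KL K(2) L(2) by (intro exI[of _ "K \<union> L"]) auto
    qed
  next
    case (limit f)
    show ?case
    proof (intro allI impI)
      fix \<epsilon> :: real assume \<epsilon>: "0 < \<epsilon>"
      then obtain g where g: "integrable \<mu> g" "L1_norm (\<lambda>x. g x - f x) < \<epsilon> / 2"
          "\<forall>\<epsilon>>0. \<exists>K. compact K \<and> L1_norm (\<lambda>x. indicator (- K) x * g x) < \<epsilon>"
        using limit(2)[of "\<epsilon> / 2"] by auto
      obtain K where K: "compact K" "L1_norm (\<lambda>x. indicator (- K) x * g x) < \<epsilon> / 2"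
        using g(3) \<epsilon> by (meson half_gt_zero)
      have fg: "integrable \<mu> (\<lambda>x. f x - g x)" using limit(1) g(1) by simp
      have "L1_norm (\<lambda>x. indicator (- K) x * f x)
          \<le> L1_norm (\<lambda>x. indicator (- K) x * (f x - g x)) + L1_norm (\<lambda>x. indicator (- K) x * g x)"
        using L1_norm_add_le[OF int[OF K(1) fg] int[OF K(1) g(1)]] by (simp add: right_diff_distrib)
      also have "L1_norm (\<lambda>x. indicator (- K) x * (f x - g x)) \<le> L1_norm (\<lambda>x. f x - g x)"
        by (intro L1_norm_mono int K fg) (auto split: split_indicator)
      also have "\<dots> = L1_norm (\<lambda>x. g x - f x)" by (rule L1_norm_minus_commute)
      finally show "\<exists>K. compact K \<and> L1_norm (\<lambda>x. indicator (- K) x * f x) < \<epsilon>"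
        using K g(2) by (intro exI[of _ K]) auto
    qed
  qed
  then show ?thesis using assms(2) that by blast
qed

text \<open>
  For the indicator of a compact \<open>K\<close>, choose an open \<open>U\<close> around \<open>K\<close> of nearly the same measure.
  By the tube lemma, small translates of \<open>K\<close> in either direction stay in \<open>U\<close>, so they differ
  from \<open>K\<close> only by translates of subsets of \<open>U - K\<close>.
\<close>

lemma L1_norm_translate_eventually:
  assumes "integrable \<mu> f" "0 < \<epsilon>"
  shows "\<forall>\<^sub>F a in nhds 0. L1_norm (\<lambda>x. f (x + a) - f x) < \<epsilon>"
  using assms
proof (induction arbitrary: \<epsilon> rule: L1_induct)
  case (compact K)
  have KB: "K \<in> sets borel" using compact(1) by (simp add: compact_imp_closed)
  obtain U where U: "open U" "K \<subseteq> U" "emeasure \<mu> U < \<infinity>" "measure \<mu> (U - K) < \<epsilon> / 2"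
    by (rule outer_open[OF KB emeasure_compact_finite[OF compact(1)] half_gt_zero[OF compact(2)]])
  \<comment> \<open>Translation by \<open>a\<close> and by \<open>- a\<close> are controlled at once.\<close>
  define W where "W = {p::'a \<times> 'a. snd p + fst p \<in> U \<and> snd p - fst p \<in> U}"
  have "open ((\<lambda>p::'a \<times> 'a. snd p + fst p) -` U \<inter> (\<lambda>p. snd p - fst p) -` U)"
    by (intro open_Int open_vimage U(1) continuous_on_add continuous_on_diff continuous_on_fst
        continuous_on_snd continuous_on_id)
  then have W: "open W" unfolding W_def by (simp add: vimage_def Int_def)
  have KW: "{0} \<times> K \<subseteq> W" using U(2) by (auto simp: W_def)
  obtain V where V: "0 \<in> V" "open V" "V \<times> K \<subseteq> W"
    using Elementary_Topology.tube_lemma[OF compact(1) W KW] by (elim exE conjE)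
  have sets: "U - K \<in> sets \<mu>" using KB U(1) by auto
  have fin: "emeasure \<mu> (U - K) < \<infinity>"
    using U(1,3) emeasure_mono[of "U - K" U \<mu>] by (auto simp: order_le_less_trans)
  have ind: "integrable \<mu> (indicator (U - K) :: 'a \<Rightarrow> real)"
    using sets fin by (simp add: integrable_real_indicator)
  have "L1_norm (\<lambda>x. indicator K (x + a) - indicator K x) < \<epsilon>" if "a \<in> V" for a
  proof -
    have "indicator K (x + a) \<noteq> (indicator K x :: complex) \<Longrightarrow> x \<in> U - K \<or> x + a \<in> U - K" for x
    proof -
      assume ne: "indicator K (x + a) \<noteq> (indicator K x :: complex)"
      show ?thesis
      proof (cases "x \<in> K")
        case True
        then have "(a, x) \<in> W" using that V(3) by blast
        then show ?thesis using True ne by (auto simp: W_def)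
      next
        case False
        then have "x + a \<in> K" using ne by (auto split: split_indicator_asm)
        then have "(a, x + a) \<in> W" using that V(3) by blast
        then show ?thesis using False by (auto simp: W_def)
      qed
    qed
    then have "norm (indicator K (x + a) - indicator K x :: complex)
        \<le> indicator (U - K) x + indicator (U - K) (x + a)" for x
      by (cases "indicator K (x + a) = (indicator K x :: complex)") (auto split: split_indicator)
    then have "L1_norm (\<lambda>x. indicator K (x + a) - indicator K x)
       \<le> (\<integral>x. indicator (U - K) x + indicator (U - K) (x + a) \<partial>\<mu>)"
      unfolding L1_norm_def using ind integrable_translate[OF ind]
        integrable_translate[OF integrable_indicator_compact[OF compact(1)], of a]
        integrable_indicator_compact[OF compact(1)]
      by (intro integral_mono) auto
    also have "\<dots> = (\<integral>x. indicator (U - K) x \<partial>\<mu>) + (\<integral>x. indicator (U - K) (x + a) \<partial>\<mu>)"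
      by (rule Bochner_Integration.integral_add[OF ind integrable_translate[OF ind]])

    also have "(\<integral>x. indicator (U - K) (x + a) \<partial>\<mu>) = (\<integral>x. indicator (U - K) x \<partial>\<mu> :: real)"
      using sets by (intro integral_translate borel_measurable_indicator) simp
    also have "(\<integral>x. indicator (U - K) x \<partial>\<mu>) + (\<integral>x. indicator (U - K) x \<partial>\<mu>) = 2 * measure \<mu> (U - K)"
      using sets by simp
    finally show ?thesis using U(4) by simp
  qed
  then show ?case using V unfolding eventually_nhds by blast
next
  case (scale c f)
  have "0 < \<epsilon> / (norm c + 1)" using scale(3) by (simp add: add_nonneg_pos)
  from scale(2)[OF this] show ?case
  proof eventually_elim
    case (elim a)
    have "L1_norm (\<lambda>x. c * f (x + a) - c * f x) = norm c * L1_norm (\<lambda>x. f (x + a) - f x)"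
      by (simp flip: L1_norm_scale add: right_diff_distrib)
    also have "\<dots> \<le> (norm c + 1) * L1_norm (\<lambda>x. f (x + a) - f x)"
      by (simp add: distrib_right L1_norm_nonneg)
    also have "\<dots> < \<epsilon>" using elim by (simp add: pos_less_divide_eq add_nonneg_pos mult.commute)
    finally show ?case .
  qed
next
  case (add f g)
  have "0 < \<epsilon> / 2" using add.prems by simp
  from add.IH[OF this] show ?case
  proof eventually_elim
    case (elim a)
    have "L1_norm (\<lambda>x. (f (x + a) - f x) + (g (x + a) - g x))
       \<le> L1_norm (\<lambda>x. f (x + a) - f x) + L1_norm (\<lambda>x. g (x + a) - g x)"
      using add.hyps by (intro L1_norm_add_le Bochner_Integration.integrable_diff integrable_translate) auto
    then show ?case using elim by (simp add: algebra_simps)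
  qed
next
  case (limit f)
  then obtain g where g: "integrable \<mu> g" "L1_norm (\<lambda>x. g x - f x) < \<epsilon> / 3"
      "\<And>\<epsilon>. 0 < \<epsilon> \<Longrightarrow> \<forall>\<^sub>F a in nhds 0. L1_norm (\<lambda>x. g (x + a) - g x) < \<epsilon>"
    using limit(2)[of "\<epsilon> / 3"] by auto
  have "0 < \<epsilon> / 3" using limit by simp
  from g(3)[OF this] show ?case
  proof eventually_elim
    case (elim a)
    have tr: "integrable \<mu> (\<lambda>x. f (x + a))" "integrable \<mu> (\<lambda>x. g (x + a))"
      using limit(1) g(1) by (auto intro: integrable_translate)
    have "L1_norm (\<lambda>x. f (x + a) - f x) \<le> L1_norm (\<lambda>x. f (x + a) - g (x + a)) + L1_norm (\<lambda>x. g (x + a) - f x)"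
      by (rule L1_norm_triangle[OF tr limit(1)])
    also have "L1_norm (\<lambda>x. g (x + a) - f x) \<le> L1_norm (\<lambda>x. g (x + a) - g x) + L1_norm (\<lambda>x. g x - f x)"
      by (rule L1_norm_triangle[OF tr(2) g(1) limit(1)])
    also have "L1_norm (\<lambda>x. f (x + a) - g (x + a)) = L1_norm (\<lambda>x. f x - g x)"
      using L1_norm_translate[of "\<lambda>x. f x - g x"] limit(1) g(1) by simp
    also have "\<dots> = L1_norm (\<lambda>x. g x - f x)" by (rule L1_norm_minus_commute)
    finally show ?case using elim g(2) by simp
  qed
qed

end

section \<open>\<open>\<sigma>\<close>-compact sets and joint measurability\<close>

definition sigma_compact :: "'a::topological_space set \<Rightarrow> bool" where
  "sigma_compact S \<longleftrightarrow> (\<exists>\<K>. countable \<K> \<and> (\<forall>K\<in>\<K>. compact K) \<and> S = \<Union>\<K>)"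

lemma compact_imp_sigma_compact: "compact K \<Longrightarrow> sigma_compact K"
  unfolding sigma_compact_def by (rule exI[of _ "{K}"]) simp

lemma sigma_compact_UN:
  assumes "countable I" "\<And>i. i \<in> I \<Longrightarrow> sigma_compact (S i)"
  shows "sigma_compact (\<Union>i\<in>I. S i)"
proof -
  from assms(2) have "\<forall>i\<in>I. \<exists>\<K>. countable \<K> \<and> (\<forall>K\<in>\<K>. compact K) \<and> S i = \<Union>\<K>"
    unfolding sigma_compact_def by blast
  then obtain \<K> where \<K>: "\<And>i. i \<in> I \<Longrightarrow> countable (\<K> i) \<and> (\<forall>K\<in>\<K> i. compact K) \<and> S i = \<Union>(\<K> i)"
    by metis
  show ?thesis unfolding sigma_compact_def
    by (rule exI[of _ "\<Union>i\<in>I. \<K> i"]) (use assms(1) \<K> in auto)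
qed

lemma sigma_compact_Un: "sigma_compact S \<Longrightarrow> sigma_compact T \<Longrightarrow> sigma_compact (S \<union> T)"
  using sigma_compact_UN[of "{S, T}" "\<lambda>X. X"] by auto

lemma sigma_compact_image:
  assumes "continuous_on UNIV f" "sigma_compact S"
  shows "sigma_compact (f ` S)"
proof -
  obtain \<K> where "countable \<K>" "\<forall>K\<in>\<K>. compact K" "S = \<Union>\<K>"
    using assms(2) unfolding sigma_compact_def by blast
  then show ?thesis unfolding sigma_compact_def
    by (intro exI[of _ "(`) f ` \<K>"])
      (auto intro: compact_continuous_image continuous_on_subset[OF assms(1)])
qed

lemma sigma_compact_Times:
  assumes "sigma_compact S" "sigma_compact T"
  shows "sigma_compact (S \<times> T)"
proof -
  obtain \<K> where \<K>: "countable \<K>" "\<forall>K\<in>\<K>. compact K" "S = \<Union>\<K>"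
    using assms(1) unfolding sigma_compact_def by blast
  obtain \<L> where \<L>: "countable \<L>" "\<forall>K\<in>\<L>. compact K" "T = \<Union>\<L>"
    using assms(2) unfolding sigma_compact_def by blast
  have "S \<times> T = (\<Union>p\<in>\<K> \<times> \<L>. fst p \<times> snd p)" using \<K>(3) \<L>(3) by fastforce
  also have "sigma_compact \<dots>"
    using \<K> \<L> by (intro sigma_compact_UN compact_imp_sigma_compact) (auto intro: compact_Times)
  finally show ?thesis .
qed

lemma sigma_compact_borel:
  assumes "sigma_compact (S :: 'a::t2_space set)"
  shows "S \<in> sets borel"
proof -
  obtain \<K> where \<K>: "countable \<K>" "\<forall>K\<in>\<K>. compact K" "S = \<Union>\<K>"
    using assms unfolding sigma_compact_def by blast
  have "\<K> \<subseteq> sets borel"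
    using \<K>(2) by (blast intro: borel_closed compact_imp_closed)
  then show ?thesis
    unfolding \<K>(3) using \<K>(1) by (intro sets.countable_Union)
qed

lemma product_borel_between_compact_open:
  fixes C :: "('a::topological_space \<times> 'b::topological_space) set"
  assumes "compact C" "open W" "C \<subseteq> W"
  obtains R where "R \<in> sets (borel \<Otimes>\<^sub>M borel)" "C \<subseteq> R" "R \<subseteq> W"
proof -
  have "\<forall>p\<in>C. \<exists>A B. open A \<and> open B \<and> p \<in> A \<times> B \<and> A \<times> B \<subseteq> W"
  proof
    fix p assume "p \<in> C"
    then have "p \<in> W" using assms(3) by blast
    then show "\<exists>A B. open A \<and> open B \<and> p \<in> A \<times> B \<and> A \<times> B \<subseteq> W"
      by (rule open_prod_elim[OF assms(2)]) (intro exI conjI)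
  qed
  from bchoice[OF this] obtain A where
    "\<forall>p\<in>C. \<exists>B. open (A p) \<and> open B \<and> p \<in> A p \<times> B \<and> A p \<times> B \<subseteq> W" by (elim exE)
  from bchoice[OF this] obtain B where
    AB: "\<forall>p\<in>C. open (A p) \<and> open (B p) \<and> p \<in> A p \<times> B p \<and> A p \<times> B p \<subseteq> W" by (elim exE)
  have "\<And>p. p \<in> C \<Longrightarrow> open (A p \<times> B p)" using AB by (simp add: open_Times)
  moreover have "C \<subseteq> (\<Union>p\<in>C. A p \<times> B p)" using AB by blast
  ultimately obtain D where D: "D \<subseteq> C" "finite D" "C \<subseteq> (\<Union>p\<in>D. A p \<times> B p)"
    by (rule compactE_image[OF assms(1)])
  have "(\<Union>p\<in>D. A p \<times> B p) \<in> sets (borel \<Otimes>\<^sub>M borel)"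
    using D AB by (intro sets.finite_UN pair_measureI) auto
  moreover have "(\<Union>p\<in>D. A p \<times> B p) \<subseteq> W" using D(1) AB by blast
  ultimately show ?thesis using that D(3) by blast
qed

text \<open>
  On a \<open>\<sigma>\<close>-compact rectangle, the open set \<open>{F > c}\<close> is the union of the \<open>\<sigma>\<close>-compact sets
  \<open>{F \<ge> c + 1/n}\<close>, and each compact piece is covered by finitely many open rectangles inside
  \<open>{F > c}\<close>.  This is the point where continuous functions of two variables behave better than
  Borel ones.
\<close>

lemma continuous_greater_in_product_borel:
  fixes F :: "'a::t2_space \<times> 'b::t2_space \<Rightarrow> real"
  assumes F: "continuous_on UNIV F" and "sigma_compact S" "sigma_compact T"
  shows "{p \<in> S \<times> T. c < F p} \<in> sets (borel \<Otimes>\<^sub>M borel)"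
proof -
  obtain \<Q> where \<Q>: "countable \<Q>" "\<forall>Q\<in>\<Q>. compact Q" "S \<times> T = \<Union>\<Q>"
    using sigma_compact_Times[OF assms(2,3)] unfolding sigma_compact_def by (elim exE conjE)
  define W where "W = {p. c < F p}"
  have W: "open W" unfolding W_def by (intro open_Collect_less continuous_on_const F)
  define C where "C Q n = Q \<inter> {p. c + inverse (real (Suc n)) \<le> F p}" for Q n
  have "compact (C Q n)" if "Q \<in> \<Q>" for Q n
    unfolding C_def using \<Q>(2) that
    by (intro compact_Int_closed closed_Collect_le continuous_on_const F) auto
  moreover have "C Q n \<subseteq> W" for Q n
  proof
    fix p assume "p \<in> C Q n"
    moreover have "0 < inverse (real (Suc n))" by simp
    ultimately show "p \<in> W" unfolding C_def W_def by (auto simp del: inverse_positive_iff_positive)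
  qed
  ultimately have "\<forall>Q n. \<exists>R. Q \<in> \<Q> \<longrightarrow> R \<in> sets (borel \<Otimes>\<^sub>M borel) \<and> C Q n \<subseteq> R \<and> R \<subseteq> W"
    by (metis product_borel_between_compact_open[OF _ W])
  then obtain R where R: "\<And>Q n. Q \<in> \<Q> \<Longrightarrow> R Q n \<in> sets (borel \<Otimes>\<^sub>M borel) \<and> C Q n \<subseteq> R Q n \<and> R Q n \<subseteq> W"
    by metis
  have "{p \<in> S \<times> T. c < F p} = (S \<times> T) \<inter> (\<Union>Q\<in>\<Q>. \<Union>n. R Q n)"
  proof (intro subset_antisym subsetI)
    fix p assume p: "p \<in> {p \<in> S \<times> T. c < F p}"
    then obtain Q where Q: "Q \<in> \<Q>" "p \<in> Q" using \<Q>(3) by blast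
    have "0 < F p - c" using p by simp
    then obtain n where "inverse (real (Suc n)) < F p - c" using reals_Archimedean by blast
    then have "p \<in> C Q n" using Q unfolding C_def by simp
    then show "p \<in> (S \<times> T) \<inter> (\<Union>Q\<in>\<Q>. \<Union>n. R Q n)" using R[OF Q(1)] Q(1) p by blast
  next
    fix p assume p: "p \<in> (S \<times> T) \<inter> (\<Union>Q\<in>\<Q>. \<Union>n. R Q n)"
    then have "p \<in> W" using R by blast
    with p show "p \<in> {p \<in> S \<times> T. c < F p}" unfolding W_def by blast
  qed
  also have "\<dots> \<in> sets (borel \<Otimes>\<^sub>M borel)"
    using R \<Q>(1) sigma_compact_borel[OF assms(2)] sigma_compact_borel[OF assms(3)]
    by (intro sets.Int pair_measureI sets.countable_UN' sets.countable_UN) auto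
  finally show ?thesis .
qed

text \<open>
  The restriction to \<open>\<sigma>\<close>-compact squares is what makes every continuous \<open>h\<close> qualify.
\<close>

definition sum_measurable :: "('a::{topological_ab_group_add, t2_space} \<Rightarrow> complex) \<Rightarrow> bool" where
  "sum_measurable h \<longleftrightarrow> (\<forall>S. sigma_compact S \<longrightarrow>
     (\<lambda>p. indicator (S \<times> S) p * h (fst p + snd p)) \<in> borel_measurable (borel \<Otimes>\<^sub>M borel))"

lemma sum_measurable_continuous:
  fixes h :: "'a::{topological_ab_group_add, t2_space} \<Rightarrow> real"
  assumes "continuous_on UNIV h"
  shows "sum_measurable (\<lambda>x. complex_of_real (h x))"
  unfolding sum_measurable_def
proof (intro allI impI)
  fix S :: "'a set" assume S: "sigma_compact S"
  have SS: "S \<times> S \<in> sets (borel \<Otimes>\<^sub>M borel)"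
    using sigma_compact_borel[OF S] by (intro pair_measureI) auto
  have "continuous_on UNIV (\<lambda>p::'a \<times> 'a. fst p + snd p)"
    by (intro continuous_on_add continuous_on_fst continuous_on_snd continuous_on_id)
  then have cont: "continuous_on UNIV (\<lambda>p. h (fst p + snd p))"
    by (rule continuous_on_compose2[OF assms]) simp
  have "(\<lambda>p. indicator (S \<times> S) p * h (fst p + snd p)) \<in> borel_measurable (borel \<Otimes>\<^sub>M borel)"
    unfolding borel_measurable_iff_greater
  proof
    fix c :: real
    have "{p \<in> space (borel \<Otimes>\<^sub>M borel). c < indicator (S \<times> S) p * h (fst p + snd p)}
        = {p \<in> S \<times> S. c < h (fst p + snd p)} \<union> (if c < 0 then space (borel \<Otimes>\<^sub>M borel) - S \<times> S else {})"
      by (auto simp: space_pair_measure split: split_indicator_asm split_indicator)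
    also have "\<dots> \<in> sets (borel \<Otimes>\<^sub>M borel)"
      using continuous_greater_in_product_borel[OF cont S S] SS
      by (intro sets.Un) auto
    finally show "{p \<in> space (borel \<Otimes>\<^sub>M borel). c < indicator (S \<times> S) p * h (fst p + snd p)}
        \<in> sets (borel \<Otimes>\<^sub>M borel)" .
  qed
  then have "(\<lambda>p. complex_of_real (indicator (S \<times> S) p * h (fst p + snd p)))
      \<in> borel_measurable (borel \<Otimes>\<^sub>M borel)"
    by measurable
  then show "(\<lambda>p. indicator (S \<times> S) p * complex_of_real (h (fst p + snd p)))
      \<in> borel_measurable (borel \<Otimes>\<^sub>M borel)"
    by (rule back_subst[of "\<lambda>F. F \<in> _"]) (auto split: split_indicator)
qed

lemma sum_measurable_scale:
  assumes "sum_measurable h"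
  shows "sum_measurable (\<lambda>x. c * h x)"
  unfolding sum_measurable_def
proof (intro allI impI)
  fix S :: "'a set" assume "sigma_compact S"
  then have [measurable]: "(\<lambda>p. indicator (S \<times> S) p * h (fst p + snd p)) \<in> borel_measurable (borel \<Otimes>\<^sub>M borel)"
    using assms unfolding sum_measurable_def by blast
  have "(\<lambda>p. c * (indicator (S \<times> S) p * h (fst p + snd p))) \<in> borel_measurable (borel \<Otimes>\<^sub>M borel)"
    by measurable
  then show "(\<lambda>p. indicator (S \<times> S) p * (c * h (fst p + snd p))) \<in> borel_measurable (borel \<Otimes>\<^sub>M borel)"
    by (simp only: mult.left_commute)
qed

lemma sum_measurable_add:
  assumes "sum_measurable g" "sum_measurable h"
  shows "sum_measurable (\<lambda>x. g x + h x)"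
  unfolding sum_measurable_def
proof (intro allI impI)
  fix S :: "'a set" assume "sigma_compact S"
  then have [measurable]: "(\<lambda>p. indicator (S \<times> S) p * g (fst p + snd p)) \<in> borel_measurable (borel \<Otimes>\<^sub>M borel)"
      "(\<lambda>p. indicator (S \<times> S) p * h (fst p + snd p)) \<in> borel_measurable (borel \<Otimes>\<^sub>M borel)"
    using assms unfolding sum_measurable_def by blast+
  have "(\<lambda>p. indicator (S \<times> S) p * g (fst p + snd p) + indicator (S \<times> S) p * h (fst p + snd p))
      \<in> borel_measurable (borel \<Otimes>\<^sub>M borel)"
    by measurable
  then show "(\<lambda>p. indicator (S \<times> S) p * (g (fst p + snd p) + h (fst p + snd p)))
      \<in> borel_measurable (borel \<Otimes>\<^sub>M borel)"
    by (simp only: distrib_left)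
qed

lemma sum_measurable_lim:
  assumes "\<And>n. sum_measurable (h n)"
  shows "sum_measurable (\<lambda>x. lim (\<lambda>n. h n x))"
  unfolding sum_measurable_def
proof (intro allI impI)
  fix S :: "'a set" assume S: "sigma_compact S"
  have "(\<lambda>p. lim (\<lambda>n. indicator (S \<times> S) p * h n (fst p + snd p))) \<in> borel_measurable (borel \<Otimes>\<^sub>M borel)"
    using assms S unfolding sum_measurable_def by (intro borel_measurable_lim_metric) blast
  then show "(\<lambda>p. indicator (S \<times> S) p * lim (\<lambda>n. h n (fst p + snd p))) \<in> borel_measurable (borel \<Otimes>\<^sub>M borel)"
  proof (rule back_subst[of "\<lambda>F. F \<in> _"], intro ext)
    fix p :: "'a \<times> 'a"
    show "lim (\<lambda>n. indicator (S \<times> S) p * h n (fst p + snd p))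
        = indicator (S \<times> S) p * lim (\<lambda>n. h n (fst p + snd p))"
      by (cases "p \<in> S \<times> S") (simp_all add: limI)
  qed
qed

context lca_haar
begin

section \<open>Baire representatives of integrable functions\<close>

lemma Urysohn_compact_support:
  assumes "compact K" "open U" "K \<subseteq> U"
  obtains h :: "'a \<Rightarrow> real" and L where "continuous_on UNIV h" "\<And>x. 0 \<le> h x \<and> h x \<le> 1"
    "\<And>x. x \<in> K \<Longrightarrow> h x = 1" "\<And>x. x \<notin> U \<Longrightarrow> h x = 0" "compact L" "\<And>x. x \<notin> L \<Longrightarrow> h x = 0"
proof -
  have "Hausdorff_space (euclidean :: 'a topology)"
    unfolding Hausdorff_space_def disjnt_def using hausdorff by auto
  then have reg: "completely_regular_space (euclidean :: 'a topology)"
    using locally_compact by (intro locally_compact_regular_imp_completely_regular_space) auto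
  obtain V L where VL: "open V" "compact L" "K \<subseteq> V" "V \<subseteq> L"
    using locally_compact assms(1) locally_compact_space_compact_closed_compact[of "euclidean :: 'a topology"]
      \<open>Hausdorff_space euclidean\<close>
    by auto
  obtain h where h: "continuous_map euclidean (top_of_set {0..1::real}) h"
      "h ` (- (U \<inter> V)) \<subseteq> {0}" "h ` K \<subseteq> {1}"
    by (rule Urysohn_completely_regular_compact_closed[OF zero_le_one reg, of K "- (U \<inter> V)"])
      (use assms VL in \<open>auto simp: disjnt_def\<close>)
  show ?thesis
  proof
    show "continuous_on UNIV h" using h(1) by (simp add: continuous_map_in_subtopology)
    show "0 \<le> h x \<and> h x \<le> 1" for x
      using h(1) by (auto simp: continuous_map_in_subtopology Pi_iff image_subset_iff)
    show "compact L" by (rule VL(2))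
  qed (use h(2,3) VL in \<open>auto simp: image_subset_iff\<close>)
qed

text \<open>
  A version \<open>g\<close> of \<open>f\<close> to which Fubini can be applied: \<open>g (x + y)\<close> is jointly measurable, and
  \<open>g\<close> lives on a set on which Haar measure is \<open>\<sigma>\<close>-finite.
\<close>

definition baire_representative :: "('a \<Rightarrow> complex) \<Rightarrow> ('a \<Rightarrow> complex) \<Rightarrow> bool" where
  "baire_representative f g \<longleftrightarrow> integrable \<mu> g \<and> (AE x in \<mu>. g x = f x) \<and> sum_measurable g \<and>
     (\<exists>S. sigma_compact S \<and> (\<forall>x. x \<notin> S \<longrightarrow> g x = 0))"

text \<open>
  An \<open>L\<^sup>1\<close> convergent sequence has a subsequence converging almost everywhere.  The function
  \<open>lim\<close> is total, so the pointwise limit inherits joint measurability everywhere, including at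
  the points where the sequence diverges.
\<close>

lemma baire_representative_limit:
  assumes f: "integrable \<mu> f"
    and approx: "\<And>\<epsilon>. 0 < \<epsilon> \<Longrightarrow> \<exists>g. integrable \<mu> g \<and> (\<exists>g'. baire_representative g g') \<and> L1_norm (\<lambda>x. g x - f x) < \<epsilon>"
  shows "\<exists>g. baire_representative f g"
proof -
  have "\<exists>u. baire_representative u u \<and> L1_norm (\<lambda>x. u x - f x) < \<epsilon>" if "0 < \<epsilon>" for \<epsilon>
  proof -
    from approx[OF that] obtain g u where g: "integrable \<mu> g" "baire_representative g u"
        "L1_norm (\<lambda>x. g x - f x) < \<epsilon>" by blast
    have "L1_norm (\<lambda>x. u x - f x) = L1_norm (\<lambda>x. g x - f x)"
      unfolding L1_norm_def using g f unfolding baire_representative_def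
      by (intro integral_cong_AE) auto
    then show ?thesis using g unfolding baire_representative_def by auto
  qed
  then have "\<forall>n. \<exists>u. baire_representative u u \<and> L1_norm (\<lambda>x. u x - f x) < inverse (real (Suc n))"
    by simp
  then obtain u where u: "\<And>n. baire_representative (u n) (u n)"
      "\<And>n. L1_norm (\<lambda>x. u n x - f x) < inverse (real (Suc n))"
    by metis
  have int: "integrable \<mu> (u n)" and sm: "sum_measurable (u n)" for n
    using u(1) unfolding baire_representative_def by auto
  have "(\<lambda>n. L1_norm (\<lambda>x. u n x - f x)) \<longlonglongrightarrow> 0"
    by (rule tendsto_sandwich[OF _ _ tendsto_const LIMSEQ_inverse_real_of_nat])
      (use u(2)[THEN less_imp_le] in \<open>auto simp: L1_norm_nonneg simp del: of_nat_Suc\<close>)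
  then obtain r where r: "strict_mono r" "AE x in \<mu>. (\<lambda>n. u (r n) x - f x) \<longlonglongrightarrow> 0"
    using tendsto_L1_AE_subseq[of \<mu> "\<lambda>n x. u n x - f x"] int f unfolding L1_norm_def by auto
  define g where "g x = lim (\<lambda>n. u (r n) x)" for x
  have AE: "AE x in \<mu>. g x = f x"
    using r(2) by eventually_elim (simp add: g_def limI LIM_zero_iff)
  have [measurable]: "g \<in> borel_measurable \<mu>"
    unfolding g_def using int by (intro borel_measurable_lim_metric) auto
  have "integrable \<mu> g"
    using f AE by (subst integrable_cong_AE[of g \<mu> f]) auto
  moreover have "sum_measurable g"
    unfolding g_def by (rule sum_measurable_lim) (rule sm)
  moreover have "\<exists>S. sigma_compact S \<and> (\<forall>x. x \<notin> S \<longrightarrow> g x = 0)"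
  proof -
    obtain S where S: "\<And>n. sigma_compact (S n)" "\<And>n x. x \<notin> S n \<Longrightarrow> u n x = 0"
      using u(1) unfolding baire_representative_def by metis
    have "sigma_compact (\<Union>n. S n)" using S(1) by (intro sigma_compact_UN) auto
    moreover have "g x = 0" if "x \<notin> (\<Union>n. S n)" for x
      using that S(2) by (simp add: g_def limI)
    ultimately show ?thesis by blast
  qed
  ultimately show ?thesis using AE unfolding baire_representative_def by blast
qed

text \<open>
  The class of functions with a representative is linear and closed under \<open>L\<^sup>1\<close> limits, and the
  indicator of a compact set is an \<open>L\<^sup>1\<close> limit of Urysohn functions of compact support.
\<close>

lemma baire_representative_exists:
  assumes "integrable \<mu> f"
  shows "\<exists>g. baire_representative f g"
  using assms
proof (induction rule: L1_induct)
  case (compact K)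
  have KB: "K \<in> sets borel" using compact by (simp add: compact_imp_closed)
  show ?case
  proof (rule baire_representative_limit[OF integrable_indicator_compact[OF compact]])
    fix \<epsilon> :: real assume \<epsilon>: "0 < \<epsilon>"
    obtain U where U: "open U" "K \<subseteq> U" "emeasure \<mu> U < \<infinity>" "measure \<mu> (U - K) < \<epsilon>"
      by (rule outer_open[OF KB emeasure_compact_finite[OF compact] \<epsilon>])
    obtain h :: "'a \<Rightarrow> real" and L where h: "continuous_on UNIV h" "\<And>x. 0 \<le> h x \<and> h x \<le> 1"
        "\<And>x. x \<in> K \<Longrightarrow> h x = 1" "\<And>x. x \<notin> U \<Longrightarrow> h x = 0" "compact L" "\<And>x. x \<notin> L \<Longrightarrow> h x = 0"
      by (rule Urysohn_compact_support[OF compact U(1,2)]) blast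
    define g where "g = (\<lambda>x. complex_of_real (h x))"
    have hm: "h \<in> borel_measurable \<mu>"
      unfolding borel_measurable_haar using h(1) by (rule borel_measurable_continuous_onI)
    then have [measurable]: "g \<in> borel_measurable \<mu>" unfolding g_def by measurable
    have g: "integrable \<mu> g"
      by (rule Bochner_Integration.integrable_bound[OF integrable_indicator_compact[OF h(5)]])
        (use h(2,6) hm in \<open>auto simp: g_def split: split_indicator\<close>)
    have "baire_representative g g"
      unfolding baire_representative_def using g sum_measurable_continuous[OF h(1)]
        compact_imp_sigma_compact[OF h(5)] h(6) by (auto simp: g_def)
    moreover have "L1_norm (\<lambda>x. g x - indicator K x) < \<epsilon>"
    proof -
      have UK: "U - K \<in> sets borel" using KB U(1) by auto
      have fin: "emeasure \<mu> (U - K) < \<infinity>"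
        using U(1,3) emeasure_mono[of "U - K" U \<mu>] by (auto simp: order_le_less_trans)
      have ind: "integrable \<mu> (indicator (U - K) :: 'a \<Rightarrow> real)"
        using UK fin by (simp add: integrable_real_indicator)
      have "norm (g x - indicator K x) \<le> indicator (U - K) x" for x
        using h(2)[of x] h(3)[of x] h(4)[of x] by (cases "x \<in> K"; cases "x \<in> U") (auto simp: g_def)
      then have "L1_norm (\<lambda>x. g x - indicator K x) \<le> (\<integral>x. indicator (U - K) x \<partial>\<mu>)"
        unfolding L1_norm_def using g integrable_indicator_compact[OF compact] ind
        by (intro integral_mono) auto
      also have "\<dots> = measure \<mu> (U - K)" using UK by simp
      finally show ?thesis using U(4) by simp
    qed
    ultimately show "\<exists>g. integrable \<mu> g \<and> (\<exists>g'. baire_representative g g') \<and> L1_norm (\<lambda>x. g x - indicator K x) < \<epsilon>"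
      using g by blast
  qed
next
  case (scale c f)
  then obtain g where g: "baire_representative f g" by blast
  then have "baire_representative (\<lambda>x. c * f x) (\<lambda>x. c * g x)"
    unfolding baire_representative_def by (auto intro: sum_measurable_scale)
  then show ?case by blast
next
  case (add f1 f2)
  then obtain g1 g2 where g: "baire_representative f1 g1" "baire_representative f2 g2" by blast
  then obtain S1 S2 where S: "sigma_compact S1" "\<And>x. x \<notin> S1 \<Longrightarrow> g1 x = 0"
      "sigma_compact S2" "\<And>x. x \<notin> S2 \<Longrightarrow> g2 x = 0"
    unfolding baire_representative_def by blast
  have "AE x in \<mu>. g1 x + g2 x = f1 x + f2 x"
    using g unfolding baire_representative_def by (auto elim: eventually_elim2)
  then have "baire_representative (\<lambda>x. f1 x + f2 x) (\<lambda>x. g1 x + g2 x)"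
    using g sigma_compact_Un[OF S(1,3)] S(2,4) unfolding baire_representative_def
    by (auto intro!: sum_measurable_add exI[of _ "S1 \<union> S2"])
  then show ?case by blast
next
  case (limit f)
  show ?case by (rule baire_representative_limit[OF limit(1)]) (use limit(2) in blast)
qed

section \<open>Fubini for kernels of \<open>\<sigma>\<close>-compact support\<close>

text \<open>
  Haar measure cut down to a \<open>\<sigma>\<close>-compact set \<open>Q\<close> is \<open>\<sigma>\<close>-finite, and for a kernel supported in
  \<open>Q \<times> Q\<close> all iterated integrals agree with those for the restricted measure.  The third
  conclusion is Minkowski's integral inequality.
\<close>

lemma Fubini_sigma_compact_support:
  fixes e :: "'a \<Rightarrow> 'a \<Rightarrow> complex" and b :: "'a \<Rightarrow> real"
  assumes Q: "sigma_compact Q"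
    and meas: "(\<lambda>p. e (fst p) (snd p)) \<in> borel_measurable (borel \<Otimes>\<^sub>M borel)"
    and supp: "\<And>x y. x \<notin> Q \<or> y \<notin> Q \<Longrightarrow> e x y = 0"
    and sect: "\<And>y. integrable \<mu> (\<lambda>x. e x y)"
    and bound: "AE y in \<mu>. L1_norm (\<lambda>x. e x y) \<le> b y" and b: "integrable \<mu> b"
  shows "AE x in \<mu>. integrable \<mu> (\<lambda>y. e x y)"
    and "integrable \<mu> (\<lambda>x. \<integral>y. e x y \<partial>\<mu>)"
    and "L1_norm (\<lambda>x. \<integral>y. e x y \<partial>\<mu>) \<le> (\<integral>y. b y \<partial>\<mu>)"
    and "(\<integral>x. \<integral>y. e x y \<partial>\<mu> \<partial>\<mu>) = (\<integral>y. \<integral>x. e x y \<partial>\<mu> \<partial>\<mu>)"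
proof -
  \<comment> \<open>A density, rather than a restricted space, keeps all sets Borel in the full group.\<close>
  define \<nu> where "\<nu> = density \<mu> (\<lambda>x. ennreal (indicator Q x))"
  have QB: "Q \<in> sets borel" using Q by (rule sigma_compact_borel)
  have sets_\<nu> [measurable_cong]: "sets \<nu> = sets borel" by (simp add: \<nu>_def)
  have space_\<nu>: "space \<nu> = UNIV" by (simp add: \<nu>_def)
  have indQ: "(\<lambda>x. indicator Q x :: real) \<in> borel_measurable \<mu>" using QB by simp
  have sets_\<nu>\<nu>: "sets (\<nu> \<Otimes>\<^sub>M \<nu>) = sets (borel \<Otimes>\<^sub>M borel)"
    by (rule sets_pair_measure_cong[OF sets_\<nu> sets_\<nu>])
  obtain \<K> where \<K>: "countable \<K>" "\<forall>K\<in>\<K>. compact K" "Q = \<Union>\<K>"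
    using Q unfolding sigma_compact_def by (elim exE conjE)
  have em: "emeasure \<nu> A = emeasure \<mu> (Q \<inter> A)" if "A \<in> sets borel" for A
  proof -
    have "emeasure \<nu> A = (\<integral>\<^sup>+x. ennreal (indicator Q x) * indicator A x \<partial>\<mu>)"
      unfolding \<nu>_def using that indQ by (intro emeasure_density) auto
    also have "\<dots> = (\<integral>\<^sup>+x. indicator (Q \<inter> A) x \<partial>\<mu>)"
      by (intro nn_integral_cong) (auto split: split_indicator)
    finally show ?thesis using QB that by simp
  qed
  interpret \<nu>: sigma_finite_measure \<nu>
  proof
    have "\<forall>K\<in>\<K>. K \<in> sets borel" using \<K>(2) by (auto intro: borel_closed compact_imp_closed)
    moreover have "emeasure \<mu> (Q \<inter> K) \<noteq> \<infinity>" if "K \<in> \<K>" for K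
    proof -
      have "Q \<inter> K = K" using that \<K>(3) by blast
      then show ?thesis using emeasure_compact_finite \<K>(2) that by force
    qed
    ultimately show "\<exists>A. countable A \<and> A \<subseteq> sets \<nu> \<and> \<Union>A = space \<nu> \<and> (\<forall>a\<in>A. emeasure \<nu> a \<noteq> \<infinity>)"
      using \<K>(1,3) QB by (intro exI[of _ "insert (- Q) \<K>"]) (auto simp: sets_\<nu> space_\<nu> em)
  qed
  interpret \<nu>\<nu>: pair_sigma_finite \<nu> \<nu> ..
  have to_\<mu>: "integrable \<nu> F \<longleftrightarrow> integrable \<mu> F" "(\<integral>x. F x \<partial>\<nu>) = (\<integral>x. F x \<partial>\<mu>)"
    if "F \<in> borel_measurable borel" "\<And>x. x \<notin> Q \<Longrightarrow> F x = 0"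
    for F :: "'a \<Rightarrow> 'c::{banach, second_countable_topology}"
  proof -
    have F: "F \<in> borel_measurable \<mu>" using that(1) by (simp only: borel_measurable_haar)
    have eq: "(\<lambda>x. indicator Q x *\<^sub>R F x) = F"
      using that(2) by (auto split: split_indicator)
    show "integrable \<nu> F \<longleftrightarrow> integrable \<mu> F"
      using integrable_density[OF F indQ] by (simp add: \<nu>_def eq)
    show "(\<integral>x. F x \<partial>\<nu>) = (\<integral>x. F x \<partial>\<mu>)"
      using integral_density[OF F indQ] by (simp add: \<nu>_def eq)
  qed
  have AE_\<nu>: "AE x in \<nu>. P x" if "AE x in \<mu>. P x" for P
  proof -
    have m: "(\<lambda>x. ennreal (indicator Q x)) \<in> borel_measurable \<mu>" using QB by simp
    show ?thesis unfolding \<nu>_def AE_density[OF m] using that by eventually_elim simp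
  qed
  have sect_x: "(\<lambda>x. e x y) \<in> borel_measurable borel" for y
    using measurable_compose[OF measurable_Pair2'[of y borel borel] meas] by simp
  have sect_y: "(\<lambda>y. e x y) \<in> borel_measurable borel" for x
    using measurable_compose[OF measurable_Pair1'[of x borel borel] meas] by simp
  have E: "(\<lambda>(x, y). e x y) \<in> borel_measurable (\<nu> \<Otimes>\<^sub>M \<nu>)"
    using meas unfolding measurable_cong_sets[OF sets_\<nu>\<nu> refl[of "sets borel"]] by (simp add: case_prod_beta')
  have E': "(\<lambda>(y, x). e x y) \<in> borel_measurable (\<nu> \<Otimes>\<^sub>M \<nu>)"
    using measurable_compose[OF measurable_pair_swap' E] by (simp add: case_prod_beta')
  have L1: "(\<integral>x. norm (e x y) \<partial>\<nu>) = L1_norm (\<lambda>x. e x y)" for y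
    unfolding L1_norm_def using sect_x[of y] supp
    by (intro to_\<mu>) auto
  have intx: "integrable \<nu> (\<lambda>x. e x y)" for y
    using sect[of y] supp by (subst to_\<mu>(1)[OF sect_x]) auto
  have L1m: "(\<lambda>y. L1_norm (\<lambda>x. e x y)) \<in> borel_measurable \<nu>"
    unfolding L1[symmetric] using E'
    by (intro \<nu>.borel_measurable_lebesgue_integral) (simp add: case_prod_beta')
  have b\<nu>: "integrable \<nu> b"
  proof -
    have "b \<in> borel_measurable \<mu>" using b by (rule borel_measurable_integrable)
    then show ?thesis unfolding \<nu>_def using b QB
      by (subst integrable_density[OF _ indQ]) (use integrable_mult_indicator[of Q \<mu> b] in auto)
  qed
  have "integrable \<nu> (\<lambda>y. L1_norm (\<lambda>x. e x y))"
    by (rule Bochner_Integration.integrable_bound[OF b\<nu> L1m])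
      (rule AE_mp[OF AE_\<nu>[OF bound]], auto simp: L1_norm_nonneg intro: abs_ge_self order_trans)
  then have L1int: "integrable \<mu> (\<lambda>y. L1_norm (\<lambda>x. e x y))"
  proof (rule to_\<mu>(1)[THEN iffD1, rotated 2])
    show "(\<lambda>y. L1_norm (\<lambda>x. e x y)) \<in> borel_measurable borel"
      using L1m unfolding measurable_cong_sets[OF sets_\<nu> refl[of "sets borel"]] .
    show "L1_norm (\<lambda>x. e x y) = 0" if "y \<notin> Q" for y
      using supp that by (simp add: L1_norm_def)
  qed
  have "integrable (\<nu> \<Otimes>\<^sub>M \<nu>) (\<lambda>(y, x). e x y)"
    using E' \<open>integrable \<nu> (\<lambda>y. L1_norm (\<lambda>x. e x y))\<close>
    by (intro \<nu>\<nu>.Fubini_integrable) (auto simp: L1 intro: intx)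
  then have int: "integrable (\<nu> \<Otimes>\<^sub>M \<nu>) (\<lambda>(x, y). e x y)"
    using \<nu>\<nu>.integrable_product_swap[of "\<lambda>(y, x). e x y"] by simp
  have inner: "(\<integral>y. e x y \<partial>\<nu>) = (\<integral>y. e x y \<partial>\<mu>)" for x
    using supp by (intro to_\<mu>(2)[OF sect_y]) auto
  have inner': "(\<integral>x. e x y \<partial>\<nu>) = (\<integral>x. e x y \<partial>\<mu>)" for y
    using supp by (intro to_\<mu>(2)[OF sect_x]) auto
  have int_x: "integrable \<nu> (\<lambda>x. \<integral>y. e x y \<partial>\<mu>)"
    using \<nu>\<nu>.integrable_fst'[OF int] by (simp add: inner)
  have meas_x: "(\<lambda>x. \<integral>y. e x y \<partial>\<mu>) \<in> borel_measurable borel"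
    using borel_measurable_integrable[OF int_x]
    unfolding measurable_cong_sets[OF sets_\<nu> refl[of "sets borel"]] .
  have supp_x: "(\<integral>y. e x y \<partial>\<mu>) = 0" if "x \<notin> Q" for x
    using supp that by simp
  have "AE x in \<nu>. integrable \<nu> (\<lambda>y. e x y)"
    using \<nu>\<nu>.AE_integrable_fst'[OF int] by simp
  then have "AE x in \<mu>. 0 < ennreal (indicator Q x) \<longrightarrow> integrable \<nu> (\<lambda>y. e x y)"
    unfolding \<nu>_def using QB by (subst (asm) AE_density) auto
  then show "AE x in \<mu>. integrable \<mu> (\<lambda>y. e x y)"
  proof eventually_elim
    case (elim x)
    show ?case
    proof (cases "x \<in> Q")
      case True
      then have "integrable \<nu> (\<lambda>y. e x y)" using elim by simp
      then show ?thesis using supp by (subst (asm) to_\<mu>(1)[OF sect_y]) auto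
    next
      case False
      then show ?thesis using supp by simp
    qed
  qed
  show int_x': "integrable \<mu> (\<lambda>x. \<integral>y. e x y \<partial>\<mu>)"
    using int_x by (subst (asm) to_\<mu>(1)[OF meas_x supp_x])
  have "(\<integral>x. \<integral>y. e x y \<partial>\<mu> \<partial>\<mu>) = (\<integral>x. \<integral>y. e x y \<partial>\<nu> \<partial>\<nu>)"
    unfolding inner by (rule to_\<mu>(2)[OF meas_x supp_x, symmetric])
  also have "\<dots> = (\<integral>y. \<integral>x. e x y \<partial>\<nu> \<partial>\<nu>)"
    by (rule \<nu>\<nu>.Fubini_integral[OF int, symmetric])
  also have "\<dots> = (\<integral>y. \<integral>x. e x y \<partial>\<mu> \<partial>\<mu>)"
    unfolding inner'
  proof (rule to_\<mu>(2))
    have "(\<lambda>y. \<integral>x. e x y \<partial>\<nu>) \<in> borel_measurable \<nu>"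
      using E' by (intro \<nu>.borel_measurable_lebesgue_integral) (simp add: case_prod_beta')
    then show "(\<lambda>y. \<integral>x. e x y \<partial>\<mu>) \<in> borel_measurable borel"
      unfolding measurable_cong_sets[OF sets_\<nu> refl[of "sets borel"]] inner' .
  qed (use supp in simp)
  finally show "(\<integral>x. \<integral>y. e x y \<partial>\<mu> \<partial>\<mu>) = (\<integral>y. \<integral>x. e x y \<partial>\<mu> \<partial>\<mu>)" .
  have intn: "integrable (\<nu> \<Otimes>\<^sub>M \<nu>) (\<lambda>(x, y). norm (e x y))"
    using integrable_norm[OF int] by (simp add: case_prod_beta')
  have "L1_norm (\<lambda>x. \<integral>y. e x y \<partial>\<mu>) = (\<integral>x. norm (\<integral>y. e x y \<partial>\<nu>) \<partial>\<nu>)"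
    unfolding L1_norm_def inner using meas_x supp_x by (intro to_\<mu>(2)[symmetric]) auto
  also have "\<dots> \<le> (\<integral>x. \<integral>y. norm (e x y) \<partial>\<nu> \<partial>\<nu>)"
    using \<nu>\<nu>.integrable_fst'[OF intn] int_x
    by (intro integral_mono integral_norm_bound) (auto simp: inner)
  also have "\<dots> = (\<integral>y. \<integral>x. norm (e x y) \<partial>\<nu> \<partial>\<nu>)"
    by (rule \<nu>\<nu>.Fubini_integral[OF intn, symmetric])
  also have "\<dots> = (\<integral>y. L1_norm (\<lambda>x. e x y) \<partial>\<mu>)"
    unfolding L1
  proof (rule to_\<mu>(2))
    show "(\<lambda>y. L1_norm (\<lambda>x. e x y)) \<in> borel_measurable borel"
      using L1m unfolding measurable_cong_sets[OF sets_\<nu> refl[of "sets borel"]] .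
  qed (use supp in \<open>simp add: L1_norm_def\<close>)
  also have "\<dots> \<le> (\<integral>y. b y \<partial>\<mu>)"
    by (rule integral_mono_AE[OF L1int b bound])
  finally show "L1_norm (\<lambda>x. \<integral>y. e x y \<partial>\<mu>) \<le> (\<integral>y. b y \<partial>\<mu>)" .
qed

end

section \<open>Cosine shifts, sums, differences and reflections\<close>

definition cos_shift :: "('a::ab_group_add \<Rightarrow> complex) \<Rightarrow> 'a \<Rightarrow> 'a \<Rightarrow> complex" where
  "cos_shift g y x = (g (x + y) + g (x - y)) / 2"

lemma cos_conv_eq_cos_shift: "cos_conv \<mu> f g x = (\<integral>y. f y * cos_shift g y x \<partial>\<mu>)"
  by (simp add: cos_conv_def cos_shift_def)

text \<open>
  The substitution \<open>y \<mapsto> - y\<close> maps \<open>S\<close> into the \<open>\<sigma>\<close>-compact set \<open>S \<union> - S\<close>.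
\<close>

lemma sum_measurable_diff:
  assumes h: "sum_measurable h" and S: "sigma_compact S"
  shows "(\<lambda>p. indicator (S \<times> S) p * h (fst p - snd p)) \<in> borel_measurable (borel \<Otimes>\<^sub>M borel)"
proof -
  define T where "T = S \<union> uminus ` S"
  have T: "sigma_compact T"
    unfolding T_def by (intro sigma_compact_Un sigma_compact_image S continuous_on_minus continuous_on_id)
  have um: "uminus \<in> borel_measurable (borel :: 'a measure)"
    by (intro borel_measurable_continuous_onI continuous_on_minus continuous_on_id)
  have "(\<lambda>p. (fst p, - snd p)) \<in> (borel \<Otimes>\<^sub>M borel :: ('a \<times> 'a) measure) \<rightarrow>\<^sub>M borel \<Otimes>\<^sub>M borel"
    by (intro measurable_Pair measurable_fst measurable_compose[OF measurable_snd um])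
  from measurable_compose[OF this h[unfolded sum_measurable_def, rule_format, OF T]]
  have [measurable]: "(\<lambda>p. indicator (T \<times> T) (fst p, - snd p) * h (fst p - snd p)) \<in> borel_measurable (borel \<Otimes>\<^sub>M borel)"
    by simp
  have SS: "S \<times> S \<in> sets (borel \<Otimes>\<^sub>M borel)"
    using sigma_compact_borel[OF S] by (intro pair_measureI)
  have [measurable]: "indicator (S \<times> S) \<in> borel_measurable (borel \<Otimes>\<^sub>M borel :: ('a \<times> 'a) measure)"
    using SS by (rule borel_measurable_indicator)
  have "(\<lambda>p. indicator (S \<times> S) p * (indicator (T \<times> T) (fst p, - snd p) * h (fst p - snd p))) \<in> borel_measurable (borel \<Otimes>\<^sub>M borel)"
    by measurable
  then show ?thesis
  proof (rule back_subst[of "\<lambda>F. F \<in> _"], intro ext)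
    fix p :: "'a \<times> 'a"
    show "indicator (S \<times> S) p * (indicator (T \<times> T) (fst p, - snd p) * h (fst p - snd p))
        = indicator (S \<times> S) p * h (fst p - snd p)"
      by (cases "p \<in> S \<times> S") (auto simp: T_def)
  qed
qed

text \<open>
  Large enough to contain the support, in both variables, of kernels such as
  \<open>f y * g (x + y)\<close> and \<open>f y * g (x - y)\<close> when \<open>f\<close> and \<open>g\<close> are supported in \<open>S\<close>.
\<close>

definition sum_diff_hull :: "'a::ab_group_add set \<Rightarrow> 'a set" where
  "sum_diff_hull S = S \<union> ((\<lambda>p. fst p + snd p) ` (S \<times> S) \<union> (\<lambda>p. fst p - snd p) ` (S \<times> S))"

lemma sigma_compact_sum_diff_hull:
  fixes S :: "'a::{topological_ab_group_add, t2_space} set"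
  assumes "sigma_compact S"
  shows "sigma_compact (sum_diff_hull S)"
  unfolding sum_diff_hull_def
  by (intro sigma_compact_Un sigma_compact_image sigma_compact_Times assms continuous_on_add
      continuous_on_diff continuous_on_fst continuous_on_snd continuous_on_id)

lemma sum_diff_hullI:
  assumes "s \<in> S" "t \<in> S"
  shows "s \<in> sum_diff_hull S" "s + t \<in> sum_diff_hull S" "s - t \<in> sum_diff_hull S"
  using assms unfolding sum_diff_hull_def by force+

lemma uminus_image_eq_vimage: "uminus ` A = uminus -` (A :: 'a::ab_group_add set)"
  by (auto simp: image_iff) (metis minus_minus)

context lca_haar
begin

lemma integrable_bump:
  fixes h :: "'a \<Rightarrow> real"
  assumes "continuous_on UNIV h" "\<And>x. 0 \<le> h x \<and> h x \<le> 1" "compact L" "\<And>x. x \<notin> L \<Longrightarrow> h x = 0"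
  shows "integrable \<mu> h"
proof (rule Bochner_Integration.integrable_bound[OF integrable_indicator_compact[OF assms(3)]])
  show "h \<in> borel_measurable \<mu>"
    unfolding borel_measurable_haar by (rule borel_measurable_continuous_onI[OF assms(1)])
  show "AE x in \<mu>. norm (h x) \<le> norm (indicator L x :: complex)"
    using assms(2,4) by (intro AE_I2) (auto split: split_indicator)
qed

lemma integral_continuous_pos:
  fixes f :: "'a \<Rightarrow> real"
  assumes f: "continuous_on UNIV f" "\<And>x. 0 \<le> f x" "0 < f x0" and int: "integrable \<mu> f"
  shows "(\<integral>x. f x \<partial>\<mu>) \<noteq> 0"
proof
  assume "(\<integral>x. f x \<partial>\<mu>) = 0"
  then have AE: "AE x in \<mu>. f x = 0"
    using integral_nonneg_eq_0_iff_AE[OF int] f(2) by simp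
  have op: "open {x. 0 < f x}" by (intro open_Collect_less continuous_on_const f(1))
  then have "{x. 0 < f x} \<in> null_sets \<mu>"
    using AE by (intro AE_iff_null_sets[THEN iffD2]) auto
  moreover have "emeasure \<mu> {x. 0 < f x} \<noteq> 0"
    by (rule emeasure_open_pos[OF op, of x0]) (simp add: f(3))
  ultimately show False by auto
qed

text \<open>
  Haar measure on an abelian group is invariant under \<open>x \<mapsto> - x\<close>.  For a test function \<open>f\<close>
  with nonzero integral, evaluate \<open>\<integral>\<integral> f y * h (x - y) dy dx\<close> in two ways.  Integrating over \<open>x\<close> first gives
  \<open>\<integral> f * \<integral> h\<close>.  Translating the inner integral by \<open>x\<close> first and then exchanging the order gives
  \<open>\<integral> f * \<integral> h (- y) dy\<close>.
\<close>

lemma integral_bump_reflect: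
  fixes h :: "'a \<Rightarrow> real"
  assumes h: "continuous_on UNIV h" "\<And>x. 0 \<le> h x \<and> h x \<le> 1" "compact Kh" "\<And>x. x \<notin> Kh \<Longrightarrow> h x = 0"
  shows "(\<integral>x. h (- x) \<partial>\<mu>) = (\<integral>x. h x \<partial>\<mu>)"
proof -
  obtain f :: "'a \<Rightarrow> real" and Kf where f: "continuous_on UNIV f" "\<And>x. 0 \<le> f x \<and> f x \<le> 1"
      "\<And>x. x \<in> {0} \<Longrightarrow> f x = 1" "\<And>x. x \<notin> UNIV \<Longrightarrow> f x = 0" "compact Kf" "\<And>x. x \<notin> Kf \<Longrightarrow> f x = 0"
    by (rule Urysohn_compact_support[of "{0}" UNIV]) auto
  have intf: "integrable \<mu> f" by (rule integrable_bump[OF f(1,2,5,6)])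
  have inth: "integrable \<mu> h" by (rule integrable_bump[OF h])
  have cont_neg: "continuous_on UNIV (\<lambda>x. h (- x))"
    by (rule continuous_on_compose2[OF h(1)]) (auto intro: continuous_on_minus continuous_on_id)
  have cK: "compact (uminus ` Kh)"
    using h(3) by (intro compact_continuous_image continuous_on_minus continuous_on_id)
  have neg0: "h (- x) = 0" if "x \<notin> uminus ` Kh" for x
    using that by (intro h(4)) (metis imageI minus_minus)
  have inthn: "integrable \<mu> (\<lambda>x. h (- x))"
    by (rule integrable_bump[OF cont_neg _ cK neg0]) (use h(2) in auto)
  define F where "F = (\<lambda>x. complex_of_real (f x))"
  define H where "H = (\<lambda>x. complex_of_real (h x))"
  have FH: "integrable \<mu> F" "integrable \<mu> H" "integrable \<mu> (\<lambda>x. H (- x))"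
    using intf inth inthn by (simp_all add: F_def H_def)
  have [measurable]: "F \<in> borel_measurable borel" "H \<in> borel_measurable borel"
      "(\<lambda>x. H (- x)) \<in> borel_measurable borel"
    using FH[THEN borel_measurable_integrable] unfolding borel_measurable_haar .
  define S where "S = Kf \<union> (Kh \<union> uminus ` Kh)"
  define Q where "Q = sum_diff_hull S"
  have "sigma_compact S"
    unfolding S_def using f(5) h(3) cK by (intro compact_imp_sigma_compact compact_Un)
  then have Q: "sigma_compact Q" unfolding Q_def by (rule sigma_compact_sum_diff_hull)
  have S: "x \<in> S" if "F x \<noteq> 0 \<or> H x \<noteq> 0 \<or> H (- x) \<noteq> 0" for x
    using that f(6)[of x] h(4)[of x] neg0[of x] unfolding S_def F_def H_def by auto
  define e1 where "e1 x y = F y * H (x - y)" for x y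
  define e2 where "e2 x y = F (x + y) * H (- y)" for x y
  have supp1: "e1 x y = 0" if "x \<notin> Q \<or> y \<notin> Q" for x y
  proof (rule ccontr)
    assume "e1 x y \<noteq> 0"
    then have "y \<in> S" "x - y \<in> S" using S by (auto simp: e1_def)
    then have "y \<in> Q" "x \<in> Q"
      using sum_diff_hullI(1)[of y S y] sum_diff_hullI(2)[of "x - y" S y] by (simp_all add: Q_def)
    then show False using that by simp
  qed
  have supp2: "e2 x y = 0" if "x \<notin> Q \<or> y \<notin> Q" for x y
  proof (rule ccontr)
    assume "e2 x y \<noteq> 0"
    then have "y \<in> S" "x + y \<in> S" using S[of y] S[of "x + y"] by (auto simp: e2_def)
    then have "y \<in> Q" "x \<in> Q"
      using sum_diff_hullI(1)[of y S y] sum_diff_hullI(3)[of "x + y" S y] by (simp_all add: Q_def)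
    then show False using that by simp
  qed
  have QQ: "p \<in> Q \<times> Q \<or> e1 (fst p) (snd p) = 0" "p \<in> Q \<times> Q \<or> e2 (fst p) (snd p) = 0" for p
    using supp1[of "fst p" "snd p"] supp2[of "fst p" "snd p"] by (auto simp: mem_Times_iff)
  have [measurable]: "(\<lambda>p. indicator (Q \<times> Q) p * H (fst p - snd p)) \<in> borel_measurable (borel \<Otimes>\<^sub>M borel)"
    by (rule sum_measurable_diff[OF _ Q]) (simp add: H_def sum_measurable_continuous[OF h(1)])
  have [measurable]: "(\<lambda>p. indicator (Q \<times> Q) p * F (fst p + snd p)) \<in> borel_measurable (borel \<Otimes>\<^sub>M borel)"
    using sum_measurable_continuous[OF f(1)] Q unfolding sum_measurable_def F_def by simp
  have "(\<lambda>p. F (snd p) * (indicator (Q \<times> Q) p * H (fst p - snd p))) \<in> borel_measurable (borel \<Otimes>\<^sub>M borel)"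
    by measurable
  moreover have "(\<lambda>p. F (snd p) * (indicator (Q \<times> Q) p * H (fst p - snd p))) = (\<lambda>p. e1 (fst p) (snd p))"
    (is "?lhs = _")
  proof
    fix p show "?lhs p = e1 (fst p) (snd p)"
      using QQ(1)[of p] by (cases "p \<in> Q \<times> Q") (auto simp: e1_def)
  qed
  ultimately have m1: "(\<lambda>p. e1 (fst p) (snd p)) \<in> borel_measurable (borel \<Otimes>\<^sub>M borel)" by simp
  have "(\<lambda>p. (indicator (Q \<times> Q) p * F (fst p + snd p)) * H (- snd p)) \<in> borel_measurable (borel \<Otimes>\<^sub>M borel)"
    by measurable
  moreover have "(\<lambda>p. (indicator (Q \<times> Q) p * F (fst p + snd p)) * H (- snd p)) = (\<lambda>p. e2 (fst p) (snd p))"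
    (is "?lhs = _")
  proof
    fix p show "?lhs p = e2 (fst p) (snd p)"
      using QQ(2)[of p] by (cases "p \<in> Q \<times> Q") (auto simp: e2_def)
  qed
  ultimately have m2: "(\<lambda>p. e2 (fst p) (snd p)) \<in> borel_measurable (borel \<Otimes>\<^sub>M borel)" by simp
  have "(\<integral>x. \<integral>y. e1 x y \<partial>\<mu> \<partial>\<mu>) = (\<integral>y. \<integral>x. e1 x y \<partial>\<mu> \<partial>\<mu>)"
  proof (rule Fubini_sigma_compact_support(4)[OF Q m1 supp1])
    show "integrable \<mu> (\<lambda>x. e1 x y)" for y
      unfolding e1_def using integrable_translate[OF FH(2), of "- y"] by simp
    show "AE y in \<mu>. L1_norm (\<lambda>x. e1 x y) \<le> norm (F y) * L1_norm H"
      unfolding e1_def L1_norm_scale using L1_norm_translate[OF FH(2), of "- y" for y] by simp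
    show "integrable \<mu> (\<lambda>y. norm (F y) * L1_norm H)" using FH by simp
  qed
  moreover have "(\<integral>x. e1 x y \<partial>\<mu>) = F y * (\<integral>x. H x \<partial>\<mu>)" for y
    unfolding e1_def using integral_translate[of H "- y"] by simp
  ultimately have 1: "(\<integral>x. \<integral>y. e1 x y \<partial>\<mu> \<partial>\<mu>) = (\<integral>x. F x \<partial>\<mu>) * (\<integral>x. H x \<partial>\<mu>)"
    by simp
  have "(\<integral>x. \<integral>y. e2 x y \<partial>\<mu> \<partial>\<mu>) = (\<integral>y. \<integral>x. e2 x y \<partial>\<mu> \<partial>\<mu>)"
  proof (rule Fubini_sigma_compact_support(4)[OF Q m2 supp2])
    show "integrable \<mu> (\<lambda>x. e2 x y)" for y
      unfolding e2_def using integrable_translate[OF FH(1), of y] by simp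
    show "AE y in \<mu>. L1_norm (\<lambda>x. e2 x y) \<le> norm (H (- y)) * L1_norm F"
      unfolding e2_def mult.commute[of "F _"] L1_norm_scale using L1_norm_translate[OF FH(1)] by simp
    show "integrable \<mu> (\<lambda>y. norm (H (- y)) * L1_norm F)" using FH by simp
  qed
  moreover have "(\<integral>x. e2 x y \<partial>\<mu>) = (\<integral>x. F x \<partial>\<mu>) * H (- y)" for y
    unfolding e2_def using integral_translate[of F y] by simp
  ultimately have 2: "(\<integral>x. \<integral>y. e2 x y \<partial>\<mu> \<partial>\<mu>) = (\<integral>x. F x \<partial>\<mu>) * (\<integral>x. H (- x) \<partial>\<mu>)"
    by simp
  have "(\<integral>y. e1 x y \<partial>\<mu>) = (\<integral>y. e2 x y \<partial>\<mu>)" for x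
  proof -
    have "(\<lambda>y. e1 x y) \<in> borel_measurable borel"
      using measurable_compose[OF measurable_Pair1'[of x borel borel] m1] by simp
    from integral_translate[OF this, of x] show ?thesis
      by (simp add: e1_def e2_def add.commute)
  qed
  then have "(\<integral>x. \<integral>y. e1 x y \<partial>\<mu> \<partial>\<mu>) = (\<integral>x. \<integral>y. e2 x y \<partial>\<mu> \<partial>\<mu>)" by simp
  then have "(\<integral>x. F x \<partial>\<mu>) * (\<integral>x. H x \<partial>\<mu>) = (\<integral>x. F x \<partial>\<mu>) * (\<integral>x. H (- x) \<partial>\<mu>)"
    by (metis 1 2)
  moreover have "(\<integral>x. F x \<partial>\<mu>) \<noteq> 0"
    using integral_continuous_pos[OF f(1) _ _ intf, of 0] f(2,3) by (simp add: F_def)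
  ultimately show ?thesis by (simp add: H_def)
qed

text \<open>
  Inner regularity of \<open>- U\<close>: a compact \<open>K\<close> inside it reflects into \<open>U\<close>, and a Urysohn function
  between \<open>- K\<close> and \<open>U\<close> has the same integral as its reflection.
\<close>

lemma emeasure_reflect_open_le:
  assumes U: "open U"
  shows "emeasure \<mu> (uminus ` U) \<le> emeasure \<mu> U"
proof -
  have "open (uminus ` U)"
    unfolding uminus_image_eq_vimage by (intro open_vimage U continuous_on_minus continuous_on_id)
  then have "emeasure \<mu> (uminus ` U) = (SUP K\<in>{K. compact K \<and> K \<subseteq> uminus ` U}. emeasure \<mu> K)"
    by (rule emeasure_inner)
  also have "\<dots> \<le> emeasure \<mu> U"
  proof (rule SUP_least)
    fix K assume "K \<in> {K. compact K \<and> K \<subseteq> uminus ` U}"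
    then have K: "compact K" "uminus ` K \<subseteq> U" by auto
    have cK: "compact (uminus ` K)"
      using K(1) by (intro compact_continuous_image continuous_on_minus continuous_on_id)
    obtain h :: "'a \<Rightarrow> real" and L where h: "continuous_on UNIV h" "\<And>x. 0 \<le> h x \<and> h x \<le> 1"
      "\<And>x. x \<in> uminus ` K \<Longrightarrow> h x = 1" "\<And>x. x \<notin> U \<Longrightarrow> h x = 0" "compact L" "\<And>x. x \<notin> L \<Longrightarrow> h x = 0"
      by (rule Urysohn_compact_support[OF cK U K(2)]) blast
    have cont_neg: "continuous_on UNIV (\<lambda>x. h (- x))"
      by (rule continuous_on_compose2[OF h(1)]) (auto intro: continuous_on_minus continuous_on_id)
    have cL: "compact (uminus ` L)"
      using h(5) by (intro compact_continuous_image continuous_on_minus continuous_on_id)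
    have neg0: "h (- x) = 0" if "x \<notin> uminus ` L" for x
      using that by (intro h(6)) (metis imageI minus_minus)
    have int: "integrable \<mu> h" "integrable \<mu> (\<lambda>x. h (- x))"
      using integrable_bump[OF h(1,2,5,6)] integrable_bump[OF cont_neg _ cL neg0] h(2) by auto
    have "emeasure \<mu> K = (\<integral>\<^sup>+x. indicator K x \<partial>\<mu>)"
      using compact_imp_closed[OF K(1)] by simp
    also have "\<dots> \<le> (\<integral>\<^sup>+x. ennreal (h (- x)) \<partial>\<mu>)"
      using h(3) by (intro nn_integral_mono) (auto split: split_indicator)
    also have "\<dots> = ennreal (\<integral>x. h (- x) \<partial>\<mu>)"
      using int(2) h(2) by (intro nn_integral_eq_integral) auto
    also have "\<dots> = ennreal (\<integral>x. h x \<partial>\<mu>)"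
      using integral_bump_reflect[OF h(1,2,5,6)] by simp
    also have "\<dots> = (\<integral>\<^sup>+x. ennreal (h x) \<partial>\<mu>)"
      using int(1) h(2) by (intro nn_integral_eq_integral[symmetric]) auto
    also have "\<dots> \<le> (\<integral>\<^sup>+x. indicator U x \<partial>\<mu>)"
      using h(2,4) by (intro nn_integral_mono) (auto split: split_indicator)
    also have "\<dots> = emeasure \<mu> U" using U by simp
    finally show "emeasure \<mu> K \<le> emeasure \<mu> U" .
  qed
  finally show ?thesis .
qed

text \<open>
  Needed since \<open>cos_conv\<close> contains \<open>g (x - y)\<close> as a function of \<open>y\<close>: a change of \<open>g\<close> on a null
  set \<open>N\<close> is felt on \<open>x - N\<close>.  By outer regularity, \<open>- N\<close> lies in reflections of open sets of
  arbitrarily small measure.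
\<close>

lemma AE_reflect:
  assumes "AE x in \<mu>. P x"
  shows "AE x in \<mu>. P (- x)"
proof -
  obtain N where N: "N \<in> null_sets \<mu>" "{x. \<not> P x} \<subseteq> N"
    using assms unfolding eventually_ae_filter by auto
  then have NB: "N \<in> sets borel" "emeasure \<mu> N = 0" by auto
  have "uminus \<in> borel_measurable (borel :: 'a measure)"
    by (intro borel_measurable_continuous_onI continuous_on_minus continuous_on_id)
  from measurable_sets[OF this NB(1)] have NB': "uminus ` N \<in> sets borel"
    by (simp add: uminus_image_eq_vimage)
  have "emeasure \<mu> (uminus ` N) \<le> (INF U\<in>{U. open U \<and> N \<subseteq> U}. emeasure \<mu> U)"
  proof (rule INF_greatest)
    fix U assume U: "U \<in> {U. open U \<and> N \<subseteq> U}"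
    have "open (uminus ` U)"
      unfolding uminus_image_eq_vimage using U by (intro open_vimage continuous_on_minus continuous_on_id) auto
    then have "emeasure \<mu> (uminus ` N) \<le> emeasure \<mu> (uminus ` U)"
      using U by (intro emeasure_mono) auto
    also have "\<dots> \<le> emeasure \<mu> U" using U by (intro emeasure_reflect_open_le) simp
    finally show "emeasure \<mu> (uminus ` N) \<le> emeasure \<mu> U" .
  qed
  also have "\<dots> = 0" using emeasure_outer[OF NB(1)] NB(2) by simp
  finally have "uminus ` N \<in> null_sets \<mu>" using NB' by auto
  moreover have "{x \<in> space \<mu>. \<not> P (- x)} \<subseteq> uminus ` N" using N(2) unfolding uminus_image_eq_vimage by auto
  ultimately show ?thesis by (rule AE_I')
qed

section \<open>The cosine convolution of integrable functions\<close>

lemma measurable_add_arg [measurable]: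
  "g \<in> borel_measurable borel \<Longrightarrow> (\<lambda>x. g (x + (y::'a)) :: complex) \<in> borel_measurable borel"
  by (rule measurable_compose[of "\<lambda>x. x + y" borel borel])
    (intro borel_measurable_continuous_onI continuous_on_add continuous_on_id continuous_on_const)

lemma measurable_diff_arg [measurable]:
  "g \<in> borel_measurable borel \<Longrightarrow> (\<lambda>y. g (x - (y::'a)) :: complex) \<in> borel_measurable borel"
  by (rule measurable_compose[of "\<lambda>y. x - y" borel borel])
    (intro borel_measurable_continuous_onI continuous_on_diff continuous_on_id continuous_on_const)

lemma measurable_cos_shift_snd:
  fixes g :: "'a \<Rightarrow> complex"
  assumes "g \<in> borel_measurable borel"
  shows "(\<lambda>y. cos_shift g y x) \<in> borel_measurable borel"
  unfolding cos_shift_def add.commute[of x]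
  using measurable_add_arg[OF assms, of x] measurable_diff_arg[OF assms, of x] by measurable

lemma integrable_cos_shift: "integrable \<mu> g \<Longrightarrow> integrable \<mu> (cos_shift g y)"
  unfolding cos_shift_def
  using integrable_translate[of g y] integrable_translate[of g "- y"] by simp

lemma L1_norm_cos_shift_le:
  assumes "integrable \<mu> g"
  shows "L1_norm (cos_shift g y) \<le> L1_norm g"
proof -
  have "cos_shift g y = (\<lambda>x. (1 / 2) * (g (x + y) + g (x + - y)))"
    by (simp add: cos_shift_def fun_eq_iff)
  then have "L1_norm (cos_shift g y) = L1_norm (\<lambda>x. (1 / 2) * (g (x + y) + g (x + - y)))"
    by simp
  also have "\<dots> = L1_norm (\<lambda>x. g (x + y) + g (x + - y)) / 2"
    unfolding L1_norm_scale by simp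
  also have "\<dots> \<le> (L1_norm (\<lambda>x. g (x + y)) + L1_norm (\<lambda>x. g (x + - y))) / 2"
    by (intro divide_right_mono L1_norm_add_le integrable_translate assms) simp
  also have "\<dots> = L1_norm g"
    unfolding L1_norm_translate[OF assms] by simp
  finally show ?thesis .
qed

lemma borel_measurable_of_integrable: "integrable \<mu> (f :: 'a \<Rightarrow> complex) \<Longrightarrow> f \<in> borel_measurable borel"
  using borel_measurable_integrable[of \<mu> f] unfolding borel_measurable_haar .

lemma L1_norm_cong_AE:
  assumes "integrable \<mu> f" "integrable \<mu> g" "AE x in \<mu>. f x = g x"
  shows "L1_norm f = L1_norm g"
  unfolding L1_norm_def
proof (rule integral_cong_AE)
  show "AE x in \<mu>. norm (f x) = norm (g x)" using assms(3) by eventually_elim simp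
qed (use assms(1,2) in auto)

lemma AE_cos_shift_cong:
  assumes "AE x in \<mu>. f x = g x"
  shows "AE x in \<mu>. cos_shift f y x = cos_shift g y x"
    and "AE y in \<mu>. cos_shift f y x = cos_shift g y x"
proof -
  show "AE x in \<mu>. cos_shift f y x = cos_shift g y x"
    using AE_translate[OF assms, of y] AE_translate[OF assms, of "- y"]
    by eventually_elim (simp add: cos_shift_def)
  show "AE y in \<mu>. cos_shift f y x = cos_shift g y x"
    using AE_translate[OF assms, of x] AE_translate[OF AE_reflect[OF assms], of "- x"]
    by eventually_elim (simp add: cos_shift_def add.commute)
qed

text \<open>
  Equality at every point, not only almost everywhere.  This allows Baire representatives to
  replace \<open>f\<close> and \<open>g\<close> without leaving any measurability question open.
\<close>

lemma cos_conv_cong_AE: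
  assumes f: "integrable \<mu> f" "integrable \<mu> f'" "AE x in \<mu>. f x = f' x"
    and g: "integrable \<mu> g" "integrable \<mu> g'" "AE x in \<mu>. g x = g' x"
  shows "cos_conv \<mu> f g = cos_conv \<mu> f' g'"
proof
  fix x
  have [measurable]: "f \<in> borel_measurable borel" "f' \<in> borel_measurable borel"
    using f borel_measurable_of_integrable by auto
  have [measurable]: "(\<lambda>y. cos_shift g y x) \<in> borel_measurable borel"
      "(\<lambda>y. cos_shift g' y x) \<in> borel_measurable borel"
    using g borel_measurable_of_integrable by (auto intro: measurable_cos_shift_snd)
  show "cos_conv \<mu> f g x = cos_conv \<mu> f' g' x"
    unfolding cos_conv_eq_cos_shift
  proof (rule integral_cong_AE)
    show "AE y in \<mu>. f y * cos_shift g y x = f' y * cos_shift g' y x"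
      using f(3) AE_cos_shift_cong(2)[OF g(3), of x] by eventually_elim simp
  qed measurable
qed

text \<open>
  The factor \<open>c\<close> serves two purposes.  With \<open>c = 0\<close> the lemma is the norm inequality for the
  convolution; with \<open>c = 1\<close> it says that \<open>f \<star> g\<close> is close to a multiple of \<open>S\<^sub>a g\<close> when \<open>S\<^sub>y g\<close>
  stays close to \<open>S\<^sub>a g\<close> on the support of \<open>f\<close>.
\<close>

lemma cos_kernel_bounds:
  fixes c :: complex
  assumes f: "baire_representative f f" and g: "baire_representative g g"
    and \<epsilon>: "AE y in \<mu>. f y \<noteq> 0 \<longrightarrow> L1_norm (\<lambda>x. cos_shift g y x - c * cos_shift g a x) \<le> \<epsilon>"
  defines "e \<equiv> (\<lambda>x y. f y * (cos_shift g y x - c * cos_shift g a x))"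
  shows "AE x in \<mu>. integrable \<mu> (\<lambda>y. e x y)"
    and "integrable \<mu> (\<lambda>x. \<integral>y. e x y \<partial>\<mu>)"
    and "L1_norm (\<lambda>x. \<integral>y. e x y \<partial>\<mu>) \<le> \<epsilon> * L1_norm f"
proof -
  have int: "integrable \<mu> f" "integrable \<mu> g"
    using f g unfolding baire_representative_def by auto
  have fB [measurable]: "f \<in> borel_measurable borel" and gB: "g \<in> borel_measurable borel"
    using int borel_measurable_of_integrable by auto
  have sm: "sum_measurable g" using g unfolding baire_representative_def by auto
  obtain Sf where Sf: "sigma_compact Sf" "\<forall>x. x \<notin> Sf \<longrightarrow> f x = 0"
    using f unfolding baire_representative_def by (elim conjE exE)
  obtain Sg where Sg: "sigma_compact Sg" "\<forall>x. x \<notin> Sg \<longrightarrow> g x = 0"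
    using g unfolding baire_representative_def by (elim conjE exE)
  \<comment> \<open>The point \<open>a\<close> is included so that the support of \<open>S\<^sub>a g\<close> lies in \<open>Q\<close> as well.\<close>
  define S where "S = Sf \<union> (Sg \<union> {a})"
  have "sigma_compact S"
    unfolding S_def by (intro sigma_compact_Un Sf Sg compact_imp_sigma_compact compact_sing)
  define Q where "Q = sum_diff_hull S"
  have Q: "sigma_compact Q"
    unfolding Q_def using \<open>sigma_compact S\<close> by (rule sigma_compact_sum_diff_hull)
  have shift: "x \<in> Q" if "cos_shift g t x \<noteq> 0" "t \<in> S" for t x
  proof -
    have "g (x + t) \<noteq> 0 \<or> g (x - t) \<noteq> 0" using that(1) by (auto simp: cos_shift_def)
    then have "x + t \<in> S \<or> x - t \<in> S" using Sg(2) unfolding S_def by blast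
    then show ?thesis
      using sum_diff_hullI(3)[of "x + t" S t] sum_diff_hullI(2)[of "x - t" S t] that(2)
      by (auto simp: Q_def)
  qed
  have supp: "e x y = 0" if "x \<notin> Q \<or> y \<notin> Q" for x y
  proof (rule ccontr)
    assume "e x y \<noteq> 0"
    then have fy: "f y \<noteq> 0" and ne: "cos_shift g y x \<noteq> 0 \<or> cos_shift g a x \<noteq> 0"
      by (auto simp: e_def)
    have y: "y \<in> S" using fy Sf(2) unfolding S_def by blast
    have "a \<in> S" by (simp add: S_def)
    then have "x \<in> Q" using ne shift y by blast
    moreover have "y \<in> Q" using sum_diff_hullI(1)[OF y y] by (simp add: Q_def)
    ultimately show False using that by simp
  qed
  have QB: "Q \<times> Q \<in> sets (borel \<Otimes>\<^sub>M borel)"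
    using sigma_compact_borel[OF Q] by (intro pair_measureI)
  have [measurable]: "indicator (Q \<times> Q) \<in> borel_measurable (borel \<Otimes>\<^sub>M borel :: ('a \<times> 'a) measure)"
    using QB by (rule borel_measurable_indicator)
  have [measurable]: "(\<lambda>p. indicator (Q \<times> Q) p * g (fst p - snd p)) \<in> borel_measurable (borel \<Otimes>\<^sub>M borel)"
    by (rule sum_measurable_diff[OF sm Q])
  have [measurable]: "(\<lambda>p. indicator (Q \<times> Q) p * g (fst p + snd p)) \<in> borel_measurable (borel \<Otimes>\<^sub>M borel)"
    using sm Q unfolding sum_measurable_def by simp
  have [measurable]: "cos_shift g a \<in> borel_measurable borel"
    by (rule borel_measurable_of_integrable[OF integrable_cos_shift[OF int(2)]])
  have "(\<lambda>p. f (snd p) * ((indicator (Q \<times> Q) p * g (fst p + snd p) + indicator (Q \<times> Q) p * g (fst p - snd p)) / 2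
      - c * (indicator (Q \<times> Q) p * cos_shift g a (fst p)))) \<in> borel_measurable (borel \<Otimes>\<^sub>M borel)"
    by measurable
  moreover have "(\<lambda>p. f (snd p) * ((indicator (Q \<times> Q) p * g (fst p + snd p) + indicator (Q \<times> Q) p * g (fst p - snd p)) / 2
      - c * (indicator (Q \<times> Q) p * cos_shift g a (fst p)))) = (\<lambda>p. e (fst p) (snd p))"
    (is "?lhs = _")
  proof
    fix p show "?lhs p = e (fst p) (snd p)"
    proof (cases "p \<in> Q \<times> Q")
      case True
      then show ?thesis by (simp add: e_def cos_shift_def)
    next
      case False
      then have "e (fst p) (snd p) = 0" by (intro supp) (auto simp: mem_Times_iff)
      then show ?thesis using False by simp
    qed
  qed
  ultimately have meas: "(\<lambda>p. e (fst p) (snd p)) \<in> borel_measurable (borel \<Otimes>\<^sub>M borel)" by simp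
  have sect: "integrable \<mu> (\<lambda>x. e x y)" for y
    unfolding e_def using integrable_cos_shift[OF int(2)] by simp
  have bound: "AE y in \<mu>. L1_norm (\<lambda>x. e x y) \<le> \<epsilon> * norm (f y)"
    using \<epsilon>
  proof eventually_elim
    case (elim y)
    then show ?case unfolding e_def L1_norm_scale
      by (cases "f y = 0") (auto simp: mult.commute mult_left_mono)
  qed
  have b: "integrable \<mu> (\<lambda>y. \<epsilon> * norm (f y))" using int(1) by simp
  show "AE x in \<mu>. integrable \<mu> (\<lambda>y. e x y)" "integrable \<mu> (\<lambda>x. \<integral>y. e x y \<partial>\<mu>)"
    by (rule Fubini_sigma_compact_support[OF Q meas supp sect bound b]; assumption)+
  show "L1_norm (\<lambda>x. \<integral>y. e x y \<partial>\<mu>) \<le> \<epsilon> * L1_norm f"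
    using Fubini_sigma_compact_support(3)[OF Q meas supp sect bound b]
    by (simp add: L1_norm_def)
qed

lemma baire_representative_refl: "baire_representative f g \<Longrightarrow> baire_representative g g"
  by (simp add: baire_representative_def)

lemma baire_representativeD:
  assumes "baire_representative f g"
  shows "integrable \<mu> g" "AE x in \<mu>. f x = g x"
proof -
  show "integrable \<mu> g" using assms unfolding baire_representative_def by (elim conjE)
  have "AE x in \<mu>. g x = f x" using assms unfolding baire_representative_def by (elim conjE)
  then show "AE x in \<mu>. f x = g x" by eventually_elim simp
qed

lemma cos_conv_bounds:
  assumes f: "integrable \<mu> f" and g: "integrable \<mu> g"
  shows AE_integrable_cos_conv: "AE x in \<mu>. integrable \<mu> (\<lambda>y. f y * cos_shift g y x)"
    and integrable_cos_conv: "integrable \<mu> (cos_conv \<mu> f g)"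
    and L1_norm_cos_conv_le: "L1_norm (cos_conv \<mu> f g) \<le> L1_norm g * L1_norm f"
proof -
  obtain f' where f': "baire_representative f f'" using baire_representative_exists[OF f] by (elim exE)
  obtain g' where g': "baire_representative g g'" using baire_representative_exists[OF g] by (elim exE)
  note f'D = baire_representativeD[OF f'] and g'D = baire_representativeD[OF g']
  have eq: "cos_conv \<mu> f g = cos_conv \<mu> f' g'"
    by (rule cos_conv_cong_AE[OF f f'D g g'D])
  have le: "AE y in \<mu>. f' y \<noteq> 0 \<longrightarrow> L1_norm (\<lambda>x. cos_shift g' y x - 0 * cos_shift g' 0 x) \<le> L1_norm g'"
    using L1_norm_cos_shift_le[OF g'D(1)] by (intro AE_I2) simp
  note kernel = cos_kernel_bounds[OF baire_representative_refl[OF f'] baire_representative_refl[OF g'] le]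
  have "AE x in \<mu>. integrable \<mu> (\<lambda>y. f' y * cos_shift g' y x)"
    using kernel(1) by simp
  then show "AE x in \<mu>. integrable \<mu> (\<lambda>y. f y * cos_shift g y x)"
  proof eventually_elim
    case (elim x)
    have [measurable]: "f \<in> borel_measurable borel" by (rule borel_measurable_of_integrable[OF f])
    have [measurable]: "(\<lambda>y. cos_shift g y x) \<in> borel_measurable borel"
      by (rule measurable_cos_shift_snd[OF borel_measurable_of_integrable[OF g]])
    have "AE y in \<mu>. f' y * cos_shift g' y x = f y * cos_shift g y x"
      using f'D(2) AE_cos_shift_cong(2)[OF g'D(2), of x] by eventually_elim simp
    then show ?case by (rule integrable_cong_AE_imp[OF elim, rotated]) measurable
  qed
  show "integrable \<mu> (cos_conv \<mu> f g)"
    unfolding eq using kernel(2) by (simp add: cos_conv_eq_cos_shift[abs_def])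
  have "L1_norm f' = L1_norm f" "L1_norm g' = L1_norm g"
    using L1_norm_cong_AE[OF f f'D] L1_norm_cong_AE[OF g g'D] by simp_all
  then show "L1_norm (cos_conv \<mu> f g) \<le> L1_norm g * L1_norm f"
    unfolding eq using kernel(3) by (simp add: cos_conv_eq_cos_shift[abs_def])
qed

lemma cos_conv_near_shift:
  assumes f: "integrable \<mu> f" and g: "integrable \<mu> g"
    and \<epsilon>: "\<And>y. f y \<noteq> 0 \<Longrightarrow> L1_norm (\<lambda>x. cos_shift g y x - cos_shift g a x) \<le> \<epsilon>"
  shows "L1_norm (\<lambda>x. cos_conv \<mu> f g x - (\<integral>y. f y \<partial>\<mu>) * cos_shift g a x) \<le> \<epsilon> * L1_norm f"
proof -
  obtain f' where f': "baire_representative f f'" using baire_representative_exists[OF f] by (elim exE)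
  obtain g' where g': "baire_representative g g'" using baire_representative_exists[OF g] by (elim exE)
  note f'D = baire_representativeD[OF f'] and g'D = baire_representativeD[OF g']
  have eq: "cos_conv \<mu> f g = cos_conv \<mu> f' g'"
    by (rule cos_conv_cong_AE[OF f f'D g g'D])
  have ints: "(\<integral>y. f y \<partial>\<mu>) = (\<integral>y. f' y \<partial>\<mu>)"
    by (rule integral_cong_AE) (use f f'D in auto)
  have nrm: "L1_norm (\<lambda>x. cos_shift g' y x - cos_shift g' a x) = L1_norm (\<lambda>x. cos_shift g y x - cos_shift g a x)" for y
  proof (rule L1_norm_cong_AE)
    show "AE x in \<mu>. cos_shift g' y x - cos_shift g' a x = cos_shift g y x - cos_shift g a x"
      using AE_cos_shift_cong(1)[OF g'D(2), of y] AE_cos_shift_cong(1)[OF g'D(2), of a]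
      by eventually_elim simp
  qed (use g g'D(1) integrable_cos_shift in simp_all)
  have le: "AE y in \<mu>. f' y \<noteq> 0 \<longrightarrow> L1_norm (\<lambda>x. cos_shift g' y x - 1 * cos_shift g' a x) \<le> \<epsilon>"
    using f'D(2) by eventually_elim (simp add: nrm \<epsilon>)
  note kernel = cos_kernel_bounds[OF baire_representative_refl[OF f'] baire_representative_refl[OF g'] le]
  have intshift: "integrable \<mu> (cos_shift g' a)" by (rule integrable_cos_shift[OF g'D(1)])
  have "AE x in \<mu>. cos_conv \<mu> f g x - (\<integral>y. f y \<partial>\<mu>) * cos_shift g a x
      = (\<integral>y. f' y * (cos_shift g' y x - 1 * cos_shift g' a x) \<partial>\<mu>)"
    using AE_integrable_cos_conv[OF f'D(1) g'D(1)] AE_cos_shift_cong(1)[OF g'D(2), of a]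
  proof eventually_elim
    case (elim x)
    have "(\<integral>y. f' y * (cos_shift g' y x - 1 * cos_shift g' a x) \<partial>\<mu>)
        = (\<integral>y. f' y * cos_shift g' y x - f' y * cos_shift g' a x \<partial>\<mu>)"
      by (simp add: right_diff_distrib)
    also have "\<dots> = (\<integral>y. f' y * cos_shift g' y x \<partial>\<mu>) - (\<integral>y. f' y * cos_shift g' a x \<partial>\<mu>)"
      by (rule Bochner_Integration.integral_diff[OF elim(1)]) (use f'D in simp)
    finally show ?case using elim(2) by (simp add: eq cos_conv_eq_cos_shift ints)
  qed
  then have "L1_norm (\<lambda>x. cos_conv \<mu> f g x - (\<integral>y. f y \<partial>\<mu>) * cos_shift g a x)
      = L1_norm (\<lambda>x. \<integral>y. f' y * (cos_shift g' y x - 1 * cos_shift g' a x) \<partial>\<mu>)"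
    using integrable_cos_conv[OF f g] integrable_cos_shift[OF g] kernel(2)
    by (intro L1_norm_cong_AE) simp_all
  also have "\<dots> \<le> \<epsilon> * L1_norm f'" by (rule kernel(3))
  also have "L1_norm f' = L1_norm f" using L1_norm_cong_AE[OF f f'D] by simp
  finally show ?thesis .
qed

lemma cos_conv_add_AE:
  assumes "integrable \<mu> f1" "integrable \<mu> f2" "integrable \<mu> g"
  shows "AE x in \<mu>. cos_conv \<mu> (\<lambda>y. f1 y + f2 y) g x = cos_conv \<mu> f1 g x + cos_conv \<mu> f2 g x"
  using AE_integrable_cos_conv[OF assms(1,3)] AE_integrable_cos_conv[OF assms(2,3)]
  by eventually_elim (simp add: cos_conv_eq_cos_shift distrib_right)

lemma L1_continuous_cos_shift:
  assumes g: "integrable \<mu> g" and \<epsilon>: "0 < \<epsilon>"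
  shows "\<forall>\<^sub>F z in nhds y. L1_norm (\<lambda>x. cos_shift g z x - cos_shift g y x) < \<epsilon>"
proof -
  have ev: "\<forall>\<^sub>F a in nhds 0. L1_norm (\<lambda>x. g (x + a) - g x) < \<epsilon>"
    by (rule L1_norm_translate_eventually[OF g \<epsilon>])
  have "filterlim (\<lambda>z. z - y) (nhds 0) (nhds y)"
  proof -
    have "((\<lambda>z. z - y) \<longlongrightarrow> y - y) (nhds y)"
      by (intro tendsto_diff tendsto_const filterlim_ident)
    then show ?thesis by simp
  qed
  then have ev1: "\<forall>\<^sub>F z in nhds y. L1_norm (\<lambda>x. g (x + (z - y)) - g x) < \<epsilon>"
    using ev by (rule eventually_compose_filterlim[rotated])
  have "filterlim (\<lambda>z. y - z) (nhds 0) (nhds y)"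
  proof -
    have "((\<lambda>z. y - z) \<longlongrightarrow> y - y) (nhds y)"
      by (intro tendsto_diff tendsto_const filterlim_ident)
    then show ?thesis by simp
  qed
  then have ev2: "\<forall>\<^sub>F z in nhds y. L1_norm (\<lambda>x. g (x + (y - z)) - g x) < \<epsilon>"
    using ev by (rule eventually_compose_filterlim[rotated])
  show ?thesis using ev1 ev2
  proof eventually_elim
    case (elim z)
    have i1: "integrable \<mu> (\<lambda>x. g (x + (z - y)) - g x)" "integrable \<mu> (\<lambda>x. g (x + (y - z)) - g x)"
      using g by (auto intro: integrable_translate)
    define u where "u x = g (x + z) - g (x + y)" for x
    define v where "v x = g (x - z) - g (x - y)" for x
    have u: "u = (\<lambda>x. g ((x + y) + (z - y)) - g (x + y))" by (simp add: u_def fun_eq_iff algebra_simps)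
    have v: "v = (\<lambda>x. g ((x + - y) + (y - z)) - g (x + - y))" by (simp add: v_def fun_eq_iff algebra_simps)
    have int: "integrable \<mu> u" "integrable \<mu> v"
      unfolding u_def v_def using g integrable_translate[OF g, of "- y"] integrable_translate[OF g, of "- z"]
      by (auto intro: integrable_translate)
    have nu: "L1_norm u < \<epsilon>"
      unfolding u using L1_norm_translate[OF i1(1), of y] elim(1) by simp
    have nv: "L1_norm v < \<epsilon>"
      unfolding v using L1_norm_translate[OF i1(2), of "- y"] elim(2) by simp
    have "(\<lambda>x. cos_shift g z x - cos_shift g y x) = (\<lambda>x. (1/2) * (u x + v x))"
      by (simp add: cos_shift_def u_def v_def fun_eq_iff field_simps)
    then have "L1_norm (\<lambda>x. cos_shift g z x - cos_shift g y x) = L1_norm (\<lambda>x. u x + v x) / 2"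
      by (simp only: L1_norm_scale) simp
    also have "\<dots> \<le> (L1_norm u + L1_norm v) / 2"
      using L1_norm_add_le[OF int] by simp
    finally show ?case using nu nv by simp
  qed
qed

end

section \<open>Bounded functionals on the cosine convolution algebra\<close>

lemma L1_class_self: "integrable \<mu> f \<Longrightarrow> f \<in> L1_class \<mu> f"
  by (simp add: L1_class_def L1_rel_def)

lemma L1_class_memD: "h \<in> L1_class \<mu> f \<Longrightarrow> integrable \<mu> h \<and> (AE x in \<mu>. f x = h x)"
  by (simp add: L1_class_def L1_rel_def)

lemma L1_class_in_L1: "integrable \<mu> f \<Longrightarrow> L1_class \<mu> f \<in> L1 \<mu>"
  unfolding L1_def L1_class_def by (rule quotientI) simp

lemma L1_classE:
  assumes "F \<in> L1 \<mu>"
  obtains f where "integrable \<mu> f" "F = L1_class \<mu> f"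
  using assms unfolding L1_def L1_class_def by (auto elim: quotientE)

lemma L1_class_cong_AE:
  assumes "integrable \<mu> f" "integrable \<mu> g" "AE x in \<mu>. f x = g x"
  shows "L1_class \<mu> f = L1_class \<mu> g"
proof -
  have "(AE x in \<mu>. f x = h x) \<longleftrightarrow> (AE x in \<mu>. g x = h x)" for h
  proof
    assume "AE x in \<mu>. f x = h x"
    with assms(3) show "AE x in \<mu>. g x = h x" by eventually_elim simp
  next
    assume "AE x in \<mu>. g x = h x"
    with assms(3) show "AE x in \<mu>. f x = h x" by eventually_elim simp
  qed
  then show ?thesis using assms(1,2) by (simp add: L1_class_def L1_rel_def)
qed

lemma L1_dual_add:
  "m \<in> L1_dual \<mu> \<Longrightarrow> integrable \<mu> f \<Longrightarrow> integrable \<mu> g \<Longrightarrow>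
    m (L1_class \<mu> (\<lambda>x. f x + g x)) = m (L1_class \<mu> f) + m (L1_class \<mu> g)"
  unfolding L1_dual_def by simp

lemma L1_dual_scale:
  "m \<in> L1_dual \<mu> \<Longrightarrow> integrable \<mu> f \<Longrightarrow> m (L1_class \<mu> (\<lambda>x. c * f x)) = c * m (L1_class \<mu> f)"
  unfolding L1_dual_def by simp

lemma L1_dual_diff:
  assumes "m \<in> L1_dual \<mu>" "integrable \<mu> f" "integrable \<mu> g"
  shows "m (L1_class \<mu> (\<lambda>x. f x - g x)) = m (L1_class \<mu> f) - m (L1_class \<mu> g)"
  using L1_dual_add[OF assms(1,2), of "\<lambda>x. (- 1) * g x"] L1_dual_scale[OF assms(1,3), of "- 1"] assms(3)
  by simp

lemma bcontfunE_borel: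
  fixes \<phi> :: "'b::topological_space \<Rightarrow> complex"
  assumes "\<phi> \<in> bcontfun"
  obtains B where "continuous_on UNIV \<phi>" "\<phi> \<in> borel_measurable borel" "\<And>x. norm (\<phi> x) \<le> B"
proof -
  have "continuous_on UNIV \<phi>" "bounded (range \<phi>)" using assms by (auto simp: bcontfun_def)
  then show ?thesis
    using that borel_measurable_continuous_onI[of \<phi>] unfolding bounded_iff by auto
qed

context lca_haar
begin

text \<open>
  Continuity at 0 gives a ball on which \<open>m\<close> is bounded by 1; scale \<open>f\<close> into it.  The factor 2
  keeps the scaled function strictly inside that ball.
\<close>

lemma L1_dual_bounded:
  assumes m: "m \<in> L1_dual \<mu>"
  obtains C where "0 < C" "\<And>f. integrable \<mu> f \<Longrightarrow> norm (m (L1_class \<mu> f)) \<le> C * L1_norm f"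
proof -
  have zero: "m (L1_class \<mu> (\<lambda>x. 0)) = 0"
    using L1_dual_scale[OF m, of "\<lambda>x. 0" 0] by simp
  have "\<forall>f. integrable \<mu> f \<longrightarrow> (\<forall>\<epsilon>>0. \<exists>\<delta>>0. \<forall>g. integrable \<mu> g \<longrightarrow>
        (\<integral>x. norm (g x - f x) \<partial>\<mu>) < \<delta> \<longrightarrow> dist (m (L1_class \<mu> g)) (m (L1_class \<mu> f)) < \<epsilon>)"
    using m unfolding L1_dual_def by simp
  from this[rule_format, of "\<lambda>x. 0" 1] obtain \<delta> where \<delta>: "0 < \<delta>"
      "\<And>g. integrable \<mu> g \<Longrightarrow> L1_norm g < \<delta> \<Longrightarrow> norm (m (L1_class \<mu> g)) < 1"
    by (auto simp: zero L1_norm_def)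
  show ?thesis
  proof
    show "0 < 2 / \<delta>" using \<delta>(1) by simp
    fix f :: "'a \<Rightarrow> complex" assume f: "integrable \<mu> f"
    show "norm (m (L1_class \<mu> f)) \<le> 2 / \<delta> * L1_norm f"
    proof (cases "L1_norm f = 0")
      case True
      then have "AE x in \<mu>. norm (f x) = 0"
        using integral_nonneg_eq_0_iff_AE[of \<mu> "\<lambda>x. norm (f x)"] f by (simp add: L1_norm_def)
      then have "AE x in \<mu>. f x = 0" by eventually_elim simp
      then have "L1_class \<mu> f = L1_class \<mu> (\<lambda>x. 0)" using f by (intro L1_class_cong_AE) auto
      then show ?thesis using zero True by simp
    next
      case False
      then have pos: "0 < L1_norm f" using L1_norm_nonneg[of f] by simp
      define c where "c = complex_of_real (\<delta> / (2 * L1_norm f))"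
      have nc: "norm c = \<delta> / (2 * L1_norm f)" using pos \<delta>(1) by (simp add: c_def norm_divide norm_mult)
      have "L1_norm (\<lambda>x. c * f x) < \<delta>" unfolding L1_norm_scale nc using pos \<delta>(1) by simp
      then have "norm (m (L1_class \<mu> (\<lambda>x. c * f x))) < 1" using f by (intro \<delta>(2)) auto
      then have "norm c * norm (m (L1_class \<mu> f)) < 1"
        unfolding L1_dual_scale[OF m f] norm_mult .
      then show ?thesis unfolding nc using pos \<delta>(1) by (simp add: field_simps)
    qed
  qed
qed

lemma integrable_times_bounded:
  assumes f: "integrable \<mu> f" and \<phi>: "\<phi> \<in> borel_measurable borel"
    and B: "\<And>x. f x \<noteq> 0 \<Longrightarrow> norm (\<phi> x) \<le> B"
  shows "integrable \<mu> (\<lambda>x. f x * \<phi> x)" and "norm (\<integral>x. f x * \<phi> x \<partial>\<mu>) \<le> B * L1_norm f"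
proof -
  have [measurable]: "f \<in> borel_measurable \<mu>" using f by (rule borel_measurable_integrable)
  have [measurable]: "\<phi> \<in> borel_measurable \<mu>" using \<phi> by (simp only: borel_measurable_haar)
  have le: "norm (f x * \<phi> x) \<le> B * norm (f x)" for x
    using B[of x] by (cases "f x = 0") (auto simp: norm_mult mult.commute mult_left_mono)
  show int: "integrable \<mu> (\<lambda>x. f x * \<phi> x)"
  proof (rule Bochner_Integration.integrable_bound)
    show "integrable \<mu> (\<lambda>x. B * norm (f x))" using f by simp
    show "AE x in \<mu>. norm (f x * \<phi> x) \<le> norm (B * norm (f x))"
      using le by (intro AE_I2) (metis abs_ge_self order_trans real_norm_def)
  qed measurable
  have "norm (\<integral>x. f x * \<phi> x \<partial>\<mu>) \<le> (\<integral>x. norm (f x * \<phi> x) \<partial>\<mu>)" by (rule integral_norm_bound)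
  also have "\<dots> \<le> (\<integral>x. B * norm (f x) \<partial>\<mu>)" using int f le by (intro integral_mono) auto
  also have "\<dots> = B * L1_norm f" by (simp add: L1_norm_def)
  finally show "norm (\<integral>x. f x * \<phi> x \<partial>\<mu>) \<le> B * L1_norm f" .
qed

lemma L1_dual_cos_shift_bcontfun:
  assumes m: "m \<in> L1_dual \<mu>" and g: "integrable \<mu> g"
  shows "(\<lambda>y. m (L1_class \<mu> (cos_shift g y))) \<in> bcontfun"
proof -
  obtain C where C: "0 < C" "\<And>f. integrable \<mu> f \<Longrightarrow> norm (m (L1_class \<mu> f)) \<le> C * L1_norm f"
    by (rule L1_dual_bounded[OF m]) blast
  define \<phi> where "\<phi> y = m (L1_class \<mu> (cos_shift g y))" for y
  have "isCont \<phi> y" for y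
    unfolding isCont_def
  proof (rule tendstoI)
    fix \<epsilon> :: real assume "0 < \<epsilon>"
    then have "0 < \<epsilon> / C" using C(1) by simp
    from L1_continuous_cos_shift[OF g this, of y]
    have "\<forall>\<^sub>F z in nhds y. dist (\<phi> z) (\<phi> y) < \<epsilon>"
    proof eventually_elim
      case (elim z)
      have "dist (\<phi> z) (\<phi> y) = norm (m (L1_class \<mu> (\<lambda>x. cos_shift g z x - cos_shift g y x)))"
        using integrable_cos_shift[OF g] by (simp add: \<phi>_def dist_norm L1_dual_diff[OF m])
      also have "\<dots> \<le> C * L1_norm (\<lambda>x. cos_shift g z x - cos_shift g y x)"
        using integrable_cos_shift[OF g] by (intro C(2)) simp
      also have "\<dots> < C * (\<epsilon> / C)" using elim C(1) by (intro mult_strict_left_mono)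
      finally show ?case using C(1) by simp
    qed
    then show "\<forall>\<^sub>F z in at y. dist (\<phi> z) (\<phi> y) < \<epsilon>"
      by (rule filter_leD[OF at_within_le_nhds])
  qed
  then have "continuous_on UNIV \<phi>" by (simp add: continuous_at_imp_continuous_on)
  moreover have "norm (\<phi> y) \<le> C * L1_norm g" for y
  proof -
    have "norm (\<phi> y) \<le> C * L1_norm (cos_shift g y)"
      unfolding \<phi>_def by (rule C(2)[OF integrable_cos_shift[OF g]])
    also have "\<dots> \<le> C * L1_norm g"
      using C(1) L1_norm_cos_shift_le[OF g] by (intro mult_left_mono) simp_all
    finally show ?thesis .
  qed
  ultimately have "\<phi> \<in> bcontfun" by (intro bcontfun_normI)
  then show ?thesis by (simp add: \<phi>_def[abs_def])
qed

text \<open>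
  A bounded functional may be pulled inside the vector-valued integral
  \<open>f \<star> g = \<integral> f y S\<^sub>y g dy\<close>.  Let \<open>C\<close> bound the norm of \<open>m\<close>.  The difference \<open>D f\<close> of the two
  sides is additive in \<open>f\<close>, at most \<open>2 C \<epsilon> \<parallel>f\<parallel>\<close> when \<open>S\<^sub>y g\<close> stays within \<open>\<epsilon>\<close> of a fixed
  \<open>S\<^sub>a g\<close> for all \<open>y\<close> with \<open>f y \<noteq> 0\<close>, and at most a constant times \<open>\<parallel>f\<parallel>\<close> in general.  Cutting \<open>f\<close> along a finite cover of a compact set, up to
  a small tail, gives \<open>D f = 0\<close>.
\<close>

lemma L1_dual_cos_conv:
  assumes m: "m \<in> L1_dual \<mu>" and f: "integrable \<mu> f" and g: "integrable \<mu> g"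
  shows "m (L1_class \<mu> (cos_conv \<mu> f g)) = (\<integral>y. f y * m (L1_class \<mu> (cos_shift g y)) \<partial>\<mu>)"
proof -
  obtain C where C: "0 < C" "\<And>f. integrable \<mu> f \<Longrightarrow> norm (m (L1_class \<mu> f)) \<le> C * L1_norm f"
    by (rule L1_dual_bounded[OF m]) blast
  define \<phi> where "\<phi> y = m (L1_class \<mu> (cos_shift g y))" for y
  have "\<phi> \<in> bcontfun" unfolding \<phi>_def[abs_def] by (rule L1_dual_cos_shift_bcontfun[OF m g])
  then obtain B where \<phi>m: "\<phi> \<in> borel_measurable borel" and B: "\<And>x. norm (\<phi> x) \<le> B"
    by (rule bcontfunE_borel) blast
  define D where "D f = m (L1_class \<mu> (cos_conv \<mu> f g)) - (\<integral>y. f y * \<phi> y \<partial>\<mu>)" for f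
  have int\<phi>: "integrable \<mu> (\<lambda>y. f y * \<phi> y)" if "integrable \<mu> f" for f
    by (rule integrable_times_bounded(1)[OF that \<phi>m B])
  have D_add: "D (\<lambda>y. f1 y + f2 y) = D f1 + D f2" if f12: "integrable \<mu> f1" "integrable \<mu> f2" for f1 f2
  proof -
    have "L1_class \<mu> (cos_conv \<mu> (\<lambda>y. f1 y + f2 y) g) = L1_class \<mu> (\<lambda>x. cos_conv \<mu> f1 g x + cos_conv \<mu> f2 g x)"
      by (intro L1_class_cong_AE cos_conv_add_AE integrable_cos_conv Bochner_Integration.integrable_add f12 g)
    also have "m \<dots> = m (L1_class \<mu> (cos_conv \<mu> f1 g)) + m (L1_class \<mu> (cos_conv \<mu> f2 g))"
      by (intro L1_dual_add m integrable_cos_conv f12 g)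
    finally show ?thesis
      using int\<phi>[OF f12(1)] int\<phi>[OF f12(2)] by (simp add: D_def distrib_right)
  qed
  \<comment> \<open>Both sides are compared with \<open>(\<integral> f) * \<phi> a\<close>.\<close>
  have D_local: "norm (D f) \<le> 2 * C * \<epsilon> * L1_norm f"
    if f: "integrable \<mu> f" and near: "\<And>y. f y \<noteq> 0 \<Longrightarrow> L1_norm (\<lambda>x. cos_shift g y x - cos_shift g a x) \<le> \<epsilon>" for f a \<epsilon>
  proof -
    define I where "I = (\<integral>y. f y \<partial>\<mu>)"
    have ints: "integrable \<mu> (cos_conv \<mu> f g)" "integrable \<mu> (\<lambda>x. I * cos_shift g a x)"
      using integrable_cos_conv[OF f g] integrable_cos_shift[OF g, of a] by simp_all
    have "m (L1_class \<mu> (cos_conv \<mu> f g)) - I * \<phi> a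
        = m (L1_class \<mu> (\<lambda>x. cos_conv \<mu> f g x - I * cos_shift g a x))"
      unfolding \<phi>_def L1_dual_diff[OF m ints] L1_dual_scale[OF m integrable_cos_shift[OF g]] ..
    also have "norm \<dots> \<le> C * L1_norm (\<lambda>x. cos_conv \<mu> f g x - I * cos_shift g a x)"
      using ints by (intro C(2)) simp
    also have "\<dots> \<le> C * (\<epsilon> * L1_norm f)"
      using cos_conv_near_shift[OF f g near] C(1) unfolding I_def by (intro mult_left_mono) simp_all
    finally have 1: "norm (m (L1_class \<mu> (cos_conv \<mu> f g)) - I * \<phi> a) \<le> C * (\<epsilon> * L1_norm f)" .
    have "norm (\<phi> y - \<phi> a) \<le> C * \<epsilon>" if "f y \<noteq> 0" for y
    proof -
      have "norm (\<phi> y - \<phi> a) = norm (m (L1_class \<mu> (\<lambda>x. cos_shift g y x - cos_shift g a x)))"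
        using integrable_cos_shift[OF g] by (simp add: \<phi>_def L1_dual_diff[OF m])
      also have "\<dots> \<le> C * L1_norm (\<lambda>x. cos_shift g y x - cos_shift g a x)"
        using integrable_cos_shift[OF g] by (intro C(2)) simp
      also have "\<dots> \<le> C * \<epsilon>" using near[OF that] C(1) by simp
      finally show ?thesis .
    qed
    moreover have "(\<lambda>y. \<phi> y - \<phi> a) \<in> borel_measurable borel" using \<phi>m by measurable
    ultimately have "norm (\<integral>y. f y * (\<phi> y - \<phi> a) \<partial>\<mu>) \<le> C * \<epsilon> * L1_norm f"
      by (intro integrable_times_bounded(2)[OF f])
    also have "(\<integral>y. f y * (\<phi> y - \<phi> a) \<partial>\<mu>) = (\<integral>y. f y * \<phi> y \<partial>\<mu>) - I * \<phi> a"
      using int\<phi>[OF f] f by (simp add: right_diff_distrib I_def)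
    finally have 2: "norm ((\<integral>y. f y * \<phi> y \<partial>\<mu>) - I * \<phi> a) \<le> C * \<epsilon> * L1_norm f" .
    have "D f = (m (L1_class \<mu> (cos_conv \<mu> f g)) - I * \<phi> a) - ((\<integral>y. f y * \<phi> y \<partial>\<mu>) - I * \<phi> a)"
      by (simp add: D_def)
    also have "norm \<dots> \<le> C * (\<epsilon> * L1_norm f) + C * \<epsilon> * L1_norm f"
      by (rule order_trans[OF norm_triangle_ineq4 add_mono[OF 1 2]])
    finally show ?thesis by simp
  qed
  have D_global: "norm (D f) \<le> (C * L1_norm g + B) * L1_norm f" if f: "integrable \<mu> f" for f
  proof -
    have "norm (m (L1_class \<mu> (cos_conv \<mu> f g))) \<le> C * (L1_norm g * L1_norm f)"
      by (rule order_trans[OF C(2)[OF integrable_cos_conv[OF f g]]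
          mult_left_mono[OF L1_norm_cos_conv_le[OF f g] less_imp_le[OF C(1)]]])
    moreover have "norm (\<integral>y. f y * \<phi> y \<partial>\<mu>) \<le> B * L1_norm f"
      by (rule integrable_times_bounded(2)[OF f \<phi>m B])
    ultimately have "norm (D f) \<le> C * (L1_norm g * L1_norm f) + B * L1_norm f"
      unfolding D_def by (rule order_trans[OF norm_triangle_ineq4 add_mono])
    then show ?thesis by (simp add: algebra_simps)
  qed
  have split: "integrable \<mu> (\<lambda>y. indicator A y * f y)" "integrable \<mu> (\<lambda>y. indicator (- A) y * f y)"
      "D f = D (\<lambda>y. indicator A y * f y) + D (\<lambda>y. indicator (- A) y * f y)"
      "L1_norm f = L1_norm (\<lambda>y. indicator A y * f y) + L1_norm (\<lambda>y. indicator (- A) y * f y)"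
    if f: "integrable \<mu> f" and A: "A \<in> sets borel" for f and A
  proof -
    show ints: "integrable \<mu> (\<lambda>y. indicator A y * f y)" "integrable \<mu> (\<lambda>y. indicator (- A) y * f y)"
      using A by (auto intro!: integrable_indicator_times f)
    have "f = (\<lambda>y. indicator A y * f y + indicator (- A) y * f y)"
      by (auto split: split_indicator)
    then show "D f = D (\<lambda>y. indicator A y * f y) + D (\<lambda>y. indicator (- A) y * f y)"
      using D_add[OF ints] by simp
    have "L1_norm f = (\<integral>y. norm (indicator A y * f y) + norm (indicator (- A) y * f y) \<partial>\<mu>)"
      unfolding L1_norm_def by (intro Bochner_Integration.integral_cong) (auto split: split_indicator)
    then show "L1_norm f = L1_norm (\<lambda>y. indicator A y * f y) + L1_norm (\<lambda>y. indicator (- A) y * f y)"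
      using ints by (simp add: L1_norm_def)
  qed
  have D_cover: "norm (D f) \<le> 2 * C * \<epsilon> * L1_norm f"
    if "finite I" "\<And>a. a \<in> I \<Longrightarrow> open (V a)"
      "\<And>a y. a \<in> I \<Longrightarrow> y \<in> V a \<Longrightarrow> L1_norm (\<lambda>x. cos_shift g y x - cos_shift g a x) \<le> \<epsilon>"
      "integrable \<mu> f" "\<And>y. y \<notin> (\<Union>a\<in>I. V a) \<Longrightarrow> f y = 0" for I V f \<epsilon>
    using that
  proof (induction I arbitrary: f rule: finite_induct)
    case empty
    then have "L1_norm f = 0" by (simp add: L1_norm_def)
    then show ?case using D_global[OF empty(3)] by simp
  next
    case (insert a I)
    have V: "V a \<in> sets borel" using insert.prems(1) by simp
    note sp = split[OF insert.prems(3) V]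
    have "norm (D (\<lambda>y. indicator (V a) y * f y)) \<le> 2 * C * \<epsilon> * L1_norm (\<lambda>y. indicator (V a) y * f y)"
      using insert.prems(2)[of a] by (intro D_local[where a=a] sp) (auto split: split_indicator_asm)
    moreover have "norm (D (\<lambda>y. indicator (- V a) y * f y)) \<le> 2 * C * \<epsilon> * L1_norm (\<lambda>y. indicator (- V a) y * f y)"
    proof (rule insert.IH)
      show "indicator (- V a) y * f y = 0" if "y \<notin> (\<Union>a\<in>I. V a)" for y
        using that insert.prems(4)[of y] by (cases "y \<in> V a") auto
    qed (use insert.prems sp in auto)
    ultimately have "norm (D f) \<le> 2 * C * \<epsilon> * L1_norm (\<lambda>y. indicator (V a) y * f y)
        + 2 * C * \<epsilon> * L1_norm (\<lambda>y. indicator (- V a) y * f y)"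
      unfolding sp(3) by (rule order_trans[OF norm_triangle_ineq add_mono])
    also have "\<dots> = 2 * C * \<epsilon> * L1_norm f" unfolding sp(4) by (simp add: distrib_left)
    finally show ?case .
  qed
  \<comment> \<open>\<open>M\<close> collects the main part, cut along the cover, and the tail off a compact set.\<close>
  define M where "M = 2 * C * L1_norm f + (C * L1_norm g + B)"
  have B0: "0 \<le> B" using B[of 0] norm_ge_zero order_trans by blast
  have M0: "0 \<le> M" unfolding M_def using C(1) B0 by (simp add: L1_norm_nonneg)
  have D_small: "norm (D f) \<le> \<epsilon> * M" if \<epsilon>: "0 < \<epsilon>" for \<epsilon>
  proof -
    obtain K where K: "compact K" "L1_norm (\<lambda>x. indicator (- K) x * f x) < \<epsilon>"
      by (rule L1_tail_compact[OF f \<epsilon>])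
    have KB: "K \<in> sets borel" using compact_imp_closed[OF K(1)] by simp
    have "\<forall>a. \<exists>V. open V \<and> a \<in> V \<and> (\<forall>y\<in>V. L1_norm (\<lambda>x. cos_shift g y x - cos_shift g a x) < \<epsilon>)"
      using L1_continuous_cos_shift[OF g \<epsilon>] unfolding eventually_nhds by simp
    from choice[OF this] obtain V where
      V: "\<forall>a. open (V a) \<and> a \<in> V a \<and> (\<forall>y\<in>V a. L1_norm (\<lambda>x. cos_shift g y x - cos_shift g a x) < \<epsilon>)"
      by (elim exE)
    have "\<And>a. a \<in> K \<Longrightarrow> open (V a)" "K \<subseteq> (\<Union>a\<in>K. V a)" using V by auto
    then obtain I where I: "I \<subseteq> K" "finite I" "K \<subseteq> (\<Union>a\<in>I. V a)"
      by (rule compactE_image[OF K(1)])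
    note sp = split[OF f KB]
    have "norm (D (\<lambda>y. indicator K y * f y)) \<le> 2 * C * \<epsilon> * L1_norm (\<lambda>y. indicator K y * f y)"
    proof (rule D_cover[OF I(2), where V=V])
      show "indicator K y * f y = 0" if "y \<notin> (\<Union>a\<in>I. V a)" for y
        using that I(3) by (auto split: split_indicator)
    qed (use V sp in \<open>auto intro: less_imp_le\<close>)
    also have "\<dots> \<le> 2 * C * \<epsilon> * L1_norm f"
      unfolding sp(4) using C(1) \<epsilon> by (intro mult_left_mono) (auto simp: L1_norm_nonneg)
    finally have 1: "norm (D (\<lambda>y. indicator K y * f y)) \<le> 2 * C * \<epsilon> * L1_norm f" .
    have "norm (D (\<lambda>y. indicator (- K) y * f y)) \<le> (C * L1_norm g + B) * L1_norm (\<lambda>y. indicator (- K) y * f y)"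
      by (rule D_global[OF sp(2)])
    also have "\<dots> \<le> (C * L1_norm g + B) * \<epsilon>"
      using K(2) C(1) B0 by (intro mult_left_mono) (auto simp: L1_norm_nonneg)
    finally have 2: "norm (D (\<lambda>y. indicator (- K) y * f y)) \<le> (C * L1_norm g + B) * \<epsilon>" .
    have "norm (D f) \<le> 2 * C * \<epsilon> * L1_norm f + (C * L1_norm g + B) * \<epsilon>"
      unfolding sp(3) by (rule order_trans[OF norm_triangle_ineq add_mono[OF 1 2]])
    then show ?thesis unfolding M_def by (simp add: algebra_simps)
  qed
  have "D f = 0"
  proof (rule ccontr)
    assume "D f \<noteq> 0"
    then have pos: "0 < norm (D f) / (2 * (M + 1))" using M0 by simp
    have "M / (2 * (M + 1)) < 1" using M0 by simp
    then have "norm (D f) * (M / (2 * (M + 1))) < norm (D f) * 1"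
      using \<open>D f \<noteq> 0\<close> by (intro mult_strict_left_mono) simp_all
    then show False using D_small[OF pos] by simp
  qed
  then show ?thesis by (simp add: D_def \<phi>_def)
qed

end

section \<open>Multiplicative functionals and the cosine class\<close>

lemma bcontfun_cos_shift:
  fixes \<phi> :: "'a::{topological_ab_group_add, t2_space} \<Rightarrow> complex"
  assumes "\<phi> \<in> bcontfun"
  shows "cos_shift \<phi> y \<in> bcontfun"
proof -
  obtain B where c: "continuous_on UNIV \<phi>" and B: "\<And>x. norm (\<phi> x) \<le> B"
    by (rule bcontfunE_borel[OF assms]) blast
  have "continuous_on UNIV (\<lambda>x. \<phi> (x + y))" "continuous_on UNIV (\<lambda>x. \<phi> (x - y))"
    by (rule continuous_on_compose2[OF c];
        auto intro: continuous_on_add continuous_on_diff continuous_on_id continuous_on_const)+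
  then have "continuous_on UNIV (cos_shift \<phi> y)"
    unfolding cos_shift_def by (intro continuous_on_divide continuous_on_add continuous_on_const) auto
  moreover have "norm (cos_shift \<phi> y x) \<le> B" for x
    using norm_triangle_ineq[of "\<phi> (x + y)" "\<phi> (x - y)"] B[of "x + y"] B[of "x - y"]
    by (simp add: cos_shift_def norm_divide)
  ultimately show ?thesis by (rule bcontfun_normI)
qed

lemma bcontfun_scale: "\<phi> \<in> bcontfun \<Longrightarrow> (\<lambda>x. c * \<phi> x :: complex) \<in> bcontfun"
proof -
  assume "\<phi> \<in> bcontfun"
  then obtain B where c: "continuous_on UNIV \<phi>" and B: "\<And>x. norm (\<phi> x) \<le> B"
    by (rule bcontfunE_borel) blast
  show ?thesis
  proof (rule bcontfun_normI)
    show "continuous_on UNIV (\<lambda>x. c * \<phi> x)" by (intro continuous_on_mult c continuous_on_const)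
    show "norm (c * \<phi> x) \<le> norm c * B" for x unfolding norm_mult by (intro mult_left_mono B) simp
  qed
qed

lemma cos_class_iff: "\<phi> \<in> cos_class \<longleftrightarrow>
    \<phi> \<in> bcontfun \<and> \<phi> \<noteq> (\<lambda>_. 0) \<and> (\<forall>x y. cos_shift \<phi> y x = \<phi> y * \<phi> x)"
  unfolding cos_class_def cos_shift_def by (simp add: mult.commute eq_commute)

text \<open>
  With \<open>M\<close> the supremum of the norm of \<open>\<phi>\<close>, the cosine equation bounds \<open>\<phi> x * \<phi> y\<close> by \<open>M\<close>.
  Taking the supremum over \<open>y\<close> gives \<open>\<bar>\<phi> x\<bar> * M \<le> M\<close>.
\<close>

lemma norm_cos_class_le_1:
  assumes \<phi>: "\<phi> \<in> cos_class"
  shows "norm (\<phi> x) \<le> 1"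
proof (rule ccontr)
  assume "\<not> norm (\<phi> x) \<le> 1"
  then have gt: "1 < norm (\<phi> x)" by simp
  then have pos: "0 < norm (\<phi> x)" by (rule order_less_trans[OF zero_less_one])
  have "\<phi> \<in> bcontfun" using \<phi> by (simp add: cos_class_iff)
  then obtain B where B: "\<And>x. norm (\<phi> x) \<le> B" by (rule bcontfunE_borel) blast
  define M where "M = (SUP y. norm (\<phi> y))"
  have bdd: "bdd_above (range (\<lambda>y. norm (\<phi> y)))" by (rule bdd_aboveI2) (rule B)
  have le: "norm (\<phi> y) \<le> M" for y unfolding M_def by (rule cSUP_upper[OF UNIV_I bdd])
  have "norm (\<phi> y) \<le> M / norm (\<phi> x)" for y
  proof -
    have "norm (\<phi> y) * norm (\<phi> x) = norm (\<phi> (x + y) + \<phi> (x - y)) / 2"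
      using \<phi> by (simp add: cos_class_iff cos_shift_def norm_divide flip: norm_mult)
    also have "\<dots> \<le> (M + M) / 2"
      by (intro divide_right_mono order_trans[OF norm_triangle_ineq add_mono] le) simp
    finally have "norm (\<phi> y) * norm (\<phi> x) \<le> M" by simp
    then show ?thesis by (rule pos_le_divide_eq[OF pos, THEN iffD2])
  qed
  then have "M \<le> M / norm (\<phi> x)" unfolding M_def by (intro cSUP_least) auto
  then have "M * norm (\<phi> x) \<le> M * 1" using pos_le_divide_eq[OF pos] by simp
  moreover have "0 < M" using le[of x] gt by simp
  ultimately show False using gt by simp
qed

context lca_haar
begin

lemma bcontfun_pairing_integrable:
  fixes f \<psi> :: "'a \<Rightarrow> complex"
  assumes "integrable \<mu> f" "\<psi> \<in> bcontfun"
  shows "integrable \<mu> (\<lambda>x. f x * \<psi> x)"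
proof -
  obtain B where "\<psi> \<in> borel_measurable borel" "\<And>x. norm (\<psi> x) \<le> B"
    by (rule bcontfunE_borel[OF assms(2)]) blast
  then show ?thesis by (intro integrable_times_bounded(1)[OF assms(1)])
qed

text \<open>
  Where \<open>\<phi>\<close> and \<open>\<psi>\<close> differ, test with a bump function times the conjugate of the difference:
  the integral of the test function against the difference then has positive real part, since
  nonempty open sets have positive measure.
\<close>

lemma bcontfun_determined_by_integrals:
  fixes \<phi> \<psi> :: "'a \<Rightarrow> complex"
  assumes \<phi>: "\<phi> \<in> bcontfun" and \<psi>: "\<psi> \<in> bcontfun"
    and eq: "\<And>f. integrable \<mu> f \<Longrightarrow> (\<integral>x. f x * \<phi> x \<partial>\<mu>) = (\<integral>x. f x * \<psi> x \<partial>\<mu>)"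
  shows "\<phi> = \<psi>"
proof (rule ccontr)
  assume "\<phi> \<noteq> \<psi>"
  then obtain x0 where x0: "\<phi> x0 - \<psi> x0 \<noteq> 0" by (auto simp: fun_eq_iff)
  define c where "c = cnj (\<phi> x0 - \<psi> x0)"
  define r where "r x = Re (c * (\<phi> x - \<psi> x))" for x
  have cont: "continuous_on UNIV \<phi>" "continuous_on UNIV \<psi>" using \<phi> \<psi> by (auto simp: bcontfun_def)
  have r: "continuous_on UNIV r"
    unfolding r_def by (intro continuous_on_Re continuous_on_mult continuous_on_diff continuous_on_const cont)
  have "c * (\<phi> x0 - \<psi> x0) = complex_of_real ((norm (\<phi> x0 - \<psi> x0))\<^sup>2)"
    unfolding c_def by (metis complex_norm_square mult.commute)
  then have r0: "0 < r x0" unfolding r_def using x0 by simp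
  have V: "open {x. 0 < r x}" by (intro open_Collect_less continuous_on_const r)
  obtain h :: "'a \<Rightarrow> real" and L where h: "continuous_on UNIV h" "\<And>x. 0 \<le> h x \<and> h x \<le> 1"
      "\<And>x. x \<in> {x0} \<Longrightarrow> h x = 1" "\<And>x. x \<notin> {x. 0 < r x} \<Longrightarrow> h x = 0" "compact L" "\<And>x. x \<notin> L \<Longrightarrow> h x = 0"
    by (rule Urysohn_compact_support[OF compact_sing V, of x0]) (use r0 in auto)
  have inth: "integrable \<mu> h" by (rule integrable_bump[OF h(1,2,5,6)])
  \<comment> \<open>The factor \<open>c\<close> turns \<open>\<phi> - \<psi>\<close> near \<open>x0\<close> into a function with positive real part.\<close>
  define f where "f x = complex_of_real (h x) * c" for x
  have f: "integrable \<mu> f" unfolding f_def using inth by simp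
  note ints = bcontfun_pairing_integrable[OF f \<phi>] bcontfun_pairing_integrable[OF f \<psi>]
  have re: "h x * r x = Re (f x * \<phi> x - f x * \<psi> x)" for x
    unfolding f_def r_def by (simp add: algebra_simps)
  have int: "integrable \<mu> (\<lambda>x. h x * r x)"
    unfolding re using ints by (intro integrable_Re Bochner_Integration.integrable_diff)
  have "(\<integral>x. h x * r x \<partial>\<mu>) = Re (\<integral>x. f x * \<phi> x - f x * \<psi> x \<partial>\<mu>)"
    unfolding re using ints by (intro integral_Re Bochner_Integration.integrable_diff)
  also have "(\<integral>x. f x * \<phi> x - f x * \<psi> x \<partial>\<mu>) = 0"
    using ints eq[OF f] by simp
  finally have "(\<integral>x. h x * r x \<partial>\<mu>) = 0" by simp
  moreover have "(\<integral>x. h x * r x \<partial>\<mu>) \<noteq> 0"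
  proof (rule integral_continuous_pos[OF _ _ _ int])
    show "continuous_on UNIV (\<lambda>x. h x * r x)" by (intro continuous_on_mult h(1) r)
    show "0 \<le> h x * r x" for x
      using h(2)[of x] h(4)[of x] by (cases "0 < r x") auto
    show "0 < h x0 * r x0" using h(3) r0 by simp
  qed
  ultimately show False by simp
qed

text \<open>
  The two halves of \<open>S\<^sub>y\<close> are translations by \<open>y\<close> and by \<open>- y\<close>, adjoint to each other.
\<close>

lemma integral_cos_shift_symmetric:
  assumes g: "integrable \<mu> g" and \<psi>: "\<psi> \<in> bcontfun"
  shows "(\<integral>x. cos_shift g y x * \<psi> x \<partial>\<mu>) = (\<integral>x. g x * cos_shift \<psi> y x \<partial>\<mu>)"
proof -
  obtain B where \<psi>m: "\<psi> \<in> borel_measurable borel" and B: "\<And>x. norm (\<psi> x) \<le> B"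
    by (rule bcontfunE_borel[OF \<psi>]) blast
  have gm: "g \<in> borel_measurable borel" by (rule borel_measurable_of_integrable[OF g])
  have moved: "(\<integral>x. g (x + a) * \<psi> x \<partial>\<mu>) = (\<integral>x. g x * \<psi> (x + - a) \<partial>\<mu>)" for a
  proof -
    have "(\<lambda>x. \<psi> (x + - a)) \<in> borel_measurable borel" by (rule measurable_add_arg[OF \<psi>m])
    with gm have "(\<lambda>x. g x * \<psi> (x + - a)) \<in> borel_measurable borel" by (rule borel_measurable_times)
    from integral_translate[OF this, of a] show ?thesis by simp
  qed
  have i1: "integrable \<mu> (\<lambda>x. g (x + a) * \<psi> x)" for a
    by (rule integrable_times_bounded(1)[OF integrable_translate[OF g] \<psi>m B])
  have i2: "integrable \<mu> (\<lambda>x. g x * \<psi> (x + a))" for a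
    by (rule integrable_times_bounded(1)[OF g measurable_add_arg[OF \<psi>m] B])
  have "(\<integral>x. cos_shift g y x * \<psi> x \<partial>\<mu>) = (\<integral>x. (g (x + y) * \<psi> x + g (x + - y) * \<psi> x) / 2 \<partial>\<mu>)"
    by (simp add: cos_shift_def distrib_right)
  also have "\<dots> = ((\<integral>x. g (x + y) * \<psi> x \<partial>\<mu>) + (\<integral>x. g (x + - y) * \<psi> x \<partial>\<mu>)) / 2"
    using Bochner_Integration.integral_add[OF i1 i1, of y "- y"] by simp
  also have "\<dots> = ((\<integral>x. g x * \<psi> (x + - y) \<partial>\<mu>) + (\<integral>x. g x * \<psi> (x + - (- y)) \<partial>\<mu>)) / 2"
    unfolding moved ..
  also have "\<dots> = (\<integral>x. (g x * \<psi> (x + - y) + g x * \<psi> (x + - (- y))) / 2 \<partial>\<mu>)"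
    using Bochner_Integration.integral_add[OF i2 i2, of "- y" "- (- y)"] by simp
  also have "\<dots> = (\<integral>x. g x * cos_shift \<psi> y x \<partial>\<mu>)"
    by (simp add: cos_shift_def distrib_left add.commute)
  finally show ?thesis .
qed

text \<open>
  The inverse of \<open>cos_beta\<close> on the cosine class.  The choice of a representative does not
  matter, by \<open>integral_functional_L1_class\<close>.
\<close>

definition integral_functional :: "('a \<Rightarrow> complex) \<Rightarrow> ('a \<Rightarrow> complex) set \<Rightarrow> complex" where
  "integral_functional \<phi> = (\<lambda>F\<in>L1 \<mu>. \<integral>x. (SOME f. f \<in> F) x * \<phi> x \<partial>\<mu>)"

lemma integral_functional_L1_class:
  assumes f: "integrable \<mu> f" and \<phi>: "\<phi> \<in> bcontfun"
  shows "integral_functional \<phi> (L1_class \<mu> f) = (\<integral>x. f x * \<phi> x \<partial>\<mu>)"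
proof -
  define h where "h = (SOME h. h \<in> L1_class \<mu> f)"
  have "h \<in> L1_class \<mu> f" unfolding h_def by (rule someI[of "\<lambda>h. h \<in> L1_class \<mu> f"]) (rule L1_class_self[OF f])
  then have h: "integrable \<mu> h" "AE x in \<mu>. f x = h x" using L1_class_memD by blast+
  have "(\<integral>x. h x * \<phi> x \<partial>\<mu>) = (\<integral>x. f x * \<phi> x \<partial>\<mu>)"
  proof (rule integral_cong_AE)
    show "AE x in \<mu>. h x * \<phi> x = f x * \<phi> x" using h(2) by eventually_elim simp
  qed (use bcontfun_pairing_integrable[OF _ \<phi>] f h(1) in auto)
  then show ?thesis by (simp add: integral_functional_def L1_class_in_L1[OF f] h_def)
qed

lemma integral_functional_in_L1_dual:
  assumes \<phi>: "\<phi> \<in> bcontfun"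
  shows "integral_functional \<phi> \<in> L1_dual \<mu>"
proof -
  obtain B where \<phi>m: "\<phi> \<in> borel_measurable borel" and B: "\<And>x. norm (\<phi> x) \<le> B"
    by (rule bcontfunE_borel[OF \<phi>]) blast
  have B0: "0 \<le> B" using B[of 0] norm_ge_zero order_trans by blast
  note val = integral_functional_L1_class[OF _ \<phi>] and int = bcontfun_pairing_integrable[OF _ \<phi>]
  have "integral_functional \<phi> \<in> extensional (L1 \<mu>)" by (simp add: integral_functional_def)
  moreover have "integral_functional \<phi> (L1_class \<mu> (\<lambda>x. f x + g x))
      = integral_functional \<phi> (L1_class \<mu> f) + integral_functional \<phi> (L1_class \<mu> g)"
    if "integrable \<mu> f" "integrable \<mu> g" for f g
    using that int by (simp add: val distrib_right)
  moreover have "integral_functional \<phi> (L1_class \<mu> (\<lambda>x. c * f x)) = c * integral_functional \<phi> (L1_class \<mu> f)"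
    if "integrable \<mu> f" for c f
    using that by (simp add: val mult.assoc)
  moreover have "\<exists>\<delta>>0. \<forall>g. integrable \<mu> g \<longrightarrow> (\<integral>x. norm (g x - f x) \<partial>\<mu>) < \<delta> \<longrightarrow>
      dist (integral_functional \<phi> (L1_class \<mu> g)) (integral_functional \<phi> (L1_class \<mu> f)) < \<epsilon>"
    if f: "integrable \<mu> f" and \<epsilon>: "0 < \<epsilon>" for f \<epsilon>
  proof (intro exI[of _ "\<epsilon> / (B + 1)"] conjI allI impI)
    show "0 < \<epsilon> / (B + 1)" using \<epsilon> B0 by simp
    fix g assume g: "integrable \<mu> g" "(\<integral>x. norm (g x - f x) \<partial>\<mu>) < \<epsilon> / (B + 1)"
    have "dist (integral_functional \<phi> (L1_class \<mu> g)) (integral_functional \<phi> (L1_class \<mu> f))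
        = norm (\<integral>x. (g x - f x) * \<phi> x \<partial>\<mu>)"
      using f g(1) int by (simp add: val dist_norm left_diff_distrib)
    also have "\<dots> \<le> B * L1_norm (\<lambda>x. g x - f x)"
      using f g(1) by (intro integrable_times_bounded(2) \<phi>m B) simp
    also have "\<dots> \<le> (B + 1) * L1_norm (\<lambda>x. g x - f x)"
      by (simp add: distrib_right L1_norm_nonneg)
    also have "\<dots> < \<epsilon>" using g(2) B0 by (simp add: L1_norm_def pos_less_divide_eq mult.commute)
    finally show "dist (integral_functional \<phi> (L1_class \<mu> g)) (integral_functional \<phi> (L1_class \<mu> f)) < \<epsilon>" .
  qed
  ultimately show ?thesis unfolding L1_dual_def by blast
qed

lemma integral_functional_in_cos_spectrum:
  assumes "\<phi> \<in> cos_class"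
  shows "integral_functional \<phi> \<in> cos_spectrum \<mu>"
proof -
  have \<phi>: "\<phi> \<in> bcontfun" and nz: "\<phi> \<noteq> (\<lambda>_. 0)" and shift: "\<And>x y. cos_shift \<phi> y x = \<phi> y * \<phi> x"
    using assms by (auto simp: cos_class_iff)
  note dual = integral_functional_in_L1_dual[OF \<phi>] and val = integral_functional_L1_class[OF _ \<phi>]
  have "\<exists>F\<in>L1 \<mu>. integral_functional \<phi> F \<noteq> 0"
  proof (rule ccontr)
    assume "\<not> ?thesis"
    then have "(\<integral>x. f x * \<phi> x \<partial>\<mu>) = (\<integral>x. f x * 0 \<partial>\<mu>)" if "integrable \<mu> f" for f
      using val[OF that] L1_class_in_L1[OF that] by simp
    then have "\<phi> = (\<lambda>_. 0)"
      by (intro bcontfun_determined_by_integrals \<phi> const_bcontfun) blast+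
    with nz show False by contradiction
  qed
  moreover have "integral_functional \<phi> (L1_class \<mu> (cos_conv \<mu> f g))
      = integral_functional \<phi> (L1_class \<mu> f) * integral_functional \<phi> (L1_class \<mu> g)"
    if f: "integrable \<mu> f" and g: "integrable \<mu> g" for f g
  proof -
    have "integral_functional \<phi> (L1_class \<mu> (cos_shift g y)) = \<phi> y * (\<integral>x. g x * \<phi> x \<partial>\<mu>)" for y
    proof -
      have "integral_functional \<phi> (L1_class \<mu> (cos_shift g y)) = (\<integral>x. g x * cos_shift \<phi> y x \<partial>\<mu>)"
        by (simp only: val[OF integrable_cos_shift[OF g]] integral_cos_shift_symmetric[OF g \<phi>])
      also have "\<dots> = (\<integral>x. \<phi> y * (g x * \<phi> x) \<partial>\<mu>)" by (simp only: shift mult.left_commute)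
      finally show ?thesis by simp
    qed
    then show ?thesis
      unfolding L1_dual_cos_conv[OF dual f g] val[OF f] val[OF g] by (simp flip: mult.assoc)
  qed
  ultimately show ?thesis unfolding cos_spectrum_def using dual by blast
qed

text \<open>
  The representing function is \<open>\<phi> y = m (S\<^sub>y g\<^sub>0) / m g\<^sub>0\<close>.  Comparing \<open>m (f \<star> g) = m f * m g\<close>
  with the integral formula for all \<open>f\<close> gives \<open>m (S\<^sub>y g) = \<phi> y * m g\<close>; moving \<open>S\<^sub>y\<close> from
  \<open>g\<close> to \<open>\<phi>\<close> and varying \<open>g\<close> gives the cosine equation \<open>S\<^sub>y \<phi> = \<phi> y * \<phi>\<close>.
\<close>

lemma cos_spectrum_representation:
  assumes "m \<in> cos_spectrum \<mu>"
  obtains \<phi> :: "'a \<Rightarrow> complex" where "\<phi> \<in> cos_class" "\<And>f. integrable \<mu> f \<Longrightarrow> m (L1_class \<mu> f) = (\<integral>x. f x * \<phi> x \<partial>\<mu>)"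
proof -
  have m: "m \<in> L1_dual \<mu>" and mult: "\<And>f g. integrable \<mu> f \<Longrightarrow> integrable \<mu> g \<Longrightarrow>
        m (L1_class \<mu> (cos_conv \<mu> f g)) = m (L1_class \<mu> f) * m (L1_class \<mu> g)"
    using assms unfolding cos_spectrum_def by auto
  obtain F where "F \<in> L1 \<mu>" "m F \<noteq> 0" using assms unfolding cos_spectrum_def by auto
  then obtain g0 where g0: "integrable \<mu> g0" "m (L1_class \<mu> g0) \<noteq> 0" by (auto elim: L1_classE)
  define c where "c = inverse (m (L1_class \<mu> g0))"
  define \<phi> where "\<phi> = (\<lambda>y. c * m (L1_class \<mu> (cos_shift g0 y)))"
  have \<phi>: "\<phi> \<in> bcontfun"
    unfolding \<phi>_def by (rule bcontfun_scale[OF L1_dual_cos_shift_bcontfun[OF m g0(1)]])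
  have rep: "m (L1_class \<mu> f) = (\<integral>x. f x * \<phi> x \<partial>\<mu>)" if f: "integrable \<mu> f" for f
  proof -
    have "m (L1_class \<mu> f) = c * (m (L1_class \<mu> f) * m (L1_class \<mu> g0))"
      using g0(2) by (simp add: c_def)
    also have "\<dots> = c * (\<integral>y. f y * m (L1_class \<mu> (cos_shift g0 y)) \<partial>\<mu>)"
      using mult[OF f g0(1)] L1_dual_cos_conv[OF m f g0(1)] by simp
    also have "\<dots> = (\<integral>y. c * (f y * m (L1_class \<mu> (cos_shift g0 y))) \<partial>\<mu>)" by simp
    also have "\<dots> = (\<integral>x. f x * \<phi> x \<partial>\<mu>)" by (simp only: \<phi>_def mult.left_commute)
    finally show ?thesis .
  qed
  have shift: "m (L1_class \<mu> (cos_shift g y)) = \<phi> y * m (L1_class \<mu> g)" if g: "integrable \<mu> g" for g y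
  proof -
    have "(\<lambda>y. m (L1_class \<mu> (cos_shift g y))) = (\<lambda>y. m (L1_class \<mu> g) * \<phi> y)"
    proof (rule bcontfun_determined_by_integrals[OF L1_dual_cos_shift_bcontfun[OF m g] bcontfun_scale[OF \<phi>]])
      fix f :: "'a \<Rightarrow> complex" assume f: "integrable \<mu> f"
      have "(\<integral>y. f y * m (L1_class \<mu> (cos_shift g y)) \<partial>\<mu>) = m (L1_class \<mu> g) * (\<integral>y. f y * \<phi> y \<partial>\<mu>)"
        using mult[OF f g] L1_dual_cos_conv[OF m f g] rep[OF f] by simp
      also have "\<dots> = (\<integral>y. m (L1_class \<mu> g) * (f y * \<phi> y) \<partial>\<mu>)" by simp
      also have "\<dots> = (\<integral>y. f y * (m (L1_class \<mu> g) * \<phi> y) \<partial>\<mu>)" by (simp only: mult.left_commute)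
      finally show "(\<integral>y. f y * m (L1_class \<mu> (cos_shift g y)) \<partial>\<mu>) = (\<integral>y. f y * (m (L1_class \<mu> g) * \<phi> y) \<partial>\<mu>)" .
    qed
    from fun_cong[OF this, of y] show ?thesis by (simp add: mult.commute)
  qed
  have "cos_shift \<phi> y = (\<lambda>x. \<phi> y * \<phi> x)" for y
  proof (rule bcontfun_determined_by_integrals[OF bcontfun_cos_shift[OF \<phi>] bcontfun_scale[OF \<phi>]])
    fix g :: "'a \<Rightarrow> complex" assume g: "integrable \<mu> g"
    have "(\<integral>x. g x * cos_shift \<phi> y x \<partial>\<mu>) = \<phi> y * (\<integral>x. g x * \<phi> x \<partial>\<mu>)"
      using integral_cos_shift_symmetric[OF g \<phi>, of y] rep[OF integrable_cos_shift[OF g], of y]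
        shift[OF g, of y] rep[OF g] by simp
    also have "\<dots> = (\<integral>x. \<phi> y * (g x * \<phi> x) \<partial>\<mu>)" by simp
    also have "\<dots> = (\<integral>x. g x * (\<phi> y * \<phi> x) \<partial>\<mu>)" by (simp only: mult.left_commute)
    finally show "(\<integral>x. g x * cos_shift \<phi> y x \<partial>\<mu>) = (\<integral>x. g x * (\<phi> y * \<phi> x) \<partial>\<mu>)" .
  qed
  moreover have "\<phi> \<noteq> (\<lambda>_. 0)"
  proof
    assume "\<phi> = (\<lambda>_. 0)"
    then show False using rep[OF g0(1)] g0(2) by simp
  qed
  ultimately have "\<phi> \<in> cos_class" using \<phi> by (simp add: cos_class_iff)
  then show ?thesis using rep that by blast
qed

lemma cos_beta_eqI:
  assumes \<phi>: "\<phi> \<in> cos_class" and rep: "\<And>f. integrable \<mu> f \<Longrightarrow> m (L1_class \<mu> f) = (\<integral>x. f x * \<phi> x \<partial>\<mu>)"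
  shows "cos_beta \<mu> m = \<phi>"
  unfolding cos_beta_def
proof (rule the_equality)
  fix \<psi> assume \<psi>: "\<psi> \<in> cos_class \<and> (\<forall>f. integrable \<mu> f \<longrightarrow> m (L1_class \<mu> f) = (\<integral>x. f x * \<psi> x \<partial>\<mu>))"
  show "\<psi> = \<phi>"
    by (rule bcontfun_determined_by_integrals) (use \<phi> \<psi> rep in \<open>auto simp: cos_class_iff\<close>)
qed (use \<phi> rep in blast)

lemma cos_beta_cos_spectrum:
  assumes "m \<in> cos_spectrum \<mu>"
  shows "cos_beta \<mu> m \<in> cos_class"
    and "integrable \<mu> f \<Longrightarrow> m (L1_class \<mu> f) = (\<integral>x. f x * cos_beta \<mu> m x \<partial>\<mu>)"
proof -
  obtain \<phi> where \<phi>: "\<phi> \<in> cos_class" "\<And>f. integrable \<mu> f \<Longrightarrow> m (L1_class \<mu> f) = (\<integral>x. f x * \<phi> x \<partial>\<mu>)"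
    by (rule cos_spectrum_representation[OF assms]) blast
  have "cos_beta \<mu> m = \<phi>" by (rule cos_beta_eqI[OF \<phi>])
  then show "cos_beta \<mu> m \<in> cos_class"
    "integrable \<mu> f \<Longrightarrow> m (L1_class \<mu> f) = (\<integral>x. f x * cos_beta \<mu> m x \<partial>\<mu>)"
    using \<phi> by simp_all
qed

lemma cos_beta_integral_functional:
  assumes "\<phi> \<in> cos_class"
  shows "cos_beta \<mu> (integral_functional \<phi>) = \<phi>"
  using assms by (intro cos_beta_eqI integral_functional_L1_class) (auto simp: cos_class_iff)

text \<open>
  This is where the compact-open topology enters.  Choose \<open>K\<close> with \<open>\<integral> \<bar>f\<bar>\<close> small off \<open>K\<close>: there
  the difference of two functions of the cosine class is at most 2, and on \<open>K\<close> it is small.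
\<close>

lemma cos_class_pairing_ucc_continuous:
  assumes \<phi>: "\<phi> \<in> cos_class" and f: "integrable \<mu> f" and \<epsilon>: "0 < \<epsilon>"
  obtains K \<delta> where "compact K" "0 < \<delta>"
    "\<And>\<psi>. \<psi> \<in> cos_class \<Longrightarrow> \<forall>x\<in>K. dist (\<psi> x) (\<phi> x) < \<delta> \<Longrightarrow>
       dist (\<integral>x. f x * \<psi> x \<partial>\<mu>) (\<integral>x. f x * \<phi> x \<partial>\<mu>) < \<epsilon>"
proof -
  obtain K where K: "compact K" "L1_norm (\<lambda>x. indicator (- K) x * f x) < \<epsilon> / 4"
    using L1_tail_compact[OF f, of "\<epsilon> / 4"] \<epsilon> by (metis divide_pos_pos zero_less_numeral)
  have KB: "K \<in> sets borel" using compact_imp_closed[OF K(1)] by simp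
  define \<delta> where "\<delta> = \<epsilon> / (2 * (L1_norm f + 1))"
  have n0: "0 < 2 * (L1_norm f + 1)" using L1_norm_nonneg[of f] by simp
  have \<delta>: "0 < \<delta>" unfolding \<delta>_def using \<epsilon> n0 by simp
  have "\<delta> * (2 * (L1_norm f + 1)) = \<epsilon>" unfolding \<delta>_def using n0 by simp
  then have \<delta>f: "\<delta> * L1_norm f < \<epsilon> / 2" using \<delta> by (simp add: algebra_simps)
  have main: "dist (\<integral>x. f x * \<psi> x \<partial>\<mu>) (\<integral>x. f x * \<phi> x \<partial>\<mu>) < \<epsilon>"
    if \<psi>: "\<psi> \<in> cos_class" and near: "\<forall>x\<in>K. dist (\<psi> x) (\<phi> x) < \<delta>" for \<psi>
  proof -
    have b: "\<phi> \<in> bcontfun" "\<psi> \<in> bcontfun" using \<phi> \<psi> by (auto simp: cos_class_iff)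
    have m: "\<phi> \<in> borel_measurable borel" "\<psi> \<in> borel_measurable borel"
      by (rule bcontfunE_borel[OF b(1)], assumption) (rule bcontfunE_borel[OF b(2)], assumption)
    define d where "d x = \<psi> x - \<phi> x" for x
    have dm: "d \<in> borel_measurable borel" unfolding d_def using m by measurable
    have ints: "integrable \<mu> (\<lambda>x. indicator K x * f x)" "integrable \<mu> (\<lambda>x. indicator (- K) x * f x)"
      using KB by (auto intro!: integrable_indicator_times f)
    have dK: "norm (d x) \<le> \<delta>" if "indicator K x * f x \<noteq> 0" for x
      using near that by (cases "x \<in> K") (auto simp: d_def dist_norm less_imp_le)
    have d2: "norm (d x) \<le> 2" for x
      using norm_triangle_ineq4[of "\<psi> x" "\<phi> x"] norm_cos_class_le_1[OF \<phi>, of x] norm_cos_class_le_1[OF \<psi>, of x]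
      by (simp add: d_def)
    have i: "integrable \<mu> (\<lambda>x. indicator K x * f x * d x)" "integrable \<mu> (\<lambda>x. indicator (- K) x * f x * d x)"
      using integrable_times_bounded(1)[OF ints(1) dm d2] integrable_times_bounded(1)[OF ints(2) dm d2] by auto
    have "(\<integral>x. f x * \<psi> x \<partial>\<mu>) - (\<integral>x. f x * \<phi> x \<partial>\<mu>) = (\<integral>x. f x * d x \<partial>\<mu>)"
      using bcontfun_pairing_integrable[OF f b(1)] bcontfun_pairing_integrable[OF f b(2)]
      by (simp add: d_def right_diff_distrib)
    also have "\<dots> = (\<integral>x. indicator K x * f x * d x + indicator (- K) x * f x * d x \<partial>\<mu>)"
      by (intro Bochner_Integration.integral_cong) (auto split: split_indicator)
    also have "\<dots> = (\<integral>x. indicator K x * f x * d x \<partial>\<mu>) + (\<integral>x. indicator (- K) x * f x * d x \<partial>\<mu>)"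
      by (rule Bochner_Integration.integral_add[OF i])
    finally have "dist (\<integral>x. f x * \<psi> x \<partial>\<mu>) (\<integral>x. f x * \<phi> x \<partial>\<mu>)
        \<le> norm (\<integral>x. indicator K x * f x * d x \<partial>\<mu>) + norm (\<integral>x. indicator (- K) x * f x * d x \<partial>\<mu>)"
      by (simp add: dist_norm norm_triangle_ineq)
    also have "\<dots> \<le> \<delta> * L1_norm (\<lambda>x. indicator K x * f x) + 2 * L1_norm (\<lambda>x. indicator (- K) x * f x)"
      by (intro add_mono integrable_times_bounded(2) ints dm dK d2)
    also have "\<dots> \<le> \<delta> * L1_norm f + 2 * L1_norm (\<lambda>x. indicator (- K) x * f x)"
      using \<delta> by (intro add_mono mult_left_mono L1_norm_mono ints f) (auto split: split_indicator)
    also have "\<dots> < \<epsilon>" using \<delta>f K(2) by simp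
    finally show ?thesis .
  qed
  show ?thesis by (rule that[OF K(1) \<delta> main])
qed

end

section \<open>The compact-open topology and openness of \<open>cos_beta\<close>\<close>

text \<open>
  A continuous function attains its maximal distance from \<open>\<phi>\<close> on \<open>K\<close>, so some margin below
  \<open>\<epsilon>\<close> remains.
\<close>

lemma openin_ucc_ball:
  fixes \<phi> :: "'a::topological_space \<Rightarrow> complex"
  assumes K: "compact K" and \<phi>: "\<phi> \<in> bcontfun"
  shows "openin (ucc_topology bcontfun) {\<psi> \<in> bcontfun. \<forall>x\<in>K. dist (\<psi> x) (\<phi> x) < \<epsilon>}"
  unfolding openin_ucc_topology
proof (intro conjI ballI)
  show "{\<psi> \<in> bcontfun. \<forall>x\<in>K. dist (\<psi> x) (\<phi> x) < \<epsilon>} \<subseteq> bcontfun" by (rule Collect_restrict)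
  fix \<psi> assume "\<psi> \<in> {\<psi> \<in> bcontfun. \<forall>x\<in>K. dist (\<psi> x) (\<phi> x) < \<epsilon>}"
  then have \<psi>: "\<psi> \<in> bcontfun" "\<And>x. x \<in> K \<Longrightarrow> dist (\<psi> x) (\<phi> x) < \<epsilon>" by auto
  show "\<exists>L \<eta>. compact L \<and> 0 < \<eta> \<and> {\<theta> \<in> bcontfun. \<forall>x\<in>L. dist (\<theta> x) (\<psi> x) < \<eta>}
      \<subseteq> {\<psi> \<in> bcontfun. \<forall>x\<in>K. dist (\<psi> x) (\<phi> x) < \<epsilon>}"
  proof (cases "K = {}")
    case True
    then show ?thesis by (intro exI[of _ "{}"] exI[of _ 1]) auto
  next
    case False
    have "continuous_on K \<psi>" "continuous_on K \<phi>"
      using \<psi>(1) \<phi> by (auto simp: bcontfun_def intro: continuous_on_subset)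
    then have "continuous_on K (\<lambda>x. dist (\<psi> x) (\<phi> x))" by (intro continuous_on_dist)
    from continuous_attains_sup[OF K False this]
    obtain x0 where x0: "x0 \<in> K" "\<forall>x\<in>K. dist (\<psi> x) (\<phi> x) \<le> dist (\<psi> x0) (\<phi> x0)" by (elim bexE)
    define \<eta> where "\<eta> = \<epsilon> - dist (\<psi> x0) (\<phi> x0)"
    have \<eta>: "0 < \<eta>" using \<psi>(2)[OF x0(1)] by (simp add: \<eta>_def)
    have "dist (\<theta> x) (\<phi> x) < \<epsilon>" if "\<forall>x\<in>K. dist (\<theta> x) (\<psi> x) < \<eta>" "x \<in> K" for \<theta> x
    proof -
      have "dist (\<theta> x) (\<psi> x) < \<eta>" "dist (\<psi> x) (\<phi> x) \<le> dist (\<psi> x0) (\<phi> x0)"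
        using that x0(2) by auto
      then show ?thesis using dist_triangle[of "\<theta> x" "\<phi> x" "\<psi> x"] unfolding \<eta>_def by linarith
    qed
    then show ?thesis using K \<eta> by (intro exI[of _ K] exI[of _ \<eta>]) auto
  qed
qed

text \<open>
  In the subspace, neighbourhoods only have to be checked against functions in \<open>S\<close>, although
  basic sets of the ambient topology consist of arbitrary bounded continuous functions.
\<close>

lemma openin_subtopology_uccI:
  fixes V S :: "('a::topological_space \<Rightarrow> complex) set"
  assumes S: "S \<subseteq> bcontfun" and V: "V \<subseteq> S"
    and nbhd: "\<And>\<phi>. \<phi> \<in> V \<Longrightarrow> \<exists>K \<epsilon>. compact K \<and> 0 < \<epsilon> \<and> {\<psi> \<in> S. \<forall>x\<in>K. dist (\<psi> x) (\<phi> x) < \<epsilon>} \<subseteq> V"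
  shows "openin (subtopology (ucc_topology bcontfun) S) V"
proof -
  define B where "B \<phi> K \<epsilon> = {\<psi> \<in> bcontfun. \<forall>x\<in>K. dist (\<psi> x) (\<phi> x) < \<epsilon>}"
    for \<phi> :: "'a \<Rightarrow> complex" and K and \<epsilon> :: real
  define \<B> where "\<B> = {B \<phi> K \<epsilon> | \<phi> K \<epsilon>. \<phi> \<in> V \<and> compact K \<and> B \<phi> K \<epsilon> \<inter> S \<subseteq> V}"
  have "openin (ucc_topology bcontfun) (\<Union>\<B>)"
  proof (rule openin_Union)
    fix T assume "T \<in> \<B>"
    then obtain \<phi> K \<epsilon> where T: "T = B \<phi> K \<epsilon>" "\<phi> \<in> V" "compact K" unfolding \<B>_def by auto
    have "\<phi> \<in> bcontfun" using T(2) V S by blast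
    then show "openin (ucc_topology bcontfun) T"
      unfolding T(1) B_def by (rule openin_ucc_ball[OF T(3)])
  qed
  moreover have "V = \<Union>\<B> \<inter> S"
  proof (intro subset_antisym subsetI)
    fix \<phi> assume \<phi>: "\<phi> \<in> V"
    from nbhd[OF \<phi>] obtain K \<epsilon> where K: "compact K" "0 < \<epsilon>" "{\<psi> \<in> S. \<forall>x\<in>K. dist (\<psi> x) (\<phi> x) < \<epsilon>} \<subseteq> V"
      by (elim exE conjE)
    have "B \<phi> K \<epsilon> \<inter> S \<subseteq> V" using K(3) unfolding B_def by blast
    then have "B \<phi> K \<epsilon> \<in> \<B>" using \<phi> K(1) unfolding \<B>_def by blast
    moreover have "\<phi> \<in> B \<phi> K \<epsilon>" using \<phi> V S K(2) unfolding B_def by auto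
    ultimately show "\<phi> \<in> \<Union>\<B> \<inter> S" using \<phi> V by blast
  next
    fix \<phi> assume "\<phi> \<in> \<Union>\<B> \<inter> S"
    then show "\<phi> \<in> V" unfolding \<B>_def by blast
  qed
  ultimately show ?thesis unfolding openin_subtopology by blast
qed

context lca_haar
begin

text \<open>
  A weak* neighbourhood of \<open>m\<close> restricts the values at finitely many classes only.  Each of
  these restrictions holds for \<open>m\<^sub>\<psi>\<close> once \<open>\<psi>\<close> is close to \<open>cos_beta \<mu> m\<close> on some compact set,
  and every such \<open>\<psi>\<close> is the image of \<open>m\<^sub>\<psi>\<close>.
\<close>

lemma open_map_cos_beta:
  "open_map (subtopology (weak_star_topology \<mu>) (cos_spectrum \<mu>))
     (subtopology (ucc_topology bcontfun) cos_class) (cos_beta \<mu>)"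
  unfolding open_map_def
proof (intro allI impI)
  fix U assume "openin (subtopology (weak_star_topology \<mu>) (cos_spectrum \<mu>)) U"
  then obtain W where W: "openin (product_topology (\<lambda>_. euclidean) (L1 \<mu>)) W"
    and U: "U = W \<inter> L1_dual \<mu> \<inter> cos_spectrum \<mu>"
    unfolding weak_star_topology_def openin_subtopology by auto
  show "openin (subtopology (ucc_topology bcontfun) cos_class) (cos_beta \<mu> ` U)"
  proof (rule openin_subtopology_uccI)
    show "cos_class \<subseteq> (bcontfun :: ('a \<Rightarrow> complex) set)" by (auto simp: cos_class_iff)
    show "cos_beta \<mu> ` U \<subseteq> cos_class" unfolding U using cos_beta_cos_spectrum(1) by auto
    fix \<phi> assume "\<phi> \<in> cos_beta \<mu> ` U"
    then obtain m where m: "m \<in> W" "m \<in> cos_spectrum \<mu>" "\<phi> = cos_beta \<mu> m" unfolding U by auto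
    have \<phi>: "\<phi> \<in> cos_class" unfolding m(3) by (rule cos_beta_cos_spectrum(1)[OF m(2)])
    from W[unfolded openin_product_topology_alt] m(1)
    obtain X where fin: "finite {F \<in> L1 \<mu>. X F \<noteq> UNIV}" and X: "\<And>F. F \<in> L1 \<mu> \<Longrightarrow> open (X F)"
      and mX: "m \<in> Pi\<^sub>E (L1 \<mu>) X" and XW: "Pi\<^sub>E (L1 \<mu>) X \<subseteq> W"
      by auto
    define J where "J = {F \<in> L1 \<mu>. X F \<noteq> UNIV}"
    have "\<exists>K \<delta>. compact K \<and> 0 < \<delta> \<and> (\<forall>\<psi>\<in>cos_class. (\<forall>x\<in>K. dist (\<psi> x) (\<phi> x) < \<delta>) \<longrightarrow>
        integral_functional \<psi> F \<in> X F)" if F: "F \<in> J" for F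
    proof -
      have FL: "F \<in> L1 \<mu>" using F by (simp add: J_def)
      obtain f where f: "integrable \<mu> f" "F = L1_class \<mu> f" by (rule L1_classE[OF FL])
      have "m F \<in> X F" using mX FL by auto
      then obtain \<epsilon> where \<epsilon>: "0 < \<epsilon>" "\<And>z. dist z (m F) < \<epsilon> \<Longrightarrow> z \<in> X F"
        using X[OF FL] unfolding open_dist by blast
      have mF: "m F = (\<integral>x. f x * \<phi> x \<partial>\<mu>)"
        unfolding f(2) m(3) by (rule cos_beta_cos_spectrum(2)[OF m(2) f(1)])
      obtain K \<delta> where K: "compact K" "0 < \<delta>"
        "\<And>\<psi>. \<psi> \<in> cos_class \<Longrightarrow> \<forall>x\<in>K. dist (\<psi> x) (\<phi> x) < \<delta> \<Longrightarrow>
           dist (\<integral>x. f x * \<psi> x \<partial>\<mu>) (\<integral>x. f x * \<phi> x \<partial>\<mu>) < \<epsilon>"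
        by (rule cos_class_pairing_ucc_continuous[OF \<phi> f(1) \<epsilon>(1)]) blast
      have "integral_functional \<psi> F \<in> X F"
        if \<psi>: "\<psi> \<in> cos_class" and near: "\<forall>x\<in>K. dist (\<psi> x) (\<phi> x) < \<delta>" for \<psi>
      proof (rule \<epsilon>(2))
        have "\<psi> \<in> bcontfun" using \<psi> by (simp add: cos_class_iff)
        then show "dist (integral_functional \<psi> F) (m F) < \<epsilon>"
          unfolding mF using K(3)[OF \<psi> near] by (simp add: f(2) integral_functional_L1_class[OF f(1)])
      qed
      with K(1,2) show ?thesis by blast
    qed
    then have "\<forall>F\<in>J. \<exists>K \<delta>. compact K \<and> 0 < \<delta> \<and> (\<forall>\<psi>\<in>cos_class. (\<forall>x\<in>K. dist (\<psi> x) (\<phi> x) < \<delta>) \<longrightarrow>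
        integral_functional \<psi> F \<in> X F)" by (rule ballI)
    from bchoice[OF this] obtain K where
      "\<forall>F\<in>J. \<exists>\<delta>. compact (K F) \<and> 0 < \<delta> \<and> (\<forall>\<psi>\<in>cos_class. (\<forall>x\<in>K F. dist (\<psi> x) (\<phi> x) < \<delta>) \<longrightarrow>
        integral_functional \<psi> F \<in> X F)" by (elim exE)
    from bchoice[OF this] obtain \<delta> where
      K: "\<forall>F\<in>J. compact (K F) \<and> 0 < \<delta> F \<and> (\<forall>\<psi>\<in>cos_class. (\<forall>x\<in>K F. dist (\<psi> x) (\<phi> x) < \<delta> F) \<longrightarrow>
        integral_functional \<psi> F \<in> X F)" by (elim exE)
    have finJ: "finite J" using fin unfolding J_def .
    \<comment> \<open>The 1 keeps the minimum defined when no class is restricted.\<close>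
    define \<eta> where "\<eta> = Min (insert 1 (\<delta> ` J))"
    have \<eta>: "0 < \<eta>" "\<And>F. F \<in> J \<Longrightarrow> \<eta> \<le> \<delta> F" using finJ K by (auto simp: \<eta>_def)
    have "compact (\<Union>F\<in>J. K F)" using finJ K by (intro compact_UN) auto
    moreover have "\<psi> \<in> cos_beta \<mu> ` U"
      if \<psi>: "\<psi> \<in> cos_class" and near: "\<forall>x\<in>(\<Union>F\<in>J. K F). dist (\<psi> x) (\<phi> x) < \<eta>" for \<psi>
    proof -
      have spec: "integral_functional \<psi> \<in> cos_spectrum \<mu>" by (rule integral_functional_in_cos_spectrum[OF \<psi>])
      have "integral_functional \<psi> F \<in> X F" if "F \<in> L1 \<mu>" for F
      proof (cases "F \<in> J")
        case True
        have "\<forall>x\<in>K F. dist (\<psi> x) (\<phi> x) < \<delta> F" using near \<eta>(2)[OF True] True by fastforce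
        then show ?thesis using K True \<psi> by blast
      next
        case False
        then show ?thesis using that by (simp add: J_def)
      qed
      moreover have "integral_functional \<psi> \<in> extensional (L1 \<mu>)" by (simp add: integral_functional_def)
      ultimately have "integral_functional \<psi> \<in> W" using XW by (auto simp: PiE_def)
      then have "integral_functional \<psi> \<in> U" using spec unfolding U cos_spectrum_def by blast
      then show ?thesis using cos_beta_integral_functional[OF \<psi>] by (metis imageI)
    qed
    ultimately show "\<exists>K \<epsilon>. compact K \<and> 0 < \<epsilon> \<and> {\<psi> \<in> cos_class. \<forall>x\<in>K. dist (\<psi> x) (\<phi> x) < \<epsilon>} \<subseteq> cos_beta \<mu> ` U"
      using \<eta>(1) by (intro exI[of _ "\<Union>F\<in>J. K F"] exI[of _ \<eta>]) blast
  qed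
qed

end

theorem theorem6:
  fixes \<mu> :: "'a::{topological_ab_group_add, t2_space} measure"
  assumes "locally_compact_space (euclidean :: 'a topology)"
    and "haar_measure \<mu>"
  shows "open_map (subtopology (weak_star_topology \<mu>) (cos_spectrum \<mu>))
           (subtopology (ucc_topology bcontfun) cos_class) (cos_beta \<mu>)"
proof -
  interpret lca_haar \<mu> using assms by unfold_locales
  show ?thesis by (rule open_map_cos_beta)
qed

end
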